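(* Let $\mathbf g=(g_1,\dots,g_m)\in M^1(\mathbb R^n)\otimes\mathbb C^m$ generate a multi-window Gabor frame over $\Lambda_D$ with canonical dual $\boldsymbol\gamma$. Let $(w^{(\varepsilon)})_{\varepsilon>0}$ be a family of nonzero envelopes in $\ell^2(\Lambda_D)$ such that for every fixed $\nu\in\Lambda_D$ $$\frac{\|T_\nu w^{(\varepsilon)}-w^{(\varepsilon)}\|_{\ell^2}}{\|w^{(\varepsilon)}\|_{\ell^2}}\longrightarrow0\qquad(\varepsilon\to0),$$ where $(T_\nu w)_\lambda=w_{\lambda-\nu}$. Define $$E_\varepsilon:\mathcal H_{\mathbf d}\to L^2(\mathbb R^n),\qquad E_\varepsilon c:=d^{-1/4}\,\frac{\Psi_c^{w^{(\varepsilon)}}}{\|w^{(\varepsilon)}\|_{\ell^2}} .$$ Then $E_\varepsilon^*E_\varepsilon\to I_{\mathcal H_{\mathbf d}}$ in operator norm as $\varepsilon\to0$. Equivalently, $$\frac{\langle\Psi_c^{w^{(\varepsilon)}},\Psi_{c'}^{w^{(\varepsilon)}}\rangle}{\sqrt d\,\|w^{(\varepsilon)}\|_{\ell^2}^2}\longrightarrow\langle c,c'\rangle$$ uniformly for $c,c'$ in bounded subsets of $\mathcal H_{\mathbf d}$.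
   Context: Inner products are linear in the first variable. $\rho(x,\omega)=e^{-\pi i x\cdot\omega}M_\omega T_x$ on $L^2(\mathbb R^n)$ with $(T_xf)(t)=f(t-x)$, $(M_\omega f)(t)=e^{2\pi i\omega\cdot t}f(t)$. $M^1(\mathbb R^n)$ is the Feichtinger algebra: all $f$ with $z\mapsto\langle f,\rho(z)\varphi\rangle\in L^1(\mathbb R^{2n})$ for a fixed nonzero Schwartz $\varphi$. $D=\operatorname{diag}(d_1,\dots,d_n)$, positive integers $d_1\mid\cdots\mid d_n$, $d=\prod_jd_j$. $\Lambda_D=D^{1/2}\mathbb Z^n\times D^{1/2}\mathbb Z^n$, $\chi_D(D^{1/2}k,D^{1/2}\ell)=(-1)^{k^TD\ell}$, $S_\lambda=\chi_D(\lambda)\rho(\lambda)$ for $\lambda\in\Lambda_D$ (a unitary representation of $\Lambda_D$). $\mathbb Z_{\mathbf d}=\prod_j\mathbb Z_{d_j}$, $\mathcal H_{\mathbf d}=\bigotimes_j\mathbb C^{d_j}$ with orthonormal basis $(e_r)_{r\in\mathbb Z_{\mathbf d}}$, $\delta_r=D^{-1/2}r$. For $h\in M^1(\mathbb R^n)$, $Z_Dh(x,\omega)=\sum_{\gamma\in D^{1/2}\mathbb Z^n}h(x-\gamma)e^{2\pi i\gamma\cdot\omega}$ and $(\mathcal Z_Dh(x,\omega))_r=e^{-2\pi i\delta_r\cdot\omega}Z_Dh(x+\delta_r,\omega)$. Frame data: $\{\rho(\lambda)g_j:\lambda\in\Lambda_D,1\le j\le m\}$ is a frame of $L^2(\mathbb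 R^n)$; canonical dual $\gamma_j=S^{-1}g_j$ with $S$ the frame operator ($\gamma_j\in M^1$). For $c\in\mathcal H_{\mathbf d}$ put $v_r=\mathcal Z_Dg_r(0,0)$, $\Gamma_c=\sum_{r=1}^m\langle c,v_r\rangle\gamma_r\in M^1(\mathbb R^n)$, and for $w\in\ell^2(\Lambda_D)$, $\Psi_c^w=\sum_{\lambda\in\Lambda_D}w_\lambda S_\lambda\Gamma_c\in L^2(\mathbb R^n)$. *)

theory Defs
  imports "HOL-Analysis.Analysis"
begin

text \<open>
  Elements of \<open>L\<^sup>2(\<real>\<^sup>n)\<close> are represented by square-integrable Borel functions, with equality
  almost everywhere. The finite index type \<open>'n\<close> plays the role of \<open>{1,\<dots>,n}\<close>, \<open>n \<ge> 1\<close>;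
  it needs a linear order only to state the divisibility chain of the \<open>d j\<close>.
\<close>


definition L2 :: "(real^'n \<Rightarrow> complex) set" where
  "L2 = {f. f \<in> borel_measurable borel \<and> integrable lborel (\<lambda>t. (cmod (f t))\<^sup>2)}"

definition L2_inner :: "(real^'n \<Rightarrow> complex) \<Rightarrow> (real^'n \<Rightarrow> complex) \<Rightarrow> complex" where
  "L2_inner f g = (LINT t|lborel. f t * cnj (g t))"

definition L2_norm :: "(real^'n \<Rightarrow> complex) \<Rightarrow> real" where
  "L2_norm f = sqrt (LINT t|lborel. (cmod (f t))\<^sup>2)"

text \<open>Unconditional convergence of a family in \<open>L\<^sup>2\<close>-norm; the limit is unique up to null sets,
  and \<open>L2_sum\<close> selects a representative of it.\<close>

definition L2_has_sum ::
  "('i \<Rightarrow> real^'n \<Rightarrow> complex) \<Rightarrow> 'i set \<Rightarrow> (real^'n \<Rightarrow> complex) \<Rightarrow> bool" where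
  "L2_has_sum u I F \<longleftrightarrow> F \<in> L2 \<and> (\<forall>i\<in>I. u i \<in> L2) \<and>
     ((\<lambda>X. L2_norm (\<lambda>t. (\<Sum>i\<in>X. u i t) - F t)) \<longlongrightarrow> 0) (finite_subsets_at_top I)"

definition L2_sum :: "('i \<Rightarrow> real^'n \<Rightarrow> complex) \<Rightarrow> 'i set \<Rightarrow> real^'n \<Rightarrow> complex" where
  "L2_sum u I = (SOME F. L2_has_sum u I F)"

definition translation :: "real^'n \<Rightarrow> (real^'n \<Rightarrow> complex) \<Rightarrow> real^'n \<Rightarrow> complex" where
  "translation x f = (\<lambda>t. f (t - x))"

definition modulation :: "real^'n \<Rightarrow> (real^'n \<Rightarrow> complex) \<Rightarrow> real^'n \<Rightarrow> complex" where
  "modulation \<omega> f = (\<lambda>t. cis (2 * pi * (\<omega> \<bullet> t)) * f t)"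

definition rho :: "(real^'n) \<times> (real^'n) \<Rightarrow> (real^'n \<Rightarrow> complex) \<Rightarrow> real^'n \<Rightarrow> complex" where
  "rho z f = (case z of (x, \<omega>) \<Rightarrow>
     (\<lambda>t. cis (- (pi * (x \<bullet> \<omega>))) * modulation \<omega> (translation x f) t))"

primrec iterated_partial :: "'n list \<Rightarrow> (real^'n \<Rightarrow> complex) \<Rightarrow> real^'n \<Rightarrow> complex" where
  "iterated_partial [] f = f"
| "iterated_partial (i # is) f =
     (\<lambda>x. frechet_derivative (iterated_partial is f) (at x) (axis i 1))"

text \<open>Requiring all iterated partial derivatives to be (Frechet) differentiable everywhere is
  smoothness, since it makes each of them continuous.\<close>

definition schwartz :: "(real^'n \<Rightarrow> complex) \<Rightarrow> bool" where
  "schwartz f \<longleftrightarrow>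
     (\<forall>is. (\<forall>x. iterated_partial is f differentiable (at x)) \<and>
       (\<forall>N::nat. bounded (range (\<lambda>x. (1 + norm x) ^ N *\<^sub>R iterated_partial is f x))))"

text \<open>Every class in \<open>M\<^sup>1\<close> has a unique continuous representative. That representative is the one
  meant here, since the Zak transform below evaluates the function at individual points.\<close>

definition M1 :: "(real^'n \<Rightarrow> complex) \<Rightarrow> (real^'n \<Rightarrow> complex) set" where
  "M1 \<phi> = {f \<in> L2. continuous_on UNIV f \<and> integrable lborel (\<lambda>z. L2_inner f (rho z \<phi>))}"

definition Dhalf :: "('n \<Rightarrow> nat) \<Rightarrow> int^'n \<Rightarrow> real^'n" where
  "Dhalf d k = (\<chi> j. sqrt (real (d j)) * of_int (k $ j))"

definition Lat :: "('n \<Rightarrow> nat) \<Rightarrow> ((real^'n) \<times> (real^'n)) set" where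
  "Lat d = range (Dhalf d) \<times> range (Dhalf d)"

text \<open>\<open>Dhalf d\<close> is injective when all \<open>d j\<close> are positive, so \<open>k\<close> and \<open>l\<close> below are the integer
  coordinates of a lattice point.\<close>

definition chi :: "('n::finite \<Rightarrow> nat) \<Rightarrow> (real^'n) \<times> (real^'n) \<Rightarrow> complex" where
  "chi d \<mu> = (let k = inv (Dhalf d) (fst \<mu>); l = inv (Dhalf d) (snd \<mu>)
     in (-1) powi (\<Sum>j\<in>UNIV. k $ j * int (d j) * l $ j))"

definition Srep ::
  "('n \<Rightarrow> nat) \<Rightarrow> (real^'n) \<times> (real^'n) \<Rightarrow> (real^'n \<Rightarrow> complex) \<Rightarrow> real^'n \<Rightarrow> complex" where
  "Srep d \<mu> f = (\<lambda>t. chi d \<mu> * rho \<mu> f t)"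

definition ell2 :: "('n \<Rightarrow> nat) \<Rightarrow> ((real^'n) \<times> (real^'n) \<Rightarrow> complex) \<Rightarrow> bool" where
  "ell2 d w \<longleftrightarrow> (\<lambda>\<mu>. (cmod (w \<mu>))\<^sup>2) summable_on Lat d"

definition ell2_norm :: "('n \<Rightarrow> nat) \<Rightarrow> ((real^'n) \<times> (real^'n) \<Rightarrow> complex) \<Rightarrow> real" where
  "ell2_norm d w = sqrt (\<Sum>\<^sub>\<infinity>\<mu>\<in>Lat d. (cmod (w \<mu>))\<^sup>2)"

text \<open>Residues modulo \<open>d j\<close> are represented by \<open>0, \<dots>, d j - 1\<close>. The components of \<open>Zak_vec\<close> do not
  depend on this choice, by quasi-periodicity of \<open>Zak\<close>. The tensor product of the spaces
  \<open>\<complex>\<^bsup>d j\<^esup>\<close> is identified with the functions on \<open>Zd d\<close> (extended by \<open>0\<close>) through the product basis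
  \<open>e\<^sub>r\<close>.\<close>

definition Zd :: "('n \<Rightarrow> nat) \<Rightarrow> (int^'n) set" where
  "Zd d = {r. \<forall>j. 0 \<le> r $ j \<and> r $ j < int (d j)}"

definition Hd :: "('n \<Rightarrow> nat) \<Rightarrow> (int^'n \<Rightarrow> complex) set" where
  "Hd d = {c. \<forall>r. r \<notin> Zd d \<longrightarrow> c r = 0}"

definition Hd_inner :: "('n \<Rightarrow> nat) \<Rightarrow> (int^'n \<Rightarrow> complex) \<Rightarrow> (int^'n \<Rightarrow> complex) \<Rightarrow> complex" where
  "Hd_inner d c c' = (\<Sum>r\<in>Zd d. c r * cnj (c' r))"

definition Hd_norm :: "('n \<Rightarrow> nat) \<Rightarrow> (int^'n \<Rightarrow> complex) \<Rightarrow> real" where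
  "Hd_norm d c = sqrt (\<Sum>r\<in>Zd d. (cmod (c r))\<^sup>2)"

definition Hd_opnorm ::
  "('n \<Rightarrow> nat) \<Rightarrow> ((int^'n \<Rightarrow> complex) \<Rightarrow> int^'n \<Rightarrow> complex) \<Rightarrow> real" where
  "Hd_opnorm d A = (SUP c\<in>{c \<in> Hd d. Hd_norm d c \<le> 1}. Hd_norm d (A c))"

definition Hd_adjoint ::
  "('n \<Rightarrow> nat) \<Rightarrow> ((int^'n \<Rightarrow> complex) \<Rightarrow> real^'n \<Rightarrow> complex) \<Rightarrow>
   (real^'n \<Rightarrow> complex) \<Rightarrow> int^'n \<Rightarrow> complex" where
  "Hd_adjoint d E = (SOME A. \<forall>F\<in>L2. A F \<in> Hd d \<and>
     (\<forall>c\<in>Hd d. L2_inner (E c) F = Hd_inner d c (A F)))"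

definition dshift :: "('n \<Rightarrow> nat) \<Rightarrow> int^'n \<Rightarrow> real^'n" where
  "dshift d r = (\<chi> j. of_int (r $ j) / sqrt (real (d j)))"

definition Zak :: "('n \<Rightarrow> nat) \<Rightarrow> (real^'n \<Rightarrow> complex) \<Rightarrow> real^'n \<Rightarrow> real^'n \<Rightarrow> complex" where
  "Zak d h x \<omega> = (\<Sum>\<^sub>\<infinity>\<gamma>\<in>range (Dhalf d). h (x - \<gamma>) * cis (2 * pi * (\<gamma> \<bullet> \<omega>)))"

definition Zak_vec ::
  "('n \<Rightarrow> nat) \<Rightarrow> (real^'n \<Rightarrow> complex) \<Rightarrow> real^'n \<Rightarrow> real^'n \<Rightarrow> int^'n \<Rightarrow> complex" where
  "Zak_vec d h x \<omega> = (\<lambda>r. if r \<in> Zd d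
     then cis (- (2 * pi * (dshift d r \<bullet> \<omega>))) * Zak d h (x + dshift d r) \<omega> else 0)"

definition gabor_frame :: "('n \<Rightarrow> nat) \<Rightarrow> nat \<Rightarrow> (nat \<Rightarrow> real^'n \<Rightarrow> complex) \<Rightarrow> bool" where
  "gabor_frame d m g \<longleftrightarrow> (\<forall>j\<in>{1..m}. g j \<in> L2) \<and>
     (\<exists>A B. 0 < A \<and> 0 < B \<and> (\<forall>f\<in>L2.
       (\<lambda>(\<mu>, j). (cmod (L2_inner f (rho \<mu> (g j))))\<^sup>2) summable_on (Lat d \<times> {1..m}) \<and>
       A * (L2_norm f)\<^sup>2
         \<le> (\<Sum>\<^sub>\<infinity>(\<mu>, j)\<in>Lat d \<times> {1..m}. (cmod (L2_inner f (rho \<mu> (g j))))\<^sup>2) \<and>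
       (\<Sum>\<^sub>\<infinity>(\<mu>, j)\<in>Lat d \<times> {1..m}. (cmod (L2_inner f (rho \<mu> (g j))))\<^sup>2)
         \<le> B * (L2_norm f)\<^sup>2))"

definition frame_op ::
  "('n \<Rightarrow> nat) \<Rightarrow> nat \<Rightarrow> (nat \<Rightarrow> real^'n \<Rightarrow> complex) \<Rightarrow> (real^'n \<Rightarrow> complex) \<Rightarrow>
   real^'n \<Rightarrow> complex" where
  "frame_op d m g f = L2_sum
     (\<lambda>(\<mu>, j) t. L2_inner f (rho \<mu> (g j)) * rho \<mu> (g j) t) (Lat d \<times> {1..m})"

text \<open>For a frame the operator \<open>frame_op\<close> is invertible on \<open>L\<^sup>2\<close>, so the following says
  \<open>\<gamma> j = S\<^sup>-\<^sup>1 (g j)\<close>, determined up to null sets.\<close>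

definition canonical_dual ::
  "('n \<Rightarrow> nat) \<Rightarrow> nat \<Rightarrow> (nat \<Rightarrow> real^'n \<Rightarrow> complex) \<Rightarrow> (nat \<Rightarrow> real^'n \<Rightarrow> complex) \<Rightarrow> bool" where
  "canonical_dual d m g \<gamma> \<longleftrightarrow>
     (\<forall>j\<in>{1..m}. \<gamma> j \<in> L2 \<and> (AE t in lborel. frame_op d m g (\<gamma> j) t = g j t))"

definition Gam ::
  "('n \<Rightarrow> nat) \<Rightarrow> nat \<Rightarrow> (nat \<Rightarrow> real^'n \<Rightarrow> complex) \<Rightarrow> (nat \<Rightarrow> real^'n \<Rightarrow> complex) \<Rightarrow>
   (int^'n \<Rightarrow> complex) \<Rightarrow> real^'n \<Rightarrow> complex" where
  "Gam d m g \<gamma> c = (\<lambda>t. \<Sum>r\<in>{1..m}. Hd_inner d c (Zak_vec d (g r) 0 0) * \<gamma> r t)"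

definition Psi ::
  "('n \<Rightarrow> nat) \<Rightarrow> nat \<Rightarrow> (nat \<Rightarrow> real^'n \<Rightarrow> complex) \<Rightarrow> (nat \<Rightarrow> real^'n \<Rightarrow> complex) \<Rightarrow>
   ((real^'n) \<times> (real^'n) \<Rightarrow> complex) \<Rightarrow> (int^'n \<Rightarrow> complex) \<Rightarrow> real^'n \<Rightarrow> complex" where
  "Psi d m g \<gamma> w c = L2_sum (\<lambda>\<mu> t. w \<mu> * Srep d \<mu> (Gam d m g \<gamma> c) t) (Lat d)"

definition Eop ::
  "('n::finite \<Rightarrow> nat) \<Rightarrow> nat \<Rightarrow> (nat \<Rightarrow> real^'n \<Rightarrow> complex) \<Rightarrow> (nat \<Rightarrow> real^'n \<Rightarrow> complex) \<Rightarrow>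
   ((real^'n) \<times> (real^'n) \<Rightarrow> complex) \<Rightarrow> (int^'n \<Rightarrow> complex) \<Rightarrow> real^'n \<Rightarrow> complex" where
  "Eop d m g \<gamma> w c = (\<lambda>t. of_real (real (\<Prod>j\<in>UNIV. d j) powr (- 1 / 4) / ell2_norm d w)
     * Psi d m g \<gamma> w c t)"

end

theory Submission
  imports Defs "HOL-Probability.Levy"
begin

text \<open>
  Let \<open>\<kappa>\<close> be the volume of the cells with side lengths \<open>1 / sqrt (d j)\<close> centred at the points
  \<open>dshift d s\<close>, and let \<open>b s\<close> be the indicator function of the cell of \<open>s\<close>. The lattice shifts of the
  \<open>b s\<close>, \<open>s \<in> Zd d\<close>, are pairwise orthogonal with squared norm \<open>\<kappa>\<close>. For an almost shift-invariant envelope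
  \<open>w\<close> the superposition \<open>F s = \<Sum>\<mu>. w \<mu> S\<^sub>\<mu> (b s)\<close> is concentrated at the centres of the cells, because
  multiplication by the characters of the lattice hardly changes it. Hence, for a continuous window \<open>g\<close>
  dominated by a summable sequence over the cells, the coefficients \<open>\<langle>F s, S\<^sub>\<mu> g\<rangle>\<close> are close in \<open>\<ell>\<^sup>2\<close> to
  \<open>\<kappa> w \<mu>\<close> times the conjugate of the component \<open>s\<close> of the Zak vector of \<open>g\<close> at the origin. Applying the lower
  frame bound to the difference and using duality of the windows, one finds that the state with symbol
  \<open>e\<^sub>s\<close> is close to \<open>\<kappa>\<^sup>-\<^sup>1 F s\<close>; these vectors are exactly orthogonal with squared norm
  \<open>\<kappa>\<^sup>-\<^sup>1 \<parallel>w\<parallel>\<^sup>2 = sqrt (\<Prod>j. d j) \<parallel>w\<parallel>\<^sup>2\<close>.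

  Domination holds in \<open>M\<^sup>1\<close>: for almost every \<open>y\<close> the function \<open>f\<close> times a translate of \<open>\<phi>\<close> by \<open>y\<close> has an integrable
  Fourier transform, which bounds it uniformly by an integrable function of \<open>y\<close>.
\<close>

section \<open>Square-integrable functions\<close>

text \<open>The cells are matched to the lattice. With side lengths \<open>1 / sqrt (d j)\<close>,
  the modulations by D^(1/2) Z^n are orthogonal on each cell, and the translations by D^(1/2) Z^n
  permute the cells, with \<open>Zd d\<close> indexing the orbits. Since D^(1/2) k . D^(1/2) l is an
  integer, all lattice shifts commute and \<open>chi\<close> cancels the phase of
  \<open>rho\<close>. The obstacle is that the hypothesis on the envelope controls one shift at a
  time, whereas a coefficient against a window involves infinitely many shifts. Hence the estimates
  have the form \<eta> times the norm of w plus C times a finite sum of shift differences, with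
  \<eta> arbitrary and the shifts fixed before w. The summable majorant makes this possible:
  finitely many cells are treated by continuity, and the others cost a small multiple of the norm.
  The dual windows enter through the weak form of S \<gamma> = g, that is, through their pairings
  with the frame elements. Sums are kept finite by truncating w, and the estimates are uniform in
  the truncation.\<close>

lemma eventually_finite_subsets_at_topI:
  assumes "finite X" "X \<subseteq> I" "\<And>Y. finite Y \<Longrightarrow> X \<subseteq> Y \<Longrightarrow> Y \<subseteq> I \<Longrightarrow> P Y"
  shows "eventually P (finite_subsets_at_top I)"
  using assms unfolding eventually_finite_subsets_at_top by blast

lemma L2_borel: "f \<in> L2 \<Longrightarrow> f \<in> borel_measurable borel"
  by (simp add: L2_def)

lemma L2_sq_integrable: "f \<in> L2 \<Longrightarrow> integrable lborel (\<lambda>t. (cmod (f t))\<^sup>2)"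
  by (simp add: L2_def)

lemma L2_I:
  assumes "f \<in> borel_measurable borel" "integrable lborel (\<lambda>t. (cmod (f t))\<^sup>2)"
  shows "f \<in> L2"
  using assms by (simp add: L2_def)

lemma L2_bound:
  assumes f: "f \<in> borel_measurable borel" and g: "integrable lborel g"
    and le: "\<And>t. (cmod (f t))\<^sup>2 \<le> g t"
  shows "f \<in> L2"
proof (rule L2_I[OF f])
  show "integrable lborel (\<lambda>t. (cmod (f t))\<^sup>2)"
  proof (rule Bochner_Integration.integrable_bound[OF g])
    show "AE t in lborel. norm ((cmod (f t))\<^sup>2) \<le> norm (g t)"
    proof (rule AE_I2)
      fix t show "norm ((cmod (f t))\<^sup>2) \<le> norm (g t)" using le[of t] by simp
    qed
  qed (use f in simp)
qed

lemma borel_measurable_cnj: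
  assumes "f \<in> borel_measurable M"
  shows "(\<lambda>t. cnj (f t)) \<in> borel_measurable M"
  using measurable_compose[OF assms, of cnj borel]
  by (simp add: borel_measurable_continuous_onI continuous_intros)

lemma norm_mult_le_squares:
  fixes a b :: real
  shows "a * b \<le> a\<^sup>2 + b\<^sup>2"
proof -
  have "0 \<le> (a - b)\<^sup>2 + a\<^sup>2 + b\<^sup>2" by simp
  then show ?thesis by (simp add: power2_eq_square algebra_simps)
qed

lemma L2_norm_prod_integrable:
  assumes "f \<in> L2" "g \<in> L2"
  shows "integrable lborel (\<lambda>t. cmod (f t) * cmod (g t))"
proof (rule Bochner_Integration.integrable_bound)
  show "integrable lborel (\<lambda>t. (cmod (f t))\<^sup>2 + (cmod (g t))\<^sup>2)"
    using assms by (intro Bochner_Integration.integrable_add L2_sq_integrable)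
  show "(\<lambda>t. cmod (f t) * cmod (g t)) \<in> borel_measurable lborel"
    using L2_borel[OF assms(1)] L2_borel[OF assms(2)] by simp
  show "AE t in lborel. norm (cmod (f t) * cmod (g t)) \<le> norm ((cmod (f t))\<^sup>2 + (cmod (g t))\<^sup>2)"
    by (auto simp: norm_mult_le_squares abs_mult)
qed

lemma L2_prod_integrable:
  assumes "f \<in> L2" "g \<in> L2"
  shows "integrable lborel (\<lambda>t. f t * cnj (g t))"
proof (rule Bochner_Integration.integrable_bound[OF L2_norm_prod_integrable[OF assms]])
  show "(\<lambda>t. f t * cnj (g t)) \<in> borel_measurable lborel"
    using L2_borel[OF assms(1)] borel_measurable_cnj[OF L2_borel[OF assms(2)]] by simp
qed (auto simp: norm_mult)

lemma L2_cmult: "f \<in> L2 \<Longrightarrow> (\<lambda>t. c * f t) \<in> L2"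
  by (rule L2_bound[where g = "\<lambda>t. (cmod c)\<^sup>2 * (cmod (f t))\<^sup>2"])
    (auto simp: norm_mult power_mult_distrib L2_def)

lemma L2_add:
  assumes "f \<in> L2" "g \<in> L2"
  shows "(\<lambda>t. f t + g t) \<in> L2"
proof (rule L2_bound[where g = "\<lambda>t. 2 * (cmod (f t))\<^sup>2 + 2 * (cmod (g t))\<^sup>2"])
  fix t
  have "(cmod (f t + g t))\<^sup>2 \<le> (cmod (f t) + cmod (g t))\<^sup>2"
    by (intro power_mono norm_triangle_ineq) auto
  also have "\<dots> \<le> 2 * (cmod (f t))\<^sup>2 + 2 * (cmod (g t))\<^sup>2"
    using sum_squares_ge_zero[of "cmod (f t) - cmod (g t)" 0]
    by (simp add: power2_eq_square algebra_simps)
  finally show "(cmod (f t + g t))\<^sup>2 \<le> 2 * (cmod (f t))\<^sup>2 + 2 * (cmod (g t))\<^sup>2" .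
qed (use assms in \<open>auto simp: L2_def\<close>)

lemma L2_zero: "(\<lambda>t. 0) \<in> L2"
  by (simp add: L2_def)

lemma L2_uminus: "f \<in> L2 \<Longrightarrow> (\<lambda>t. - f t) \<in> L2"
  using L2_cmult[of f "-1"] by simp

lemma L2_diff: "f \<in> L2 \<Longrightarrow> g \<in> L2 \<Longrightarrow> (\<lambda>t. f t - g t) \<in> L2"
  using L2_add[OF _ L2_uminus, of f g] by simp

lemma L2_finite_sum:
  "(\<And>i. i \<in> X \<Longrightarrow> u i \<in> L2) \<Longrightarrow> (\<lambda>t. \<Sum>i\<in>X. u i t) \<in> L2"
  by (induction X rule: infinite_finite_induct) (auto intro: L2_add L2_zero)

lemma L2_norm_nonneg: "0 \<le> L2_norm f"
  by (simp add: L2_norm_def)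

lemma L2_norm_sq: "(L2_norm f)\<^sup>2 = (LINT t|lborel. (cmod (f t))\<^sup>2)"
  by (simp add: L2_norm_def)

lemma L2_inner_self: "L2_inner f f = of_real ((L2_norm f)\<^sup>2)"
  unfolding L2_norm_sq L2_inner_def complex_norm_square[symmetric] by (rule integral_complex_of_real)

lemma L2_inner_sym: "L2_inner g f = cnj (L2_inner f g)"
  unfolding L2_inner_def by (subst Bochner_Integration.integral_cnj[symmetric]) (simp add: mult.commute)

lemma L2_inner_add_left:
  "f \<in> L2 \<Longrightarrow> g \<in> L2 \<Longrightarrow> h \<in> L2 \<Longrightarrow> L2_inner (\<lambda>t. f t + g t) h = L2_inner f h + L2_inner g h"
  unfolding L2_inner_def by (simp add: distrib_right L2_prod_integrable)

lemma L2_inner_cmult_left: "L2_inner (\<lambda>t. c * f t) h = c * L2_inner f h"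
  unfolding L2_inner_def by (simp add: mult.assoc)

lemma L2_inner_sum_left:
  "(\<And>i. i \<in> X \<Longrightarrow> u i \<in> L2) \<Longrightarrow> h \<in> L2 \<Longrightarrow>
    L2_inner (\<lambda>t. \<Sum>i\<in>X. u i t) h = (\<Sum>i\<in>X. L2_inner (u i) h)"
proof (induction X rule: infinite_finite_induct)
  case (insert x F)
  then show ?case by (simp add: L2_inner_add_left L2_finite_sum)
qed (auto simp: L2_inner_def)

lemma L2_inner_diff_left:
  "f \<in> L2 \<Longrightarrow> g \<in> L2 \<Longrightarrow> h \<in> L2 \<Longrightarrow> L2_inner (\<lambda>t. f t - g t) h = L2_inner f h - L2_inner g h"
  unfolding L2_inner_def by (simp add: left_diff_distrib L2_prod_integrable)

lemma L2_inner_cmult_right: "L2_inner h (\<lambda>t. c * f t) = cnj c * L2_inner h f"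
  by (subst (1 2) L2_inner_sym) (simp add: L2_inner_cmult_left)

lemma L2_inner_diff_right:
  "f \<in> L2 \<Longrightarrow> g \<in> L2 \<Longrightarrow> h \<in> L2 \<Longrightarrow> L2_inner h (\<lambda>t. f t - g t) = L2_inner h f - L2_inner h g"
  by (subst (1 2 3) L2_inner_sym) (simp add: L2_inner_diff_left)

lemma L2_inner_sum_right:
  "(\<And>i. i \<in> X \<Longrightarrow> u i \<in> L2) \<Longrightarrow> h \<in> L2 \<Longrightarrow>
    L2_inner h (\<lambda>t. \<Sum>i\<in>X. u i t) = (\<Sum>i\<in>X. L2_inner h (u i))"
proof -
  assume a: "\<And>i. i \<in> X \<Longrightarrow> u i \<in> L2" and h: "h \<in> L2"
  have "L2_inner h (\<lambda>t. \<Sum>i\<in>X. u i t) = cnj (\<Sum>i\<in>X. L2_inner (u i) h)"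
    by (subst L2_inner_sym) (simp add: L2_inner_sum_left[OF a h])
  also have "\<dots> = (\<Sum>i\<in>X. L2_inner h (u i))"
    unfolding cnj_sum by (rule sum.cong[OF refl]) (rule L2_inner_sym[symmetric])
  finally show ?thesis .
qed

text \<open>With the moduli inside the integral this controls the cross term in
  \<open>L2_triangle\<close>. The estimate is taken for nonnegative integrals; square-integrability
  makes all three of them finite, so it transfers to real integrals.\<close>

lemma L2_Cauchy_Schwarz_norm:
  assumes f: "f \<in> L2" and g: "g \<in> L2"
  shows "(LINT t|lborel. cmod (f t) * cmod (g t)) \<le> L2_norm f * L2_norm g"
proof -
  let ?I = "LINT t|lborel. cmod (f t) * cmod (g t)"
  have [measurable]: "f \<in> borel_measurable borel" "g \<in> borel_measurable borel"
    using f g by (auto simp: L2_def)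
  have I0: "0 \<le> ?I" by (rule integral_nonneg_AE) auto
  have "(\<integral>\<^sup>+t. ennreal (cmod (f t)) * ennreal (cmod (g t)) \<partial>lborel)\<^sup>2
      \<le> (\<integral>\<^sup>+t. (ennreal (cmod (f t)))\<^sup>2 \<partial>lborel) * (\<integral>\<^sup>+t. (ennreal (cmod (g t)))\<^sup>2 \<partial>lborel)"
    by (rule Cauchy_Schwarz_nn_integral) measurable
  also have "(\<integral>\<^sup>+t. ennreal (cmod (f t)) * ennreal (cmod (g t)) \<partial>lborel) = ennreal ?I"
    by (subst nn_integral_eq_integral[symmetric])
      (auto simp: ennreal_mult L2_norm_prod_integrable[OF f g])
  also have "(\<integral>\<^sup>+t. (ennreal (cmod (f t)))\<^sup>2 \<partial>lborel) = ennreal ((L2_norm f)\<^sup>2)"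
    unfolding L2_norm_sq by (subst nn_integral_eq_integral[symmetric])
      (auto simp: ennreal_power L2_sq_integrable[OF f])
  also have "(\<integral>\<^sup>+t. (ennreal (cmod (g t)))\<^sup>2 \<partial>lborel) = ennreal ((L2_norm g)\<^sup>2)"
    unfolding L2_norm_sq by (subst nn_integral_eq_integral[symmetric])
      (auto simp: ennreal_power L2_sq_integrable[OF g])
  finally have "?I\<^sup>2 \<le> (L2_norm f * L2_norm g)\<^sup>2"
    using I0 by (simp add: ennreal_power ennreal_mult[symmetric] power_mult_distrib)
  then show ?thesis
    by (rule power2_le_imp_le) (simp add: L2_norm_nonneg)
qed

lemma L2_Cauchy_Schwarz:
  assumes f: "f \<in> L2" and g: "g \<in> L2"
  shows "cmod (L2_inner f g) \<le> L2_norm f * L2_norm g"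
proof -
  have "cmod (L2_inner f g) \<le> (LINT t|lborel. cmod (f t * cnj (g t)))"
    unfolding L2_inner_def by (rule integral_norm_bound)
  also have "\<dots> = (LINT t|lborel. cmod (f t) * cmod (g t))" by (simp add: norm_mult)
  finally show ?thesis using L2_Cauchy_Schwarz_norm[OF f g] by linarith
qed

lemma L2_norm_mono:
  assumes f: "f \<in> borel_measurable borel" and g: "g \<in> L2" and le: "\<And>t. cmod (f t) \<le> cmod (g t)"
  shows "f \<in> L2" "L2_norm f \<le> L2_norm g"
proof -
  show L: "f \<in> L2"
    by (rule L2_bound[OF f L2_sq_integrable[OF g]]) (simp add: le power_mono)
  show "L2_norm f \<le> L2_norm g"
    unfolding L2_norm_def real_sqrt_le_iff
    by (rule integral_mono) (auto intro!: L2_sq_integrable L g power_mono le)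
qed

lemma L2_norm_cmult: "L2_norm (\<lambda>t. c * f t) = cmod c * L2_norm f"
  by (simp add: L2_norm_def norm_mult power_mult_distrib real_sqrt_mult)

lemma L2_triangle:
  assumes f: "f \<in> L2" and g: "g \<in> L2"
  shows "L2_norm (\<lambda>t. f t + g t) \<le> L2_norm f + L2_norm g"
proof -
  have "(L2_norm (\<lambda>t. f t + g t))\<^sup>2 \<le> (LINT t|lborel. (cmod (f t))\<^sup>2 + (2 * (cmod (f t) * cmod (g t)) + (cmod (g t))\<^sup>2))"
    unfolding L2_norm_sq
  proof (rule integral_mono)
    show "integrable lborel (\<lambda>t. (cmod (f t + g t))\<^sup>2)" using L2_sq_integrable[OF L2_add[OF f g]] .
    show "integrable lborel (\<lambda>t. (cmod (f t))\<^sup>2 + (2 * (cmod (f t) * cmod (g t)) + (cmod (g t))\<^sup>2))"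
      using f g by (intro Bochner_Integration.integrable_add integrable_mult_right L2_sq_integrable L2_norm_prod_integrable)
    fix t
    have "(cmod (f t + g t))\<^sup>2 \<le> (cmod (f t) + cmod (g t))\<^sup>2"
      by (intro power_mono norm_triangle_ineq) auto
    then show "(cmod (f t + g t))\<^sup>2 \<le> (cmod (f t))\<^sup>2 + (2 * (cmod (f t) * cmod (g t)) + (cmod (g t))\<^sup>2)"
      by (simp add: power2_eq_square algebra_simps)
  qed
  also have "\<dots> = (L2_norm f)\<^sup>2 + (2 * (LINT t|lborel. cmod (f t) * cmod (g t)) + (L2_norm g)\<^sup>2)"
    using f g by (simp add: L2_norm_sq L2_sq_integrable L2_norm_prod_integrable)
  also have "\<dots> \<le> (L2_norm f + L2_norm g)\<^sup>2"
    using L2_Cauchy_Schwarz_norm[OF f g] by (simp add: power2_eq_square algebra_simps)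
  finally show ?thesis
    by (rule power2_le_imp_le) (simp add: L2_norm_nonneg)
qed

lemma L2_norm_zero: "L2_norm (\<lambda>t. 0) = 0"
  by (simp add: L2_norm_def)

lemma L2_norm_minus_commute: "L2_norm (\<lambda>t. f t - g t) = L2_norm (\<lambda>t. g t - f t)"
  by (simp add: L2_norm_def norm_minus_commute)

lemma L2_triangle_sum:
  "(\<And>i. i \<in> X \<Longrightarrow> u i \<in> L2) \<Longrightarrow> L2_norm (\<lambda>t. \<Sum>i\<in>X. u i t) \<le> (\<Sum>i\<in>X. L2_norm (u i))"
proof (induction X rule: infinite_finite_induct)
  case (insert x F)
  have "L2_norm (\<lambda>t. u x t + (\<Sum>i\<in>F. u i t)) \<le> L2_norm (u x) + L2_norm (\<lambda>t. \<Sum>i\<in>F. u i t)"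
    using insert by (intro L2_triangle L2_finite_sum) auto
  with insert show ?case by fastforce
qed (auto simp: L2_norm_zero)

lemma L2_triangle_diff:
  assumes "f \<in> L2" "g \<in> L2" "h \<in> L2"
  shows "L2_norm (\<lambda>t. f t - h t) \<le> L2_norm (\<lambda>t. f t - g t) + L2_norm (\<lambda>t. g t - h t)"
  using L2_triangle[OF L2_diff[OF assms(1,2)] L2_diff[OF assms(2,3)]] by simp

lemma L2_norm_diff_abs:
  assumes "f \<in> L2" "g \<in> L2"
  shows "\<bar>L2_norm f - L2_norm g\<bar> \<le> L2_norm (\<lambda>t. f t - g t)"
  using L2_triangle_diff[OF assms(1,2) L2_zero] L2_triangle_diff[OF assms(2,1) L2_zero]
    L2_norm_minus_commute[of f g] by simp

text \<open>Limits chosen by \<open>L2_sum\<close> and the equation for the dual windows are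
  determined only almost everywhere; they are used through inner products, which do not see null
  sets.\<close>

lemma L2_inner_cong_AE:
  assumes "f \<in> L2" "f' \<in> L2" "g \<in> L2" "AE t in lborel. f t = f' t"
  shows "L2_inner f g = L2_inner f' g"
  unfolding L2_inner_def
proof (rule integral_cong_AE)
  show "AE t in lborel. f t * cnj (g t) = f' t * cnj (g t)" using assms(4) by eventually_elim simp
qed (use L2_prod_integrable[OF assms(1,3)] L2_prod_integrable[OF assms(2,3)] in auto)

lemma L2_norm_eq_0_AE:
  assumes "f \<in> L2" "L2_norm f = 0"
  shows "AE t in lborel. f t = 0"
proof -
  have "(LINT t|lborel. (cmod (f t))\<^sup>2) = 0" using assms(2) by (simp add: L2_norm_def)
  then have "AE t in lborel. (cmod (f t))\<^sup>2 = 0"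
    by (subst (asm) integral_nonneg_eq_0_iff_AE) (auto simp: L2_sq_integrable[OF assms(1)])
  then show ?thesis by eventually_elim simp
qed

lemma nn_integral_L2_sq:
  assumes "f \<in> L2"
  shows "(\<integral>\<^sup>+t. ennreal ((cmod (f t))\<^sup>2) \<partial>lborel) = ennreal ((L2_norm f)\<^sup>2)"
  unfolding L2_norm_sq by (rule nn_integral_eq_integral) (auto simp: L2_sq_integrable assms)

text \<open>The weights \<open>2 ^ n\<close> turn square-summability of the increments into pointwise absolute
  summability almost everywhere.\<close>

lemma L2_complete_seq:
  fixes F :: "nat \<Rightarrow> real^'n \<Rightarrow> complex"
  assumes F: "\<And>n. F n \<in> L2"
    and step: "\<And>n. L2_norm (\<lambda>t. F (Suc n) t - F n t) \<le> (1/4) ^ n"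
  shows "\<exists>H\<in>L2. \<forall>n. L2_norm (\<lambda>t. F n t - H t) \<le> 2 * (1/4) ^ n"
proof -
  have [measurable]: "\<And>n. F n \<in> borel_measurable borel" using F by (auto simp: L2_def)
  let ?D = "\<lambda>n t. F (Suc n) t - F n t"
  have "(\<integral>\<^sup>+t. (\<Sum>n. ennreal (2 ^ n * (cmod (?D n t))\<^sup>2)) \<partial>lborel)
      = (\<Sum>n. \<integral>\<^sup>+t. ennreal (2 ^ n * (cmod (?D n t))\<^sup>2) \<partial>lborel)"
    by (rule nn_integral_suminf) measurable
  also have "\<dots> = (\<Sum>n. ennreal (2 ^ n * (L2_norm (?D n))\<^sup>2))"
    by (simp add: ennreal_mult nn_integral_cmult nn_integral_L2_sq[OF L2_diff[OF F F]])
  also have "\<dots> \<le> (\<Sum>n. ennreal ((1/8) ^ n))"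
  proof (intro suminf_le ennreal_leI)
    fix n
    have "2 ^ n * (L2_norm (?D n))\<^sup>2 \<le> 2 ^ n * ((1/4) ^ n)\<^sup>2"
      by (intro mult_left_mono power_mono step L2_norm_nonneg) auto
    also have "\<dots> = (1/8::real) ^ n"
    proof -
      have "((1/4::real) ^ n)\<^sup>2 = (1/16) ^ n"
        by (simp add: power2_eq_square power_mult_distrib[symmetric])
      then show ?thesis by (simp add: power_mult_distrib[symmetric])
    qed
    finally show "2 ^ n * (L2_norm (?D n))\<^sup>2 \<le> (1/8) ^ n" .
  qed auto
  also have "\<dots> < \<infinity>"
    by (subst suminf_ennreal2) (auto intro: summable_geometric)
  finally have "AE t in lborel. (\<Sum>n. ennreal (2 ^ n * (cmod (?D n t))\<^sup>2)) \<noteq> \<infinity>"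
    by (intro nn_integral_noteq_infinite) auto
  then have conv: "AE t in lborel. convergent (\<lambda>n. F n t)"
  proof eventually_elim
    case (elim t)
    then have s: "summable (\<lambda>n. 2 ^ n * (cmod (?D n t))\<^sup>2)"
      by (intro summable_suminf_not_top) auto
    have "summable (\<lambda>n. cmod (?D n t))"
    proof (rule summable_comparison_test')
      show "summable (\<lambda>n. (1/2) ^ n + 2 ^ n * (cmod (?D n t))\<^sup>2)"
        using s by (intro summable_add summable_geometric) auto
      fix n :: nat
      have expand: "p * (q - c)\<^sup>2 = q - 2 * c + p * c\<^sup>2" if "p * q = 1" for p q c :: real
      proof -
        have "p * (q - c)\<^sup>2 = (p * q) * q - 2 * (p * q) * c + p * c\<^sup>2"
          by (simp add: power2_eq_square algebra_simps)
        then show ?thesis by (simp add: that)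
      qed
      \<comment> \<open>Completing the square with weight 2^n: since 2^n (1/2)^n = 1, the cross term
        is exactly twice the modulus to be summed.\<close>
      have "0 \<le> 2 ^ n * ((1/2) ^ n - cmod (?D n t))\<^sup>2" by simp
      also have "\<dots> = (1/2) ^ n - 2 * cmod (?D n t) + 2 ^ n * (cmod (?D n t))\<^sup>2"
        by (rule expand) (simp add: power_mult_distrib[symmetric])
      finally have "2 * cmod (?D n t) \<le> (1/2) ^ n + 2 ^ n * (cmod (?D n t))\<^sup>2" by simp
      moreover have "0 \<le> cmod (?D n t)" by simp
      ultimately show "norm (cmod (?D n t)) \<le> (1/2) ^ n + 2 ^ n * (cmod (?D n t))\<^sup>2"
        unfolding real_norm_def abs_norm_cancel by linarith
    qed
    then have "summable (\<lambda>n. ?D n t)" by (rule summable_norm_cancel)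
    then have "convergent (\<lambda>n. \<Sum>k<n. ?D k t)" by (simp add: summable_iff_convergent)
    then have "convergent (\<lambda>n. F n t - F 0 t)" by (simp add: sum_lessThan_telescope[of "\<lambda>k. F k t"])
    then have "convergent (\<lambda>n. (F n t - F 0 t) + F 0 t)" by (intro convergent_add convergent_const)
    then show ?case by simp
  qed
  \<comment> \<open>On the null set of divergence \<open>lim\<close> is an unspecified value;
    \<open>H\<close> is measurable all the same.\<close>
  define H where "H = (\<lambda>t. lim (\<lambda>n. F n t))"
  have [measurable]: "H \<in> borel_measurable borel" unfolding H_def by measurable
  have limH: "AE t in lborel. (\<lambda>n. F n t) \<longlonglongrightarrow> H t"
    using conv by eventually_elim (simp add: H_def convergent_LIMSEQ_iff)
  have far: "L2_norm (\<lambda>t. F n t - F (n + k) t) \<le> 2 * (1/4) ^ n" for n k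
  proof -
    have "L2_norm (\<lambda>t. F n t - F (n + k) t) \<le> (\<Sum>i<k. (1/4) ^ (n + i))"
    proof (induction k)
      case (Suc k)
      have "L2_norm (\<lambda>t. F n t - F (n + Suc k) t)
          \<le> L2_norm (\<lambda>t. F n t - F (n + k) t) + L2_norm (\<lambda>t. F (n + k) t - F (n + Suc k) t)"
        by (intro L2_triangle_diff F)
      also have "L2_norm (\<lambda>t. F (n + k) t - F (n + Suc k) t) \<le> (1/4) ^ (n + k)"
        using step[of "n + k"] by (simp add: L2_norm_minus_commute)
      finally show ?case using Suc by simp
    qed (simp add: L2_norm_zero)
    also have "\<dots> = (1/4) ^ n * (\<Sum>i<k. (1/4) ^ i)" by (simp add: power_add sum_distrib_left)
    also have "(\<Sum>i<k. (1/4::real) ^ i) \<le> (\<Sum>i. (1/4) ^ i)"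
      by (intro sum_le_suminf summable_geometric) auto
    also have "(\<Sum>i. (1/4::real) ^ i) \<le> 2" by (simp add: suminf_geometric)
    finally show ?thesis by (simp add: mult.commute)
  qed
  \<comment> \<open>Fatou's lemma: the bound \<open>far\<close>, uniform in k, survives letting k
    tend to infinity under the integral.\<close>
  have bound: "(\<integral>\<^sup>+t. ennreal ((cmod (F n t - H t))\<^sup>2) \<partial>lborel) \<le> ennreal ((2 * (1/4) ^ n)\<^sup>2)" for n
  proof -
    have "(\<integral>\<^sup>+t. ennreal ((cmod (F n t - H t))\<^sup>2) \<partial>lborel)
        = (\<integral>\<^sup>+t. liminf (\<lambda>k. ennreal ((cmod (F n t - F (n + k) t))\<^sup>2)) \<partial>lborel)"
    proof (rule nn_integral_cong_AE)
      show "AE t in lborel. ennreal ((cmod (F n t - H t))\<^sup>2)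
          = liminf (\<lambda>k. ennreal ((cmod (F n t - F (n + k) t))\<^sup>2))"
        using limH
      proof eventually_elim
        case (elim t)
        have "(\<lambda>k. F (n + k) t) \<longlonglongrightarrow> H t"
          using LIMSEQ_ignore_initial_segment[OF elim, of n] by (simp add: add.commute)
        then have "(\<lambda>k. ennreal ((cmod (F n t - F (n + k) t))\<^sup>2)) \<longlonglongrightarrow> ennreal ((cmod (F n t - H t))\<^sup>2)"
          by (intro tendsto_intros)
        then show ?case by (intro lim_imp_Liminf[symmetric]) auto
      qed
    qed
    also have "\<dots> \<le> liminf (\<lambda>k. \<integral>\<^sup>+t. ennreal ((cmod (F n t - F (n + k) t))\<^sup>2) \<partial>lborel)"
      by (rule nn_integral_liminf) measurable
    also have "\<dots> \<le> liminf (\<lambda>k::nat. ennreal ((2 * (1/4) ^ n)\<^sup>2))"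
    proof (intro Liminf_mono always_eventually allI)
      fix k
      show "(\<integral>\<^sup>+t. ennreal ((cmod (F n t - F (n + k) t))\<^sup>2) \<partial>lborel) \<le> ennreal ((2 * (1/4) ^ n)\<^sup>2)"
        by (subst nn_integral_L2_sq[OF L2_diff[OF F F]])
          (intro ennreal_leI power_mono far L2_norm_nonneg)
    qed
    also have "\<dots> = ennreal ((2 * (1/4) ^ n)\<^sup>2)" by (simp add: Liminf_const)
    finally show ?thesis .
  qed
  have L: "(\<lambda>t. F n t - H t) \<in> L2" for n
  proof (rule L2_I)
    show "integrable lborel (\<lambda>t. (cmod (F n t - H t))\<^sup>2)"
      by (rule integrableI_bounded) (use le_less_trans[OF bound[of n]] in auto)
  qed measurable
  have "H \<in> L2" using L2_diff[OF F[of 0] L[of 0]] by simp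
  moreover have "L2_norm (\<lambda>t. F n t - H t) \<le> 2 * (1/4) ^ n" for n
  proof -
    have "(L2_norm (\<lambda>t. F n t - H t))\<^sup>2 \<le> (2 * (1/4) ^ n)\<^sup>2"
      using bound[of n] unfolding nn_integral_L2_sq[OF L] by (subst (asm) ennreal_le_iff) auto
    then show ?thesis by (rule power2_le_imp_le) auto
  qed
  ultimately show ?thesis by blast
qed

text \<open>The Cauchy criterion for the net of finite sets, reduced to
  \<open>L2_complete_seq\<close>: tails of size (1/4)^n give a sequence of partial sums with a
  limit, and the same tail bounds keep all later partial sums close to it.\<close>

lemma L2_has_sum_exists:
  fixes u :: "'i \<Rightarrow> real^'n \<Rightarrow> complex"
  assumes u: "\<And>i. i \<in> I \<Longrightarrow> u i \<in> L2"
    and cauchy: "\<And>e. e > 0 \<Longrightarrow> \<exists>X. finite X \<and> X \<subseteq> I \<and>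
       (\<forall>Y. finite Y \<and> Y \<subseteq> I - X \<longrightarrow> L2_norm (\<lambda>t. \<Sum>i\<in>Y. u i t) \<le> e)"
  shows "\<exists>F. L2_has_sum u I F"
proof -
  have "\<forall>n. \<exists>X. finite X \<and> X \<subseteq> I \<and>
       (\<forall>Y. finite Y \<and> Y \<subseteq> I - X \<longrightarrow> L2_norm (\<lambda>t. \<Sum>i\<in>Y. u i t) \<le> (1/4) ^ n)"
    using cauchy by simp
  then obtain X0 where X0: "\<And>n. finite (X0 n)" "\<And>n. X0 n \<subseteq> I"
    "\<And>n Y. finite Y \<Longrightarrow> Y \<subseteq> I - X0 n \<Longrightarrow> L2_norm (\<lambda>t. \<Sum>i\<in>Y. u i t) \<le> (1/4) ^ n"
    by metis
  \<comment> \<open>Unions make the sets increasing, so that consecutive partial sums differ by a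
    sum outside \<open>X0 n\<close>.\<close>
  define X where "X n = (\<Union>k\<le>n. X0 k)" for n
  have X: "finite (X n)" "X n \<subseteq> I" "X0 n \<subseteq> X n" "X n \<subseteq> X (Suc n)" for n
    using X0(1,2) by (fastforce simp: X_def atMost_Suc)+
  have tail: "L2_norm (\<lambda>t. (\<Sum>i\<in>Z. u i t) - (\<Sum>i\<in>X n. u i t)) \<le> (1/4) ^ n"
    if "finite Z" "Z \<subseteq> I" "X n \<subseteq> Z" for Z n
  proof -
    have "(\<Sum>i\<in>Z. u i t) - (\<Sum>i\<in>X n. u i t) = (\<Sum>i\<in>Z - X n. u i t)" for t
      using that by (simp add: sum_diff X)
    then show ?thesis using X0(3)[of "Z - X n" n] that X(3)[of n] by auto
  qed
  define F where "F n = (\<lambda>t. \<Sum>i\<in>X n. u i t)" for n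
  have F: "F n \<in> L2" for n
    unfolding F_def by (rule L2_finite_sum) (use u X in blast)
  have "L2_norm (\<lambda>t. F (Suc n) t - F n t) \<le> (1/4) ^ n" for n
    unfolding F_def by (rule tail) (use X in auto)
  then obtain H where H: "H \<in> L2" "\<And>n. L2_norm (\<lambda>t. F n t - H t) \<le> 2 * (1/4) ^ n"
    using L2_complete_seq[of F] F by blast
  have "((\<lambda>Z. L2_norm (\<lambda>t. (\<Sum>i\<in>Z. u i t) - H t)) \<longlongrightarrow> 0) (finite_subsets_at_top I)"
  proof (rule tendstoI)
    fix e :: real assume "e > 0"
    then obtain n where n: "(1/4::real) ^ n < e / 3"
      using real_arch_pow_inv[of "e/3" "1/4"] by auto
    have "eventually (\<lambda>Z. finite Z \<and> X n \<subseteq> Z \<and> Z \<subseteq> I) (finite_subsets_at_top I)"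
      using X by (intro eventually_finite_subsets_at_topI[of "X n"]) auto
    then show "eventually (\<lambda>Z. dist (L2_norm (\<lambda>t. (\<Sum>i\<in>Z. u i t) - H t)) 0 < e) (finite_subsets_at_top I)"
    proof eventually_elim
      case (elim Z)
      have "L2_norm (\<lambda>t. (\<Sum>i\<in>Z. u i t) - H t)
          \<le> L2_norm (\<lambda>t. (\<Sum>i\<in>Z. u i t) - F n t) + L2_norm (\<lambda>t. F n t - H t)"
        using elim u by (intro L2_triangle_diff F H L2_finite_sum) auto
      also have "\<dots> \<le> (1/4) ^ n + 2 * (1/4) ^ n"
        using tail[of Z n] elim H(2)[of n] unfolding F_def by auto
      also have "\<dots> < e" using n by linarith
      finally show ?case using L2_norm_nonneg[of "\<lambda>t. (\<Sum>i\<in>Z. u i t) - H t"] by simp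
    qed
  qed
  with H u show ?thesis unfolding L2_has_sum_def by blast
qed

lemma summable_on_small_tail:
  fixes a :: "'i \<Rightarrow> real"
  assumes "a summable_on I" and pos: "\<And>i. i \<in> I \<Longrightarrow> 0 \<le> a i" and e: "e > 0"
  obtains X where "finite X" "X \<subseteq> I" "\<And>Y. finite Y \<Longrightarrow> Y \<subseteq> I - X \<Longrightarrow> (\<Sum>i\<in>Y. a i) \<le> e"
proof -
  have "(a has_sum infsum a I) I" using assms(1) by (rule has_sum_infsum)
  then have "eventually (\<lambda>X. dist (sum a X) (infsum a I) < e) (finite_subsets_at_top I)"
    unfolding has_sum_def using e by (rule tendstoD)
  then obtain X where X: "finite X" "X \<subseteq> I" "dist (sum a X) (infsum a I) < e"
    by (auto simp: eventually_finite_subsets_at_top)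
  have "(\<Sum>i\<in>Y. a i) \<le> e" if Y: "finite Y" "Y \<subseteq> I - X" for Y
  proof -
    have "sum a X + sum a Y = sum a (X \<union> Y)"
      using X Y by (intro sum.union_disjoint[symmetric]) auto
    also have "\<dots> \<le> infsum a I"
      using X Y assms by (intro finite_sum_le_infsum) auto
    finally show ?thesis using X(3) by (simp add: dist_real_def)
  qed
  with X that show thesis by blast
qed

text \<open>The frame operator and the states \<open>Psi\<close> both exist by this lemma: a Bessel
  bound on finite sums turns a small tail of coefficients into a small tail in L2.\<close>

lemma L2_has_sum_bessel:
  fixes e :: "'i \<Rightarrow> real^'n \<Rightarrow> complex"
  assumes e: "\<And>i. i \<in> I \<Longrightarrow> e i \<in> L2"
    and bess: "\<And>X. finite X \<Longrightarrow> X \<subseteq> I \<Longrightarrow>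
      L2_norm (\<lambda>t. \<Sum>i\<in>X. a i * e i t) \<le> C * L2_set (\<lambda>i. cmod (a i)) X"
    and a: "(\<lambda>i. (cmod (a i))\<^sup>2) summable_on I"
  shows "\<exists>F. L2_has_sum (\<lambda>i t. a i * e i t) I F"
proof (rule L2_has_sum_exists)
  show "(\<lambda>t. a i * e i t) \<in> L2" if "i \<in> I" for i using e that by (intro L2_cmult)
  fix r :: real assume r: "r > 0"
  \<comment> \<open>The sign of \<open>C\<close> is unspecified and \<open>C\<close> may be zero,
    hence this denominator.\<close>
  define q where "q = r / (\<bar>C\<bar> + 1)"
  have q: "q > 0" using r by (simp add: q_def add_nonneg_pos)
  obtain X where X: "finite X" "X \<subseteq> I"
    "\<And>Y. finite Y \<Longrightarrow> Y \<subseteq> I - X \<Longrightarrow> (\<Sum>i\<in>Y. (cmod (a i))\<^sup>2) \<le> q\<^sup>2"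
    using summable_on_small_tail[OF a, of "q\<^sup>2"] q by auto
  have "L2_norm (\<lambda>t. \<Sum>i\<in>Y. a i * e i t) \<le> r" if Y: "finite Y" "Y \<subseteq> I - X" for Y
  proof -
    have "L2_set (\<lambda>i. cmod (a i)) Y \<le> q"
      unfolding L2_set_def using X(3)[OF Y] q by (simp add: real_le_lsqrt sum_nonneg)
    have "L2_norm (\<lambda>t. \<Sum>i\<in>Y. a i * e i t) \<le> C * L2_set (\<lambda>i. cmod (a i)) Y"
      using Y by (intro bess) auto
    also have "\<dots> \<le> (\<bar>C\<bar> + 1) * L2_set (\<lambda>i. cmod (a i)) Y"
      by (intro mult_right_mono) auto
    also have "\<dots> \<le> (\<bar>C\<bar> + 1) * q"
      using \<open>L2_set _ Y \<le> q\<close> by (intro mult_left_mono) auto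
    also have "\<dots> = r" by (simp add: q_def add_nonneg_eq_0_iff)
    finally show ?thesis .
  qed
  with X show "\<exists>X. finite X \<and> X \<subseteq> I \<and>
       (\<forall>Y. finite Y \<and> Y \<subseteq> I - X \<longrightarrow> L2_norm (\<lambda>t. \<Sum>i\<in>Y. a i * e i t) \<le> r)" by blast
qed

lemma L2_has_sum_L2_sum: "\<exists>F. L2_has_sum u I F \<Longrightarrow> L2_has_sum u I (L2_sum u I)"
  unfolding L2_sum_def by (rule someI_ex[where P = "L2_has_sum u I"])

lemma L2_has_sum_tendsto_inner:
  assumes s: "L2_has_sum u I F" and y: "y \<in> L2"
  shows "((\<lambda>i. L2_inner (u i) y) has_sum L2_inner F y) I"
  unfolding has_sum_def
proof (rule tendsto_norm_zero_cancel[THEN LIM_zero_cancel], rule tendsto_sandwich[OF _ _ tendsto_const])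
  have F: "F \<in> L2" "\<And>i. i \<in> I \<Longrightarrow> u i \<in> L2"
    and lim: "((\<lambda>X. L2_norm (\<lambda>t. (\<Sum>i\<in>X. u i t) - F t)) \<longlongrightarrow> 0) (finite_subsets_at_top I)"
    using s by (auto simp: L2_has_sum_def)
  show "((\<lambda>X. L2_norm (\<lambda>t. (\<Sum>i\<in>X. u i t) - F t) * L2_norm y) \<longlongrightarrow> 0) (finite_subsets_at_top I)"
    using tendsto_mult_right[OF lim, of "L2_norm y"] by simp
  have "eventually (\<lambda>X. finite X \<and> {} \<subseteq> X \<and> X \<subseteq> I) (finite_subsets_at_top I)"
    by (intro eventually_finite_subsets_at_topI[of "{}"]) auto
  then show "eventually (\<lambda>X. norm ((\<Sum>i\<in>X. L2_inner (u i) y) - L2_inner F y)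
      \<le> L2_norm (\<lambda>t. (\<Sum>i\<in>X. u i t) - F t) * L2_norm y) (finite_subsets_at_top I)"
  proof eventually_elim
    case (elim X)
    then have uX: "\<And>i. i \<in> X \<Longrightarrow> u i \<in> L2" using F by blast
    have "(\<Sum>i\<in>X. L2_inner (u i) y) - L2_inner F y = L2_inner (\<lambda>t. (\<Sum>i\<in>X. u i t) - F t) y"
      by (simp add: L2_inner_diff_left L2_finite_sum uX F y L2_inner_sum_left)
    then show ?case using L2_Cauchy_Schwarz[OF L2_diff[OF L2_finite_sum[OF uX] F(1)] y] by simp
  qed
qed (auto simp: always_eventually)

text \<open>Both limits have the same inner products with every test function, and their difference
  is itself a test function.\<close>

lemma L2_has_sum_unique:
  assumes "L2_has_sum u I F" "L2_has_sum u I H"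
  shows "AE t in lborel. F t = H t"
proof -
  have FH: "F \<in> L2" "H \<in> L2" using assms by (auto simp: L2_has_sum_def)
  let ?y = "\<lambda>t. F t - H t"
  have y: "?y \<in> L2" by (rule L2_diff[OF FH])
  have "L2_inner F ?y = L2_inner H ?y"
    by (rule has_sum_unique[OF L2_has_sum_tendsto_inner[OF assms(1) y] L2_has_sum_tendsto_inner[OF assms(2) y]])
  then have "L2_inner ?y ?y = 0" using L2_inner_diff_left[OF FH y] by simp
  then have "L2_norm ?y = 0" by (simp add: L2_inner_self)
  from L2_norm_eq_0_AE[OF y this] show ?thesis by eventually_elim simp
qed

lemma L2_has_sum_add:
  assumes "L2_has_sum u I F" "L2_has_sum v I H"
  shows "L2_has_sum (\<lambda>i t. u i t + v i t) I (\<lambda>t. F t + H t)"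
  unfolding L2_has_sum_def
proof (intro conjI ballI)
  have F: "F \<in> L2" "\<And>i. i \<in> I \<Longrightarrow> u i \<in> L2" and H: "H \<in> L2" "\<And>i. i \<in> I \<Longrightarrow> v i \<in> L2"
    using assms by (auto simp: L2_has_sum_def)
  show "(\<lambda>t. F t + H t) \<in> L2" using F H by (intro L2_add)
  show "(\<lambda>t. u i t + v i t) \<in> L2" if "i \<in> I" for i using F H that by (intro L2_add)
  show "((\<lambda>X. L2_norm (\<lambda>t. (\<Sum>i\<in>X. u i t + v i t) - (F t + H t))) \<longlongrightarrow> 0) (finite_subsets_at_top I)"
  proof (rule tendsto_sandwich[OF _ _ tendsto_const])
    show "((\<lambda>X. L2_norm (\<lambda>t. (\<Sum>i\<in>X. u i t) - F t) + L2_norm (\<lambda>t. (\<Sum>i\<in>X. v i t) - H t)) \<longlongrightarrow> 0)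
        (finite_subsets_at_top I)"
      using assms by (intro tendsto_add_zero) (auto simp: L2_has_sum_def)
    have "eventually (\<lambda>X. finite X \<and> {} \<subseteq> X \<and> X \<subseteq> I) (finite_subsets_at_top I)"
      by (intro eventually_finite_subsets_at_topI[of "{}"]) auto
    then show "eventually (\<lambda>X. L2_norm (\<lambda>t. (\<Sum>i\<in>X. u i t + v i t) - (F t + H t))
        \<le> L2_norm (\<lambda>t. (\<Sum>i\<in>X. u i t) - F t) + L2_norm (\<lambda>t. (\<Sum>i\<in>X. v i t) - H t)) (finite_subsets_at_top I)"
    proof eventually_elim
      case (elim X)
      have eq: "(\<lambda>t. (\<Sum>i\<in>X. u i t + v i t) - (F t + H t))
          = (\<lambda>t. ((\<Sum>i\<in>X. u i t) - F t) + ((\<Sum>i\<in>X. v i t) - H t))"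
        by (simp add: sum.distrib algebra_simps)
      show ?case unfolding eq
        using elim F H by (intro L2_triangle L2_diff L2_finite_sum) auto
    qed
  qed (auto simp: L2_norm_nonneg)
qed

lemma L2_has_sum_cmult:
  assumes "L2_has_sum u I F"
  shows "L2_has_sum (\<lambda>i t. c * u i t) I (\<lambda>t. c * F t)"
  unfolding L2_has_sum_def
proof (intro conjI ballI)
  show "(\<lambda>t. c * F t) \<in> L2" "\<And>i. i \<in> I \<Longrightarrow> (\<lambda>t. c * u i t) \<in> L2"
    using assms by (auto simp: L2_has_sum_def intro: L2_cmult)
  have "(\<lambda>X. L2_norm (\<lambda>t. (\<Sum>i\<in>X. c * u i t) - c * F t))
      = (\<lambda>X. cmod c * L2_norm (\<lambda>t. (\<Sum>i\<in>X. u i t) - F t))"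
    by (simp add: sum_distrib_left[symmetric] right_diff_distrib[symmetric] L2_norm_cmult)
  then show "((\<lambda>X. L2_norm (\<lambda>t. (\<Sum>i\<in>X. c * u i t) - c * F t)) \<longlongrightarrow> 0) (finite_subsets_at_top I)"
    using assms tendsto_mult_right_zero[of _ _ "cmod c"] by (auto simp: L2_has_sum_def)
qed

lemma L2_has_sum_sum:
  assumes "finite R" "\<And>r. r \<in> R \<Longrightarrow> L2_has_sum (u r) I (F r)" "R \<noteq> {}"
  shows "L2_has_sum (\<lambda>i t. \<Sum>r\<in>R. u r i t) I (\<lambda>t. \<Sum>r\<in>R. F r t)"
  using assms(1,3,2)
  by (induction R rule: finite_ne_induct) (auto intro: L2_has_sum_add)

section \<open>A sup-norm bound by the Fourier transform\<close>

text \<open>Lebesgue measure is the image of a product measure under the coordinates. This serves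
  three times: for Gaussians, for the weight dominating Schwartz functions, and for characters on a
  cell.\<close>

lemma lborel_product_integral:
  fixes f :: "'a::euclidean_space \<Rightarrow> real \<Rightarrow> 'b::{real_normed_field,banach,second_countable_topology}"
  assumes int: "\<And>b. b \<in> Basis \<Longrightarrow> integrable lborel (f b)"
  shows "integrable lborel (\<lambda>x::'a. \<Prod>b\<in>Basis. f b (x \<bullet> b))" (is ?int)
    and "(LINT x|lborel. (\<Prod>b\<in>Basis. f b ((x::'a) \<bullet> b))) = (\<Prod>b\<in>Basis. LINT x|lborel. f b x)" (is ?eq)
proof -
  interpret P: product_sigma_finite "\<lambda>b::'a. lborel :: real measure"
    by standard
  let ?P = "\<Pi>\<^sub>M b\<in>(Basis::'a set). (lborel :: real measure)"
  let ?T = "\<lambda>g::'a \<Rightarrow> real. \<Sum>b\<in>Basis. g b *\<^sub>R b"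
  let ?F = "\<lambda>x::'a. \<Prod>b\<in>Basis. f b (x \<bullet> b)"
  have T: "?T \<in> measurable ?P borel"
    by measurable
  have F: "?F \<in> borel_measurable borel"
  proof (intro borel_measurable_prod)
    fix b :: 'a assume "b \<in> Basis"
    then have "f b \<in> borel_measurable borel" using int[of b] by auto
    moreover have "(\<lambda>x::'a. x \<bullet> b) \<in> borel_measurable borel" by simp
    ultimately show "(\<lambda>x. f b (x \<bullet> b)) \<in> borel_measurable borel" by (rule measurable_compose[rotated])
  qed
  have FT: "?F (?T g) = (\<Prod>b\<in>Basis. f b (g b))" for g
    by (intro prod.cong refl) simp
  have eq: "(lborel :: 'a measure) = distr ?P borel ?T"
    by (rule lborel_eq)
  have i: "integrable ?P (\<lambda>g. \<Prod>b\<in>Basis. f b (g b))"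
    by (rule P.product_integrable_prod) (auto simp: int)
  have "integrable (distr ?P borel ?T) ?F"
    by (subst integrable_distr_eq[OF T F]) (simp only: FT i)
  then show ?int by (subst eq)
  have "integral\<^sup>L lborel ?F = integral\<^sup>L (distr ?P borel ?T) ?F"
    by (rule arg_cong[where f = "\<lambda>M. integral\<^sup>L M ?F", OF eq])
  also have "\<dots> = (\<integral>g. (\<Prod>b\<in>Basis. f b (g b)) \<partial>?P)"
    by (subst integral_distr[OF T F]) (simp only: FT)
  also have "\<dots> = (\<Prod>b\<in>Basis. LINT x|lborel. f b x)"
    by (rule P.product_integral_prod) (auto simp: int)
  finally show ?eq .
qed

lemma cis_measurable [measurable]:
  "f \<in> borel_measurable M \<Longrightarrow> (\<lambda>x. cis (f x)) \<in> borel_measurable M"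
  using measurable_compose[of f M borel cis borel]
  by (simp add: borel_measurable_continuous_onI continuous_on_cis continuous_on_id)

text \<open>The characteristic function of the standard normal distribution, rescaled by the
  substitution of e x for x.\<close>

lemma gaussian_fourier_real:
  fixes e s :: real
  assumes e: "e > 0"
  shows "integrable lborel (\<lambda>x. of_real (exp (- (e * x)\<^sup>2 / 2)) * cis (s * x))"
    and "(LINT x|lborel. of_real (exp (- (e * x)\<^sup>2 / 2)) * cis (s * x))
      = of_real (sqrt (2 * pi) / e * exp (- (s / e)\<^sup>2 / 2))"
proof -
  let ?h = "\<lambda>x. of_real (std_normal_density x) * cis ((s / e) * x)"
  have h: "integrable lborel ?h"
  proof (rule Bochner_Integration.integrable_bound[OF integrable_normal_density[where \<mu> = 0 and \<sigma> = 1]])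
    show "?h \<in> borel_measurable lborel"
      by measurable
  qed (auto simp: norm_mult)
  have I: "integral\<^sup>L lborel ?h = of_real (exp (- (s / e)\<^sup>2 / 2))"
  proof -
    have "integral\<^sup>L lborel ?h = (CLINT x|density lborel std_normal_density. iexp ((s / e) * x))"
      by (subst integral_density)
        (auto simp: scaleR_conv_of_real cis_conv_exp)
    also have "\<dots> = char std_normal_distribution (s / e)" by (simp add: char_def)
    finally show ?thesis by (simp add: char_std_normal_distribution)
  qed
  have *: "sqrt (2 * pi) * std_normal_density (e * x) = exp (- (e * x)\<^sup>2 / 2)" for x
    unfolding std_normal_density_def by simp
  have eq: "(\<lambda>x. of_real (sqrt (2 * pi)) * ?h (0 + e * x)) = (\<lambda>x. of_real (exp (- (e * x)\<^sup>2 / 2)) * cis (s * x))"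
  proof
    fix x
    have "of_real (sqrt (2 * pi)) * ?h (0 + e * x)
        = of_real (sqrt (2 * pi) * std_normal_density (e * x)) * cis ((s / e) * (e * x))"
      unfolding of_real_mult add_0 by (simp only: mult.assoc)
    also have "(s / e) * (e * x) = s * x" using e by simp
    finally show "of_real (sqrt (2 * pi)) * ?h (0 + e * x) = of_real (exp (- (e * x)\<^sup>2 / 2)) * cis (s * x)"
      unfolding * .
  qed
  have hi: "integrable lborel (\<lambda>x. ?h (0 + e * x))"
    using lborel_integrable_real_affine[OF h, of e 0] e by simp
  show "integrable lborel (\<lambda>x. of_real (exp (- (e * x)\<^sup>2 / 2)) * cis (s * x))"
    unfolding eq[symmetric] by (rule integrable_mult_right[OF hi])
  have "integral\<^sup>L lborel ?h = \<bar>e\<bar> *\<^sub>R (LINT x|lborel. ?h (0 + e * x))"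
    by (rule lborel_integral_real_affine) (use e in auto)
  then have "(LINT x|lborel. ?h (0 + e * x)) = of_real (exp (- (s / e)\<^sup>2 / 2) / e)"
    unfolding I using e by (simp add: scaleR_conv_of_real field_simps)
  then show "(LINT x|lborel. of_real (exp (- (e * x)\<^sup>2 / 2)) * cis (s * x))
      = of_real (sqrt (2 * pi) / e * exp (- (s / e)\<^sup>2 / 2))"
    unfolding eq[symmetric] integral_mult_right_zero by simp
qed

lemma cis_prod: "finite A \<Longrightarrow> cis (\<Sum>a\<in>A. f a) = (\<Prod>a\<in>A. cis (f a))"
  by (induction A rule: finite_induct) (auto simp flip: cis_mult)

text \<open>Product over the coordinates of the one-dimensional case with frequencies 2 pi (u . b);
  the exponents add up because the squared norm is the sum of the squared coordinates.\<close>

lemma gaussian_fourier: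
  fixes e :: real and u :: "'a::euclidean_space"
  assumes e: "e > 0"
  shows "integrable lborel (\<lambda>x::'a. of_real (exp (- (e * norm x)\<^sup>2 / 2)) * cis (2 * pi * (x \<bullet> u)))" (is ?int)
    and "(LINT x|lborel. of_real (exp (- (e * norm (x::'a))\<^sup>2 / 2)) * cis (2 * pi * (x \<bullet> u)))
      = of_real ((sqrt (2 * pi) / e) ^ DIM('a) * exp (- 2 * (pi * norm u / e)\<^sup>2))" (is ?eq)
proof -
  let ?f = "\<lambda>b::'a. \<lambda>x. complex_of_real (exp (- (e * x)\<^sup>2 / 2)) * cis ((2 * pi * (u \<bullet> b)) * x)"
  have nsq: "(norm x)\<^sup>2 = (\<Sum>b\<in>Basis. (x \<bullet> b)\<^sup>2)" for x :: 'a
    unfolding power2_norm_eq_inner by (subst euclidean_inner) (simp add: power2_eq_square)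
  have eq: "(\<lambda>x::'a. \<Prod>b\<in>Basis. ?f b (x \<bullet> b))
      = (\<lambda>x. of_real (exp (- (e * norm x)\<^sup>2 / 2)) * cis (2 * pi * (x \<bullet> u)))"
  proof
    fix x :: 'a
    have "(\<Prod>b\<in>Basis. ?f b (x \<bullet> b))
        = of_real (exp (\<Sum>b\<in>Basis. - (e * (x \<bullet> b))\<^sup>2 / 2)) * cis (\<Sum>b\<in>Basis. 2 * pi * (u \<bullet> b) * (x \<bullet> b))"
      by (simp add: prod.distrib cis_prod exp_sum)
    also have "(\<Sum>b\<in>Basis. - (e * (x \<bullet> b))\<^sup>2 / 2) = - (e * norm x)\<^sup>2 / 2"
      by (simp add: power_mult_distrib nsq sum_distrib_left sum_negf sum_divide_distrib)
    also have "(\<Sum>b\<in>Basis. 2 * pi * (u \<bullet> b) * (x \<bullet> b)) = 2 * pi * (x \<bullet> u)"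
      by (subst euclidean_inner[of x u]) (simp add: sum_distrib_left mult_ac)
    finally show "(\<Prod>b\<in>Basis. ?f b (x \<bullet> b)) = of_real (exp (- (e * norm x)\<^sup>2 / 2)) * cis (2 * pi * (x \<bullet> u))" .
  qed
  have i: "\<And>b. b \<in> Basis \<Longrightarrow> integrable lborel (?f b)"
    by (rule gaussian_fourier_real(1)[OF e])
  show ?int using lborel_product_integral(1)[of ?f, OF i] unfolding eq .
  have "(LINT x|lborel. of_real (exp (- (e * norm (x::'a))\<^sup>2 / 2)) * cis (2 * pi * (x \<bullet> u)))
      = (\<Prod>b\<in>Basis. of_real (sqrt (2 * pi) / e * exp (- (2 * pi * (u \<bullet> b) / e)\<^sup>2 / 2)))"
    using lborel_product_integral(2)[of ?f, OF i] unfolding eq gaussian_fourier_real(2)[OF e] .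
  also have "\<dots> = of_real ((sqrt (2 * pi) / e) ^ DIM('a) * exp (\<Sum>b\<in>(Basis::'a set). - (2 * pi * (u \<bullet> b) / e)\<^sup>2 / 2))"
    by (simp only: of_real_prod[symmetric] prod.distrib prod_constant exp_sum[OF finite_Basis])
  also have "(\<Sum>b\<in>(Basis::'a set). - (2 * pi * (u \<bullet> b) / e)\<^sup>2 / 2) = - 2 * (pi * norm u / e)\<^sup>2"
    by (simp add: power_mult_distrib power_divide nsq sum_distrib_left sum_negf sum_divide_distrib)
  finally show ?eq .
qed

text \<open>This is the smoothing kernel of \<open>fourier_sup_bound\<close> at distance \<delta>
  and scale 1 / (j + 1). Since x \<le> x^2 for x at least 1, the Gaussian is dominated by an
  exponential, which beats every power.\<close>

lemma gaussian_tail_tendsto: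
  fixes \<delta> :: real
  assumes \<delta>: "\<delta> > 0"
  shows "((\<lambda>j::nat. (sqrt (2 * pi) * real (Suc j)) ^ n * exp (- 2 * (pi * \<delta> * real (Suc j))\<^sup>2)) \<longlongrightarrow> 0) sequentially"
proof (rule tendsto_sandwich[OF _ _ tendsto_const])
  define c where "c = 2 * (pi * \<delta>)\<^sup>2"
  have c: "c > 0" using \<delta> by (simp add: c_def)
  have lim: "filterlim (\<lambda>j. c * real (Suc j)) at_top sequentially"
    by (rule filterlim_tendsto_pos_mult_at_top[OF tendsto_const c])
      (rule filterlim_compose[OF filterlim_real_sequentially filterlim_Suc])
  have "((\<lambda>j. (c * real (Suc j)) ^ n / exp (c * real (Suc j))) \<longlongrightarrow> 0) sequentially"
    by (rule filterlim_compose[OF tendsto_power_div_exp_0 lim])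
  from tendsto_mult_right_zero[OF this, of "(sqrt (2 * pi) / c) ^ n"]
  show "((\<lambda>j. (sqrt (2 * pi) / c) ^ n * ((c * real (Suc j)) ^ n / exp (c * real (Suc j)))) \<longlongrightarrow> 0) sequentially" .
  show "eventually (\<lambda>j::nat. (sqrt (2 * pi) * real (Suc j)) ^ n * exp (- 2 * (pi * \<delta> * real (Suc j))\<^sup>2)
      \<le> (sqrt (2 * pi) / c) ^ n * ((c * real (Suc j)) ^ n / exp (c * real (Suc j)))) sequentially"
  proof (intro always_eventually allI)
    fix j :: nat
    define x where "x = real (Suc j)"
    have x: "x \<ge> 1" by (simp add: x_def)
    have "c * x * 1 \<le> c * x * x" using c x by (intro mult_left_mono) auto
    also have "c * x * x = 2 * (pi * \<delta> * x)\<^sup>2" by (simp add: c_def power2_eq_square)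
    finally have "exp (- 2 * (pi * \<delta> * x)\<^sup>2) \<le> exp (- (c * x))" by simp
    then have "(sqrt (2 * pi) * x) ^ n * exp (- 2 * (pi * \<delta> * x)\<^sup>2) \<le> (sqrt (2 * pi) * x) ^ n * exp (- (c * x))"
      using x by (intro mult_left_mono) auto
    also have "\<dots> = (sqrt (2 * pi) / c) ^ n * ((c * x) ^ n / exp (c * x))"
    proof -
      have "sqrt (2 * pi) * x = (sqrt (2 * pi) / c) * (c * x)" using c by simp
      then have "(sqrt (2 * pi) * x) ^ n = (sqrt (2 * pi) / c) ^ n * (c * x) ^ n"
        by (simp only: power_mult_distrib)
      then show ?thesis by (simp only: exp_minus divide_inverse mult.assoc)
    qed
    finally show "(sqrt (2 * pi) * real (Suc j)) ^ n * exp (- 2 * (pi * \<delta> * real (Suc j))\<^sup>2)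
      \<le> (sqrt (2 * pi) / c) ^ n * ((c * real (Suc j)) ^ n / exp (c * real (Suc j)))" unfolding x_def .
  qed
qed (auto intro!: always_eventually)



text \<open>Smoothing \<open>F\<close> with a Gaussian turns the Fourier transform into an absolutely convergent
  integral; only a lower bound for the mass of the Gaussian near its centre is used, so that the
  constant is not optimal.\<close>

lemma fourier_sup_bound:
  fixes F :: "'a::euclidean_space \<Rightarrow> complex" and x :: 'a
  assumes F: "integrable lborel F" and cont: "continuous_on UNIV F"
    and Fh: "integrable lborel (\<lambda>\<omega>::'a. LINT t|lborel. F t * cis (- (2 * pi * (\<omega> \<bullet> t))))"
  shows "cmod (F x) * ((sqrt (2 * pi)) ^ DIM('a) * exp (- 2 * pi\<^sup>2) * unit_ball_vol (real DIM('a)))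
    \<le> 2 * (LINT \<omega>|lborel. cmod (LINT t|lborel. F t * cis (- (2 * pi * (\<omega> \<bullet> t)))))"
proof (cases "F x = 0")
  case True
  have "0 \<le> (LINT \<omega>|lborel. cmod (LINT t|lborel. F t * cis (- (2 * pi * (\<omega> \<bullet> t)))))"
    by (rule integral_nonneg_AE) auto
  with True show ?thesis by simp
next
  case False
  let ?n = "DIM('a)"
  let ?Fh = "\<lambda>\<omega>::'a. LINT t|lborel. F t * cis (- (2 * pi * (\<omega> \<bullet> t)))"
  define v where "v = (LINT \<omega>|lborel. cmod (?Fh \<omega>))"
  \<comment> \<open>The Fourier transform of exp (- (e |\<omega>|)^2 / 2): a Gaussian of mass 1 and
    width of order e.\<close>
  define k where "k e u = (sqrt (2 * pi) / e) ^ ?n * exp (- 2 * (pi * norm u / e)\<^sup>2)" for e and u :: 'a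
  have [measurable]: "F \<in> borel_measurable borel" using F by auto
  have k0: "e > 0 \<Longrightarrow> 0 \<le> k e u" for e u by (simp add: k_def)
  have kmono: "e > 0 \<Longrightarrow> norm u \<le> norm u' \<Longrightarrow> k e u' \<le> k e u" for e u u'
    unfolding k_def by (auto intro!: mult_left_mono power_mono divide_right_mono simp: zero_le_divide_iff)
  have [measurable]: "(\<lambda>u. k e u) \<in> borel_measurable borel" for e
    unfolding k_def by measurable
  have kle: "e > 0 \<Longrightarrow> k e u \<le> k e 0" for e u
    by (rule kmono) auto
  have Fk: "integrable lborel (\<lambda>t. F t * of_real (k e (x - t)))" if e: "e > 0" for e
  proof (rule Bochner_Integration.integrable_bound[OF integrable_mult_right[OF integrable_norm[OF F], of "k e 0"]])
    show "AE t in lborel. norm (F t * of_real (k e (x - t))) \<le> norm (k e 0 * norm (F t))"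
    proof (rule AE_I2)
      fix t
      show "norm (F t * of_real (k e (x - t))) \<le> norm (k e 0 * norm (F t))"
        using mult_right_mono[OF kle[OF e, of "x - t"], of "cmod (F t)"] k0[OF e]
        by (simp add: norm_mult mult.commute)
    qed
  qed measurable
  \<comment> \<open>Fubini turns the convolution with \<open>k e\<close> into an integral of the
    Fourier transform against a factor of modulus at most 1.\<close>
  have smooth: "cmod (LINT t|lborel. F t * of_real (k e (x - t))) \<le> v" if e: "e > 0" for e
  proof -
    let ?G = "\<lambda>\<omega>::'a. of_real (exp (- (e * norm \<omega>)\<^sup>2 / 2)) * cis (2 * pi * (\<omega> \<bullet> x))"
    let ?H = "\<lambda>t \<omega>. F t * (of_real (exp (- (e * norm \<omega>)\<^sup>2 / 2)) * cis (2 * pi * (\<omega> \<bullet> (x - t))))"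
    have Hm: "case_prod ?H \<in> borel_measurable (lborel \<Otimes>\<^sub>M lborel)"
      by measurable
    have Hi: "integrable (lborel \<Otimes>\<^sub>M lborel) (case_prod ?H)"
    proof (rule lborel_pair.Fubini_integrable[OF Hm])
      show "integrable lborel (\<lambda>t. LINT \<omega>|lborel. norm (case (t, \<omega>) of (t, \<omega>) \<Rightarrow> ?H t \<omega>))"
        using integrable_mult_left[OF integrable_norm[OF F]] by (simp add: norm_mult)
      show "AE t in lborel. integrable lborel (\<lambda>\<omega>. case (t, \<omega>) of (t, \<omega>) \<Rightarrow> ?H t \<omega>)"
        using gaussian_fourier(1)[OF e] by (auto intro!: AE_I2 integrable_mult_right)
    qed
    have "(LINT t|lborel. F t * of_real (k e (x - t))) = (LINT t|lborel. LINT \<omega>|lborel. ?H t \<omega>)"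
      unfolding integral_mult_right_zero gaussian_fourier(2)[OF e] k_def ..
    also have "\<dots> = (LINT \<omega>|lborel. LINT t|lborel. ?H t \<omega>)"
      by (rule lborel_pair.Fubini_integral[OF Hi, symmetric])
    also have "\<dots> = (LINT \<omega>|lborel. ?G \<omega> * ?Fh \<omega>)"
    proof (rule Bochner_Integration.integral_cong[OF refl])
      fix \<omega> :: 'a
      have "?H t \<omega> = ?G \<omega> * (F t * cis (- (2 * pi * (\<omega> \<bullet> t))))" for t
      proof -
        have "cis (2 * pi * (\<omega> \<bullet> (x - t))) = cis (2 * pi * (\<omega> \<bullet> x)) * cis (- (2 * pi * (\<omega> \<bullet> t)))"
          by (simp add: cis_mult inner_diff_right algebra_simps)
        then show ?thesis by (simp only: mult_ac)
      qed
      then show "(LINT t|lborel. ?H t \<omega>) = ?G \<omega> * ?Fh \<omega>"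
        by (simp only: integral_mult_right_zero)
    qed
    finally have "cmod (LINT t|lborel. F t * of_real (k e (x - t))) \<le> (LINT \<omega>|lborel. cmod (?G \<omega> * ?Fh \<omega>))"
      by (simp only: integral_norm_bound)
    also have "\<dots> \<le> v"
      unfolding v_def
    proof (rule integral_mono_AE)
      show "integrable lborel (\<lambda>\<omega>. cmod (?Fh \<omega>))" using Fh by (rule integrable_norm)
      have le: "cmod (?G \<omega> * ?Fh \<omega>) \<le> cmod (?Fh \<omega>)" for \<omega>
        by (simp add: norm_mult mult_left_le_one_le)
      then show "AE \<omega> in lborel. cmod (?G \<omega> * ?Fh \<omega>) \<le> cmod (?Fh \<omega>)" by simp
      show "integrable lborel (\<lambda>\<omega>. cmod (?G \<omega> * ?Fh \<omega>))"
      proof (rule Bochner_Integration.integrable_bound[OF Fh])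
        have "?Fh \<in> borel_measurable borel" using Fh by auto
        then show "(\<lambda>\<omega>. cmod (?G \<omega> * ?Fh \<omega>)) \<in> borel_measurable lborel" by measurable
      qed (use le in auto)
    qed
    finally show ?thesis .
  qed
  \<comment> \<open>A unimodular factor rotating F x to the positive axis, so that real parts give
    lower bounds.\<close>
  define a where "a = cnj (sgn (F x))"
  have na: "cmod a = 1" using False by (simp add: a_def norm_sgn)
  have aF: "a * F x = of_real (cmod (F x))"
    using False by (simp add: a_def sgn_eq mult.commute complex_norm_square[symmetric] power2_eq_square)
  obtain \<delta> where \<delta>: "\<delta> > 0" "\<And>t. dist t x < \<delta> \<Longrightarrow> dist (F t) (F x) < cmod (F x) / 2"
    using cont[unfolded continuous_on_iff, rule_format, of x "cmod (F x) / 2"] False by auto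
  have near: "cmod (F x) / 2 \<le> Re (a * F t)" if "dist t x < \<delta>" for t
  proof -
    have "Re (a * F x) - Re (a * F t) \<le> cmod (a * F x - a * F t)"
      using complex_Re_le_cmod[of "a * F x - a * F t"] by simp
    also have "\<dots> = dist (F t) (F x)"
      by (simp add: right_diff_distrib[symmetric] norm_mult na dist_norm norm_minus_commute)
    finally show ?thesis using \<delta>(2)[OF that] aF by simp
  qed
  define c0 where "c0 = (sqrt (2 * pi)) ^ ?n * exp (- 2 * pi\<^sup>2) * unit_ball_vol (real ?n)"
  define N where "N = (LINT t|lborel. cmod (F t))"
  have N0: "0 \<le> N" unfolding N_def by (rule integral_nonneg_AE) auto
  let ?tail = "\<lambda>e. (sqrt (2 * pi) / e) ^ ?n * exp (- 2 * (pi * \<delta> / e)\<^sup>2)"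
  \<comment> \<open>Three regions: within e of x both the kernel and the real part are bounded
    below, between e and \<delta> the integrand is nonnegative, and beyond \<delta> the kernel is at
    most \<open>?tail e\<close>. The factor 1/2 is the loss from continuity of F at x.\<close>
  have main: "cmod (F x) / 2 * c0 - ?tail e * N \<le> v" if e: "0 < e" "e \<le> \<delta>" for e
  proof -
    \<comment> \<open>The kernel at distance e. Times the volume of the ball of radius e it gives
      \<open>c0\<close> for every e, so the bound survives letting e tend to 0.\<close>
    let ?m = "(sqrt (2 * pi) / e) ^ ?n * exp (- 2 * pi\<^sup>2)"
    let ?L = "\<lambda>t. cmod (F x) / 2 * ?m * indicator (ball x e) t - ?tail e * cmod (F t)"
    have iL: "integrable lborel ?L"
      using F by (intro Bochner_Integration.integrable_diff integrable_mult_right integrable_norm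
        integrable_real_indicator) (auto simp: emeasure_ball e(1) less_imp_le)
    have "cmod (F x) / 2 * c0 - ?tail e * N = (LINT t|lborel. ?L t)"
    proof -
      have "(LINT t|lborel. ?L t) = cmod (F x) / 2 * ?m * measure lborel (ball x e) - ?tail e * N"
        using F unfolding N_def
        by (subst Bochner_Integration.integral_diff)
          (auto simp: emeasure_ball e(1) less_imp_le integrable_norm intro!: integrable_real_indicator)
      moreover have "?m * measure lborel (ball x e) = c0"
        using e by (simp add: c0_def power_divide content_ball)
      ultimately show ?thesis by (simp only: mult.assoc)
    qed
    also have "\<dots> \<le> (LINT t|lborel. Re (a * (F t * of_real (k e (x - t)))))"
    proof (rule integral_mono[OF iL])
      show "integrable lborel (\<lambda>t. Re (a * (F t * of_real (k e (x - t)))))"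
        by (intro integrable_Re integrable_mult_right Fk e)
      fix t
      have tail0: "0 \<le> ?tail e * cmod (F t)" using e by simp
      have R: "Re (a * (F t * of_real (k e (x - t)))) = Re (a * F t) * k e (x - t)"
        by (simp add: mult.assoc[symmetric])
      consider "dist t x < e" | "\<not> dist t x < e" "dist t x < \<delta>" | "\<not> dist t x < e" "\<not> dist t x < \<delta>" by blast
      then show "?L t \<le> Re (a * (F t * of_real (k e (x - t))))"
      proof cases
        case 1
        have "?m \<le> k e (x - t)"
        proof -
          have "(pi * norm (x - t) / e)\<^sup>2 \<le> pi\<^sup>2"
          proof (rule power_mono)
            show "pi * norm (x - t) / e \<le> pi"
              using 1 e by (simp add: dist_norm norm_minus_commute pos_divide_le_eq)
          qed (use e in simp)
          then show ?thesis unfolding k_def using e by (intro mult_left_mono) auto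
        qed
        then have "cmod (F x) / 2 * ?m \<le> Re (a * F t) * k e (x - t)"
        proof (intro mult_mono)
          show n: "cmod (F x) / 2 \<le> Re (a * F t)" using near[of t] 1 e by simp
          show "0 \<le> Re (a * F t)" by (rule order_trans[OF _ n]) simp
        qed (use e in auto)
        with 1 tail0 show ?thesis unfolding R by (simp add: dist_commute)
      next
        case 2
        have "0 \<le> Re (a * F t) * k e (x - t)"
          by (rule mult_nonneg_nonneg[OF order_trans[OF _ near[OF 2(2)]] k0[OF e(1)]]) simp
        with 2 tail0 show ?thesis unfolding R by (simp add: dist_commute)
      next
        case 3
        have "k e (x - t) \<le> ?tail e"
        proof -
          have "(pi * \<delta> / e)\<^sup>2 \<le> (pi * norm (x - t) / e)\<^sup>2"
            using 3 e \<delta> by (intro power_mono divide_right_mono mult_left_mono)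
              (auto simp: dist_norm norm_minus_commute)
          then show ?thesis unfolding k_def using e by (intro mult_left_mono) auto
        qed
        then have "cmod (F t) * k e (x - t) \<le> cmod (F t) * ?tail e"
          by (intro mult_left_mono) auto
        moreover have "- (Re (a * F t) * k e (x - t)) \<le> cmod (F t) * k e (x - t)"
        proof -
          have "- Re (a * F t) \<le> cmod (F t)"
            using abs_Re_le_cmod[of "a * F t"] na unfolding norm_mult by simp
          from mult_right_mono[OF this k0[OF e(1), of "x - t"]] show ?thesis
            by (simp only: mult_minus_left)
        qed
        ultimately show ?thesis using 3 unfolding R by (simp add: dist_commute mult.commute)
      qed
    qed
    also have "\<dots> = Re (a * (LINT t|lborel. F t * of_real (k e (x - t))))"
      by (simp only: integral_mult_right_zero[symmetric] integral_Re[OF integrable_mult_right[OF Fk[OF e(1)]]])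
    also have "\<dots> \<le> cmod (a * (LINT t|lborel. F t * of_real (k e (x - t))))"
      by (rule complex_Re_le_cmod)
    also have "\<dots> \<le> v" using smooth[OF e(1)] by (simp add: norm_mult na)
    finally show ?thesis .
  qed
  have "((\<lambda>j::nat. cmod (F x) / 2 * c0 - ?tail (1 / real (Suc j)) * N) \<longlongrightarrow> cmod (F x) / 2 * c0 - 0 * N) sequentially"
    using gaussian_tail_tendsto[OF \<delta>(1), of ?n] by (intro tendsto_intros) simp
  moreover have "eventually (\<lambda>j::nat. cmod (F x) / 2 * c0 - ?tail (1 / real (Suc j)) * N \<le> v) sequentially"
  proof -
    obtain J :: nat where J: "1 / real (Suc J) < \<delta>" using nat_approx_posE[OF \<delta>(1)] by blast
    show ?thesis
    proof (rule eventually_sequentiallyI[of J])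
      fix j assume "J \<le> j"
      then have "1 / real (Suc j) \<le> 1 / real (Suc J)" by (intro divide_left_mono) auto
      then show "cmod (F x) / 2 * c0 - ?tail (1 / real (Suc j)) * N \<le> v"
        using J by (intro main) auto
    qed
  qed
  ultimately have "cmod (F x) / 2 * c0 - 0 * N \<le> v"
    by (rule tendsto_upperbound) simp
  then show ?thesis unfolding v_def c0_def by simp
qed

section \<open>Feichtinger functions are dominated by a summable sequence over cells\<close>

lemma translate_measurable:
  fixes y :: "'a::euclidean_space"
  assumes "f \<in> borel_measurable borel"
  shows "(\<lambda>t. f (t - y)) \<in> borel_measurable borel"
  using assms by measurable

lemma lborel_integral_translate:
  fixes f :: "'a::euclidean_space \<Rightarrow> 'b::{banach, second_countable_topology}"
  assumes f: "f \<in> borel_measurable borel"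
  shows "(LINT t|lborel. f (t - y)) = integral\<^sup>L lborel f"
    and "integrable lborel (\<lambda>t. f (t - y)) \<longleftrightarrow> integrable lborel f"
proof -
  have T: "(+) (- y) \<in> measurable lborel borel" by simp
  have "integral\<^sup>L lborel f = integral\<^sup>L (distr lborel borel ((+) (- y))) f"
    by (simp only: lborel_distr_plus)
  also have "\<dots> = (LINT t|lborel. f (- y + t))" by (rule integral_distr[OF T f])
  finally show "(LINT t|lborel. f (t - y)) = integral\<^sup>L lborel f" by simp
  have "integrable lborel f \<longleftrightarrow> integrable (distr lborel borel ((+) (- y))) f"
    by (simp only: lborel_distr_plus)
  also have "\<dots> \<longleftrightarrow> integrable lborel (\<lambda>t. f (- y + t))" by (rule integrable_distr_eq[OF T f])
  finally show "integrable lborel (\<lambda>t. f (t - y)) \<longleftrightarrow> integrable lborel f" by simp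
qed

lemma L2_translate: "f \<in> L2 \<Longrightarrow> (\<lambda>t. f (t - y)) \<in> L2"
  unfolding L2_def using lborel_integral_translate(2)[of "\<lambda>t. (cmod (f t))\<^sup>2" y]
  by (auto intro: translate_measurable)

lemma inverse_poly_integrable:
  "integrable lborel (\<lambda>x::'a::euclidean_space. \<Prod>b\<in>Basis. inverse (1 + (x \<bullet> b)\<^sup>2))"
proof (rule lborel_product_integral(1))
  show "integrable lborel (\<lambda>x::real. inverse (1 + x\<^sup>2))"
    using integrable_inverse_1_plus_square by (simp add: set_integrable_def einterval_def)
qed

text \<open>The decay exponent is the dimension n: the square of (1 + |x|)^n dominates the product
  of the n factors 1 + (x . b)^2, and the inverse of that product is integrable.\<close>

lemma schwartz_L2:
  fixes \<phi> :: "real^'n \<Rightarrow> complex"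
  assumes "schwartz \<phi>"
  shows "continuous_on UNIV \<phi>" "\<phi> \<in> L2"
proof -
  have diff: "\<forall>x. \<phi> differentiable (at x)"
    and bdd: "bounded (range (\<lambda>x. (1 + norm x) ^ CARD('n) *\<^sub>R \<phi> x))"
    using assms[unfolded schwartz_def, rule_format, of "[]"] by auto
  show cont: "continuous_on UNIV \<phi>"
    using diff by (intro continuous_at_imp_continuous_on ballI differentiable_imp_continuous_within) auto
  obtain K where K: "\<And>x. norm ((1 + norm x) ^ CARD('n) *\<^sub>R \<phi> x) \<le> K"
    using bdd by (auto simp: bounded_iff)
  show "\<phi> \<in> L2"
  proof (rule L2_bound)
    show "\<phi> \<in> borel_measurable borel" using cont by (rule borel_measurable_continuous_onI)
    show "integrable lborel (\<lambda>x::real^'n. K\<^sup>2 * (\<Prod>b\<in>Basis. inverse (1 + (x \<bullet> b)\<^sup>2)))"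
      by (intro integrable_mult_right inverse_poly_integrable)
    fix x :: "real^'n"
    have "(\<Prod>b\<in>(Basis :: (real^'n) set). (1 + (x \<bullet> b)\<^sup>2)) \<le> (\<Prod>b\<in>(Basis :: (real^'n) set). (1 + norm x)\<^sup>2)"
    proof (intro prod_mono conjI)
      fix b :: "real^'n" assume "b \<in> Basis"
      then have "(x \<bullet> b)\<^sup>2 \<le> (norm x)\<^sup>2"
        by (metis Basis_le_norm norm_ge_zero abs_le_square_iff abs_norm_cancel)
      also have "1 + (norm x)\<^sup>2 \<le> (1 + norm x)\<^sup>2" by (simp add: power2_eq_square algebra_simps)
      finally show "1 + (x \<bullet> b)\<^sup>2 \<le> (1 + norm x)\<^sup>2" by simp
    qed simp
    also have "\<dots> = ((1 + norm x) ^ CARD('n))\<^sup>2" by (simp add: power_mult[symmetric] mult.commute)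
    finally have "(\<Prod>b\<in>(Basis :: (real^'n) set). (1 + (x \<bullet> b)\<^sup>2)) * (cmod (\<phi> x))\<^sup>2
        \<le> ((1 + norm x) ^ CARD('n))\<^sup>2 * (cmod (\<phi> x))\<^sup>2"
      by (rule mult_right_mono) simp
    also have "\<dots> = (norm ((1 + norm x) ^ CARD('n) *\<^sub>R \<phi> x))\<^sup>2"
      by (simp add: power_mult_distrib)
    also have "\<dots> \<le> K\<^sup>2" by (intro power_mono K) simp
    finally have le: "(\<Prod>b\<in>(Basis :: (real^'n) set). (1 + (x \<bullet> b)\<^sup>2)) * (cmod (\<phi> x))\<^sup>2 \<le> K\<^sup>2" .
    have pos: "(\<Prod>b\<in>(Basis :: (real^'n) set). (1 + (x \<bullet> b)\<^sup>2)) > 0"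
      by (intro prod_pos) (simp add: add_pos_nonneg)
    have "(cmod (\<phi> x))\<^sup>2 \<le> K\<^sup>2 / (\<Prod>b\<in>(Basis :: (real^'n) set). (1 + (x \<bullet> b)\<^sup>2))"
      using le pos by (simp add: pos_le_divide_eq mult.commute)
    then show "(cmod (\<phi> x))\<^sup>2 \<le> K\<^sup>2 * (\<Prod>b\<in>Basis. inverse (1 + (x \<bullet> b)\<^sup>2))"
      by (simp add: prod_inversef[symmetric] divide_inverse o_def)
  qed
qed

lemma M1_fiber_bound:
  fixes f \<phi> :: "real^'n \<Rightarrow> complex"
  assumes f: "f \<in> M1 \<phi>" and \<phi>: "continuous_on UNIV \<phi>" "\<phi> \<in> L2"
  obtains v :: "real^'n \<Rightarrow> real" where "integrable lborel v" "\<And>y. 0 \<le> v y"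
    "AE y in lborel. \<forall>t. cmod (f t) * cmod (\<phi> (t - y)) \<le> v y"
proof -
  let ?V = "\<lambda>z. L2_inner f (rho z \<phi>)"
  have fL: "f \<in> L2" and fc: "continuous_on UNIV f" and V: "integrable (lborel \<Otimes>\<^sub>M lborel) ?V"
    using f by (auto simp: M1_def lborel_prod)
  define c0 where "c0 = (sqrt (2 * pi)) ^ DIM(real^'n) * exp (- 2 * pi\<^sup>2) * unit_ball_vol (real DIM(real^'n))"
  have c0: "c0 > 0" unfolding c0_def by (intro mult_pos_pos zero_less_power unit_ball_vol_pos) auto
  let ?F = "\<lambda>y t. f t * cnj (\<phi> (t - y))"
  let ?Fh = "\<lambda>y (\<omega>::real^'n). LINT t|lborel. ?F y t * cis (- (2 * pi * (\<omega> \<bullet> t)))"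
  \<comment> \<open>Conjugation of the phase of \<open>rho\<close> leaves a unimodular factor in
    front of the Fourier transform.\<close>
  have VF: "?V (y, \<omega>) = cis (pi * (y \<bullet> \<omega>)) * ?Fh y \<omega>" for y \<omega>
    unfolding L2_inner_def rho_def modulation_def translation_def integral_mult_right_zero[symmetric]
    by (simp add: cis_cnj mult_ac)
  have norm_eq: "cmod (?V (y, \<omega>)) = cmod (?Fh y \<omega>)" for y \<omega> by (simp add: VF norm_mult)
  define v where "v y = 2 * (LINT \<omega>|lborel. cmod (?V (y, \<omega>))) / c0" for y
  show thesis
  proof (rule that[of v])
    show "integrable lborel v"
      unfolding v_def using lborel_pair.integrable_fst'[OF integrable_norm[OF V]] by simp
    show "0 \<le> v y" for y
      unfolding v_def using c0 by (intro divide_nonneg_pos mult_nonneg_nonneg integral_nonneg_AE) auto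
    show "AE y in lborel. \<forall>t. cmod (f t) * cmod (\<phi> (t - y)) \<le> v y"
      using lborel_pair.AE_integrable_fst'[OF V]
    proof eventually_elim
      case (elim y)
      \<comment> \<open>Removing this factor again transfers measurability from the fibre of
        \<open>?V\<close> to the Fourier transform.\<close>
      have eq: "(\<lambda>\<omega>. cis (- (pi * (y \<bullet> \<omega>))) * ?V (y, \<omega>)) = ?Fh y"
        unfolding VF by (simp add: mult.assoc[symmetric] cis_mult)
      have m: "(\<lambda>\<omega>. ?V (y, \<omega>)) \<in> borel_measurable borel" using elim by auto
      have Fh: "integrable lborel (?Fh y)"
      proof (rule Bochner_Integration.integrable_bound[OF elim])
        show "?Fh y \<in> borel_measurable lborel"
          unfolding eq[symmetric] using m by measurable
      qed (simp add: norm_eq)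
      have Fi: "integrable lborel (?F y)"
        by (rule L2_prod_integrable[OF fL L2_translate[OF \<phi>(2)]])
      have Fc: "continuous_on UNIV (?F y)"
        by (intro continuous_intros fc continuous_on_compose2[OF \<phi>(1)]) auto
      show ?case
      proof
        fix t
        have "cmod (?F y t) * c0 \<le> 2 * (LINT \<omega>|lborel. cmod (?V (y, \<omega>)))"
          unfolding norm_eq c0_def by (rule fourier_sup_bound[OF Fi Fc Fh])
        then show "cmod (f t) * cmod (\<phi> (t - y)) \<le> v y"
          unfolding v_def using c0 by (simp add: norm_mult pos_le_divide_eq)
      qed
    qed
  qed
qed

text \<open>Rounding to the nearest integer, by means of the summand 1/2, puts the points
  \<open>dshift d s\<close> at the centres of the cells. These are the points sampled by the Zak
  transform at the origin, and continuity there controls a neighbourhood that lies inside the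
  cell.\<close>

definition cell_index :: "('n \<Rightarrow> nat) \<Rightarrow> real^'n \<Rightarrow> int^'n" where
  "cell_index d t = (\<chi> j. \<lfloor>sqrt (real (d j)) * t $ j + 1/2\<rfloor>)"

lemma finite_int_box: "finite {k :: int^'n. \<forall>j. a j \<le> k $ j \<and> k $ j \<le> b j}"
proof -
  have "{k :: int^'n. \<forall>j. a j \<le> k $ j \<and> k $ j \<le> b j} \<subseteq> vec_lambda ` (PiE UNIV (\<lambda>j. {a j..b j}))"
    by (auto intro!: image_eqI[where x = "vec_nth _"])
  then show ?thesis by (rule finite_subset) (intro finite_imageI finite_PiE; simp)
qed

lemma cell_index_measurable [measurable]:
  "(\<lambda>t::real^'n. cell_index d t $ j) \<in> measurable borel (count_space UNIV)"
  unfolding cell_index_def by simp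

lemma cell_sets [measurable]: "{t::real^'n. cell_index d t = s} \<in> sets borel"
proof -
  have "{t::real^'n. cell_index d t = s} = (\<Inter>j. {t. cell_index d t $ j = s $ j})"
    by (auto simp: vec_eq_iff)
  also have "\<dots> \<in> sets borel"
  proof (rule sets.countable_INT'')
    fix j
    have "Measurable.pred borel (\<lambda>t::real^'n. cell_index d t $ j = s $ j)" by measurable
    then show "{t::real^'n. cell_index d t $ j = s $ j} \<in> sets borel" by (simp add: pred_def)
  qed auto
  finally show ?thesis .
qed

text \<open>The cells, translated by -p, partition the space, so no finite sum exceeds the integral
  of v.\<close>

lemma disjoint_integral_summable:
  fixes v :: "real^'n \<Rightarrow> real" and d :: "'n \<Rightarrow> nat"
  assumes v: "integrable lborel v" and pos: "\<And>y. 0 \<le> v y"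
  shows "(\<lambda>s. LINT y|lborel. indicator {y. cell_index d (y + p) = s} y * v y) summable_on UNIV"
proof (rule nonneg_bdd_above_summable_on)
  let ?I = "\<lambda>s. LINT y|lborel. indicator {y. cell_index d (y + p) = s} y * v y"
  have S: "{y. cell_index d (y + p) = s} \<in> sets borel" for s
    using measurable_sets[of "\<lambda>y. y + p" borel borel, OF _ cell_sets[of d s]] by (simp add: vimage_def)
  have int: "integrable lborel (\<lambda>y. indicator {y. cell_index d (y + p) = s} y * v y)" for s
    using integrable_mult_indicator[OF _ v, of "{y. cell_index d (y + p) = s}"] S by simp
  show "0 \<le> ?I s" for s by (rule integral_nonneg_AE) (auto simp: pos)
  show "bdd_above (sum ?I ` {F. F \<subseteq> UNIV \<and> finite F})"
  proof (rule bdd_aboveI2)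
    fix F :: "(int^'n) set" assume "F \<in> {F. F \<subseteq> UNIV \<and> finite F}"
    then have F: "finite F" by simp
    have "sum ?I F = (LINT y|lborel. (\<Sum>s\<in>F. indicator {y. cell_index d (y + p) = s} y * v y))"
      by (rule Bochner_Integration.integral_sum[symmetric]) (rule int)
    also have "\<dots> \<le> integral\<^sup>L lborel v"
    proof (rule integral_mono[OF _ v])
      show "integrable lborel (\<lambda>y. \<Sum>s\<in>F. indicator {y. cell_index d (y + p) = s} y * v y)"
        by (intro Bochner_Integration.integrable_sum int)
      fix y
      have "(\<Sum>s\<in>F. indicator {y. cell_index d (y + p) = s} y * v y)
          = (\<Sum>s\<in>F. if s = cell_index d (y + p) then v y else 0)"
        by (intro sum.cong refl) (auto simp: indicator_def)
      also have "\<dots> \<le> v y" using F pos[of y] by (simp add: sum.delta)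
      finally show "(\<Sum>s\<in>F. indicator {y. cell_index d (y + p) = s} y * v y) \<le> v y" .
    qed
    finally show "sum ?I F \<le> integral\<^sup>L lborel v" .
  qed
qed

lemma summable_on_finite_sum:
  fixes f :: "'i \<Rightarrow> 'j \<Rightarrow> 'b::{topological_comm_monoid_add}"
  assumes "\<And>k. k \<in> K \<Longrightarrow> f k summable_on A"
  shows "(\<lambda>s. \<Sum>k\<in>K. f k s) summable_on A"
  using assms
  by (induction K rule: infinite_finite_induct) (auto intro: summable_on_add)

text \<open>For fixed t, average the bound of \<open>M1_fiber_bound\<close> over those y for which t
  - y is close to a point where \<phi> is nonzero. This bounds f t by an integral of v over a small
  ball, hence over the cell of t and its neighbours; summed over all cells, each integral is counted
  only finitely often.\<close>

lemma M1_majorant: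
  fixes f \<phi> :: "real^'n \<Rightarrow> complex" and d :: "'n \<Rightarrow> nat"
  assumes d: "\<forall>j. d j > 0" and \<phi>: "schwartz \<phi>" "\<phi> \<noteq> (\<lambda>t. 0)" and f: "f \<in> M1 \<phi>"
  obtains M :: "int^'n \<Rightarrow> real" where "M summable_on UNIV" "\<And>t. cmod (f t) \<le> M (cell_index d t)"
proof -
  note \<phi>L = schwartz_L2[OF \<phi>(1)]
  obtain v where v: "integrable lborel v" "\<And>y. 0 \<le> v y"
    and vb: "AE y in lborel. \<forall>t. cmod (f t) * cmod (\<phi> (t - y)) \<le> v y"
    using M1_fiber_bound[OF f \<phi>L] by blast
  obtain t0 where t0: "\<phi> t0 \<noteq> 0" using \<phi>(2) by auto
  define c where "c = cmod (\<phi> t0) / 2"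
  have c: "c > 0" using t0 by (simp add: c_def)
  obtain \<delta> where \<delta>: "\<delta> > 0" "\<And>u. dist u t0 < \<delta> \<Longrightarrow> dist (\<phi> u) (\<phi> t0) < c"
    using \<phi>L(1)[unfolded continuous_on_iff, rule_format, of t0 c] c by auto
  have low: "c \<le> cmod (\<phi> u)" if "dist u t0 < \<delta>" for u
    using \<delta>(2)[OF that] norm_triangle_ineq2[of "\<phi> t0" "\<phi> u"] unfolding c_def
    by (simp add: dist_norm norm_minus_commute)
  define D where "D = Max (range (\<lambda>j. sqrt (real (d j))))"
  have D: "sqrt (real (d j)) \<le> D" for j unfolding D_def by (intro Max_ge) auto
  have D1: "D \<ge> 1" using order_trans[OF _ D, of 1 undefined] d by (simp add: Suc_leI)
  \<comment> \<open>The first bound keeps the modulus of \<phi> above \<open>c\<close>; the second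
    moves the cell index by at most one in each coordinate, which is the range of
    \<open>K\<close>.\<close>
  define r where "r = min \<delta> (1 / D)"
  have r: "r > 0" "r \<le> \<delta>" "r * D \<le> 1" using \<delta> D1 by (auto simp: r_def min_def field_simps)
  define K :: "(int^'n) set" where "K = {k. \<forall>j. -1 \<le> k $ j \<and> k $ j \<le> 1}"
  have K: "finite K" unfolding K_def by (rule finite_int_box)
  define I where "I s = (LINT y|lborel. indicator {y. cell_index d (y + t0) = s} y * v y)" for s
  have Isum: "I summable_on UNIV"
    unfolding I_def by (rule disjoint_integral_summable[OF v])
  \<comment> \<open>Total mass of the averaging: the lower bound for \<phi> times the volume of the
    ball.\<close>
  define w where "w = c * measure lborel (ball (0::real^'n) r)"
  have w: "w > 0" unfolding w_def using c r by (simp add: content_ball)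
  define M where "M s = (\<Sum>k\<in>K. I (s + k)) / w" for s
  show thesis
  proof (rule that)
    have "(\<lambda>s. I (s + k)) summable_on UNIV" for k
    proof -
      have "bij (\<lambda>s::int^'n. s + k)" by (rule bij_plus_right)
      then show ?thesis
        using summable_on_reindex_bij_betw[of "\<lambda>s. s + k" UNIV UNIV I] Isum by simp
    qed
    then have "(\<lambda>s. \<Sum>k\<in>K. I (s + k)) summable_on UNIV" by (intro summable_on_finite_sum) auto
    from summable_on_cmult_left[OF this, of "1 / w"] show "M summable_on UNIV"
      unfolding M_def by simp
    fix t
    let ?s = "cell_index d t"
    let ?B = "ball (t - t0) r"
    have S: "{y. cell_index d (y + t0) = s} \<in> sets borel" for s
      using measurable_sets[of "\<lambda>y. y + t0" borel borel, OF _ cell_sets[of d s]] by (simp add: vimage_def)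
    have int: "integrable lborel (\<lambda>y. indicator {y. cell_index d (y + t0) = s} y * v y)" for s
      using integrable_mult_indicator[OF _ v(1), of "{y. cell_index d (y + t0) = s}"] S by simp
    have Bint: "integrable lborel (\<lambda>y. indicator ?B y :: real)"
      using r by (intro integrable_real_indicator) (auto simp: emeasure_ball)
    have near: "cell_index d (y + t0) - ?s \<in> K" if "y \<in> ?B" for y
    proof -
      have "\<bar>sqrt (real (d j)) * (y + t0) $ j - sqrt (real (d j)) * t $ j\<bar> \<le> 1" for j
      proof -
        have "\<bar>(y + t0) $ j - t $ j\<bar> \<le> norm (y + t0 - t)"
          using component_le_norm_cart[of "y + t0 - t" j] by simp
        also have "\<dots> \<le> r" using that by (simp add: dist_norm norm_minus_commute algebra_simps)
        finally have "sqrt (real (d j)) * \<bar>(y + t0) $ j - t $ j\<bar> \<le> D * r"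
          using D D1 by (intro mult_mono) auto
        moreover have "\<bar>sqrt (real (d j)) * (y + t0) $ j - sqrt (real (d j)) * t $ j\<bar>
            = sqrt (real (d j)) * \<bar>(y + t0) $ j - t $ j\<bar>"
          by (simp only: right_diff_distrib[symmetric] abs_mult abs_of_nonneg real_sqrt_ge_zero of_nat_0_le_iff)
        ultimately show ?thesis using r(3) by (simp only: mult.commute[of D])
      qed
      note close = this
      have fl: "\<lfloor>x + 1/2\<rfloor> - \<lfloor>z + 1/2\<rfloor> \<le> 1" if "x - z \<le> 1" for x z :: real
        using floor_mono[of "x + 1/2" "(z + 1/2) + of_int 1"] that unfolding floor_add_int[symmetric] by linarith
      show ?thesis
        unfolding K_def cell_index_def mem_Collect_eq vector_minus_component vec_lambda_beta
      proof (intro allI conjI)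
        fix j
        show "- 1 \<le> \<lfloor>sqrt (real (d j)) * (y + t0) $ j + 1 / 2\<rfloor> - \<lfloor>sqrt (real (d j)) * t $ j + 1 / 2\<rfloor>"
          using fl[of "sqrt (real (d j)) * t $ j" "sqrt (real (d j)) * (y + t0) $ j"] close[of j] by linarith
        show "\<lfloor>sqrt (real (d j)) * (y + t0) $ j + 1 / 2\<rfloor> - \<lfloor>sqrt (real (d j)) * t $ j + 1 / 2\<rfloor> \<le> 1"
          using fl[of "sqrt (real (d j)) * (y + t0) $ j" "sqrt (real (d j)) * t $ j"] close[of j] by linarith
      qed
    qed
    have "cmod (f t) * w = (LINT y|lborel. cmod (f t) * c * indicator ?B y)"
      using r by (simp add: w_def content_ball)
    also have "\<dots> \<le> (LINT y|lborel. (\<Sum>k\<in>K. indicator {y. cell_index d (y + t0) = ?s + k} y * v y))"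
    proof (rule integral_mono_AE)
      show "integrable lborel (\<lambda>y. cmod (f t) * c * indicator ?B y)"
        by (intro integrable_mult_right Bint)
      show "integrable lborel (\<lambda>y. \<Sum>k\<in>K. indicator {y. cell_index d (y + t0) = ?s + k} y * v y)"
        by (intro Bochner_Integration.integrable_sum int)
      show "AE y in lborel. cmod (f t) * c * indicator ?B y
          \<le> (\<Sum>k\<in>K. indicator {y. cell_index d (y + t0) = ?s + k} y * v y)"
        using vb
      proof eventually_elim
        case (elim y)
        show ?case
        proof (cases "y \<in> ?B")
          case False
          then show ?thesis by (simp add: sum_nonneg v(2))
        next
          case True
          let ?k = "cell_index d (y + t0) - ?s"
          have "dist (t - y) t0 < \<delta>"
            using True r(2) by (simp add: dist_norm algebra_simps)
          then have "cmod (f t) * c \<le> cmod (f t) * cmod (\<phi> (t - y))"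
            by (intro mult_left_mono low) auto
          also have "\<dots> \<le> v y" using elim by blast
          also have "v y = (\<Sum>k\<in>{?k}. indicator {y. cell_index d (y + t0) = ?s + k} y * v y)" by simp
          also have "\<dots> \<le> (\<Sum>k\<in>K. indicator {y. cell_index d (y + t0) = ?s + k} y * v y)"
            using near[OF True] K v(2) by (intro sum_mono2) auto
          finally show ?thesis using True by simp
        qed
      qed
    qed
    also have "\<dots> = (\<Sum>k\<in>K. I (?s + k))"
      unfolding I_def by (rule Bochner_Integration.integral_sum) (rule int)
    finally show "cmod (f t) \<le> M ?s" unfolding M_def using w by (simp add: pos_le_divide_eq)
  qed
qed

section \<open>Time-frequency shifts over the lattice\<close>

text \<open>In contrast to \<open>rho\<close> there is no symmetric phase. On the lattice these
  operators agree with \<open>Srep\<close> and are additive in \<mu>, which makes them the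
  convenient normalisation.\<close>

definition tf_shift :: "(real^'n) \<times> (real^'n) \<Rightarrow> (real^'n \<Rightarrow> complex) \<Rightarrow> real^'n \<Rightarrow> complex" where
  "tf_shift \<mu> f = (\<lambda>t. cis (2 * pi * (snd \<mu> \<bullet> t)) * f (t - fst \<mu>))"

lemma tf_shift_L2: "f \<in> L2 \<Longrightarrow> tf_shift \<mu> f \<in> L2"
proof -
  assume f: "f \<in> L2"
  note T = L2_translate[OF f, of "fst \<mu>"]
  show ?thesis unfolding tf_shift_def
  proof (rule L2_norm_mono(1)[OF _ T])
    show "(\<lambda>t. cis (2 * pi * (snd \<mu> \<bullet> t)) * f (t - fst \<mu>)) \<in> borel_measurable borel"
      using L2_borel[OF T] by measurable
  qed (simp add: norm_mult)
qed

lemma tf_shift_inner: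
  assumes "f \<in> L2" "g \<in> L2"
  shows "L2_inner (tf_shift \<mu> f) (tf_shift \<mu> g) = L2_inner f g"
proof -
  have "L2_inner (tf_shift \<mu> f) (tf_shift \<mu> g) = (LINT t|lborel. f (t - fst \<mu>) * cnj (g (t - fst \<mu>)))"
    unfolding L2_inner_def tf_shift_def
  proof (rule Bochner_Integration.integral_cong[OF refl])
    fix t
    have "cis (2 * pi * (snd \<mu> \<bullet> t)) * cnj (cis (2 * pi * (snd \<mu> \<bullet> t))) = 1"
      by (simp add: cis_cnj cis_mult)
    then show "cis (2 * pi * (snd \<mu> \<bullet> t)) * f (t - fst \<mu>) * cnj (cis (2 * pi * (snd \<mu> \<bullet> t)) * g (t - fst \<mu>))
        = f (t - fst \<mu>) * cnj (g (t - fst \<mu>))"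
      by (simp add: mult_ac)
  qed
  also have "\<dots> = L2_inner f g"
    unfolding L2_inner_def
    by (rule lborel_integral_translate(1)[of "\<lambda>t. f t * cnj (g t)"])
      (use L2_prod_integrable[OF assms] in auto)
  finally show ?thesis .
qed

lemma tf_shift_zero [simp]: "tf_shift 0 f = f"
  by (simp add: tf_shift_def)

lemma tf_shift_cmult: "tf_shift \<mu> (\<lambda>t. c * f t) = (\<lambda>t. c * tf_shift \<mu> f t)"
  by (simp add: tf_shift_def mult_ac)

lemma tf_shift_sum: "tf_shift \<mu> (\<lambda>t. \<Sum>i\<in>X. u i t) = (\<lambda>t. \<Sum>i\<in>X. tf_shift \<mu> (u i) t)"
  by (simp add: tf_shift_def sum_distrib_left)

lemma rho_eq_tf_shift:
  "rho \<mu> f = (\<lambda>t. cis (- (pi * (fst \<mu> \<bullet> snd \<mu>))) * tf_shift \<mu> f t)"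
  by (simp add: rho_def modulation_def translation_def tf_shift_def case_prod_beta)

text \<open>The phase of \<open>rho\<close> occurs once directly and once conjugated, so frame
  operator and frame inequalities may be read with \<open>tf_shift\<close>.\<close>

lemma rho_coefficient:
  "L2_inner f (rho \<mu> g) * rho \<mu> g t = L2_inner f (tf_shift \<mu> g) * tf_shift \<mu> g t"
  "cmod (L2_inner f (rho \<mu> g)) = cmod (L2_inner f (tf_shift \<mu> g))"
proof -
  have "cnj (cis x) * cis x = 1" for x by (simp add: cis_cnj cis_mult)
  then show "L2_inner f (rho \<mu> g) * rho \<mu> g t = L2_inner f (tf_shift \<mu> g) * tf_shift \<mu> g t"
    unfolding rho_eq_tf_shift L2_inner_cmult_right
    by (metis (no_types, lifting) mult.assoc mult.left_commute mult_1)
  show "cmod (L2_inner f (rho \<mu> g)) = cmod (L2_inner f (tf_shift \<mu> g))"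
    unfolding rho_eq_tf_shift L2_inner_cmult_right by (simp add: norm_mult)
qed

definition tf_sum ::
  "((real^'n) \<times> (real^'n)) set \<Rightarrow> ((real^'n) \<times> (real^'n) \<Rightarrow> complex) \<Rightarrow>
   (real^'n \<Rightarrow> complex) \<Rightarrow> real^'n \<Rightarrow> complex" where
  "tf_sum X w f = (\<lambda>t. \<Sum>\<mu>\<in>X. w \<mu> * tf_shift \<mu> f t)"

lemma tf_sum_L2: "f \<in> L2 \<Longrightarrow> tf_sum X w f \<in> L2"
  unfolding tf_sum_def by (intro L2_finite_sum L2_cmult tf_shift_L2)

lemma L2_inner_tf_sum_left:
  "f \<in> L2 \<Longrightarrow> y \<in> L2 \<Longrightarrow> L2_inner (tf_sum X w f) y = (\<Sum>\<mu>\<in>X. w \<mu> * L2_inner (tf_shift \<mu> f) y)"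
  unfolding tf_sum_def by (subst L2_inner_sum_left) (auto intro: L2_cmult tf_shift_L2 simp: L2_inner_cmult_left)

lemma orthogonal_sum_norm:
  assumes X: "finite X" and e: "\<And>i. i \<in> X \<Longrightarrow> e i \<in> L2"
    and orth: "\<And>i j. i \<in> X \<Longrightarrow> j \<in> X \<Longrightarrow> L2_inner (e i) (e j) = (if i = j then of_real k else 0)"
  shows "(L2_norm (\<lambda>t. \<Sum>i\<in>X. a i * e i t))\<^sup>2 = k * (\<Sum>i\<in>X. (cmod (a i))\<^sup>2)"
proof -
  let ?z = "\<lambda>t. \<Sum>i\<in>X. a i * e i t"
  have z: "?z \<in> L2" using e by (intro L2_finite_sum L2_cmult) auto
  have "complex_of_real ((L2_norm ?z)\<^sup>2) = L2_inner ?z ?z" by (rule L2_inner_self[symmetric])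
  also have "\<dots> = (\<Sum>i\<in>X. a i * L2_inner (e i) ?z)"
    using e z by (subst L2_inner_sum_left) (auto intro: L2_cmult simp: L2_inner_cmult_left)
  also have "\<dots> = (\<Sum>i\<in>X. a i * (cnj (a i) * of_real k))"
  proof (rule sum.cong[OF refl])
    fix i assume i: "i \<in> X"
    have "L2_inner (e i) ?z = (\<Sum>j\<in>X. cnj (a j) * L2_inner (e i) (e j))"
      using e i by (subst L2_inner_sum_right) (auto intro: L2_cmult simp: L2_inner_cmult_right)
    also have "\<dots> = (\<Sum>j\<in>X. if i = j then cnj (a j) * of_real k else 0)"
      using i by (intro sum.cong refl) (simp add: orth)
    also have "\<dots> = cnj (a i) * of_real k" using X i by (simp add: sum.delta)
    finally show "a i * L2_inner (e i) ?z = a i * (cnj (a i) * of_real k)" by simp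
  qed
  also have "\<dots> = of_real (k * (\<Sum>i\<in>X. (cmod (a i))\<^sup>2))"
    by (simp only: of_real_mult of_real_sum sum_distrib_left complex_norm_square mult_ac)
  finally show ?thesis by (simp only: of_real_eq_iff)
qed

text \<open>Pair F with the combination of the \<open>e i\<close> that has the coefficients of F
  itself. Its norm is sqrt k times the square root of their square sum, of which one factor
  cancels.\<close>

lemma bessel_inequality:
  assumes X: "finite X" and e: "\<And>i. i \<in> X \<Longrightarrow> e i \<in> L2" and F: "F \<in> L2" and k: "k > 0"
    and orth: "\<And>i j. i \<in> X \<Longrightarrow> j \<in> X \<Longrightarrow> L2_inner (e i) (e j) = (if i = j then of_real k else 0)"
  shows "L2_set (\<lambda>i. cmod (L2_inner F (e i))) X \<le> sqrt k * L2_norm F"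
proof -
  define S where "S = L2_set (\<lambda>i. cmod (L2_inner F (e i))) X"
  have S0: "S \<ge> 0" by (simp add: S_def)
  have SS: "S\<^sup>2 = (\<Sum>i\<in>X. (cmod (L2_inner F (e i)))\<^sup>2)" by (simp add: S_def L2_set_def sum_nonneg)
  let ?z = "\<lambda>t. \<Sum>i\<in>X. L2_inner F (e i) * e i t"
  have z: "?z \<in> L2" using e by (intro L2_finite_sum L2_cmult) auto
  have "(L2_norm ?z)\<^sup>2 = (sqrt k * S)\<^sup>2"
    using orthogonal_sum_norm[OF X e orth, of "\<lambda>i. L2_inner F (e i)"] k SS by (simp add: power_mult_distrib)
  then have nz: "L2_norm ?z = sqrt k * S"
    using S0 k by (simp add: power2_eq_iff_nonneg L2_norm_nonneg)
  have "L2_inner F ?z = (\<Sum>i\<in>X. cnj (L2_inner F (e i)) * L2_inner F (e i))"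
    using e F by (subst L2_inner_sum_right) (auto intro: L2_cmult simp: L2_inner_cmult_right)
  also have "\<dots> = of_real (S\<^sup>2)"
    unfolding SS of_real_sum complex_norm_square by (simp add: mult.commute)
  finally have "S\<^sup>2 \<le> L2_norm F * (sqrt k * S)"
    using L2_Cauchy_Schwarz[OF F z] S0 nz by (simp add: norm_power)
  then have "S * S \<le> (sqrt k * L2_norm F) * S" by (simp add: power2_eq_square mult_ac)
  then have "S \<le> sqrt k * L2_norm F"
    using S0 k L2_norm_nonneg[of F] by (cases "S = 0") (auto simp: mult_le_cancel_right)
  then show ?thesis by (simp add: S_def)
qed

subsection \<open>Geometry of the lattice and its cells\<close>

locale gabor_lattice =
  fixes d :: "'n::finite \<Rightarrow> nat"
  assumes d_pos: "\<And>j. d j > 0"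
begin

lemma sqrt_d_pos: "sqrt (real (d j)) > 0"
  using d_pos by simp

lemma Dhalf_nth [simp]: "Dhalf d k $ j = sqrt (real (d j)) * of_int (k $ j)"
  by (simp add: Dhalf_def)

lemma Dhalf_add: "Dhalf d (k + l) = Dhalf d k + Dhalf d l"
  by (simp add: vec_eq_iff algebra_simps)

lemma Dhalf_uminus: "Dhalf d (- k) = - Dhalf d k"
  by (simp add: vec_eq_iff)

lemma Dhalf_zero: "Dhalf d 0 = 0"
  by (simp add: vec_eq_iff)

lemma Dhalf_inj: "inj (Dhalf d)"
  by (intro injI, simp add: vec_eq_iff) (metis d_pos less_irrefl)

lemma Lat_iff: "\<mu> \<in> Lat d \<longleftrightarrow> (\<exists>k l. \<mu> = (Dhalf d k, Dhalf d l))"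
  by (auto simp: Lat_def)

lemma Lat_add: "\<mu> \<in> Lat d \<Longrightarrow> \<nu> \<in> Lat d \<Longrightarrow> \<mu> + \<nu> \<in> Lat d"
  unfolding Lat_iff by (metis Dhalf_add add_Pair)

lemma Lat_uminus: "\<mu> \<in> Lat d \<Longrightarrow> - \<mu> \<in> Lat d"
  unfolding Lat_iff by (metis Dhalf_uminus uminus_Pair)

lemma Lat_diff: "\<mu> \<in> Lat d \<Longrightarrow> \<nu> \<in> Lat d \<Longrightarrow> \<mu> - \<nu> \<in> Lat d"
  using Lat_add[of \<mu> "- \<nu>"] Lat_uminus[of \<nu>] by simp

text \<open>Two factors D^(1/2) combine to D, so the lattice pairs integrally with itself. All
  commutation relations below rest on this.\<close>

lemma Dhalf_inner: "Dhalf d k \<bullet> Dhalf d l = of_int (\<Sum>j\<in>UNIV. k $ j * int (d j) * l $ j)"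
proof -
  have "sqrt (real (d j)) * of_int (k $ j) * (sqrt (real (d j)) * of_int (l $ j))
      = of_int (k $ j * int (d j) * l $ j)" for j
  proof -
    have "sqrt (real (d j)) * of_int (k $ j) * (sqrt (real (d j)) * of_int (l $ j))
        = (sqrt (real (d j)) * sqrt (real (d j))) * (of_int (k $ j) * of_int (l $ j))"
      by (simp only: mult_ac)
    also have "\<dots> = of_int (k $ j * int (d j) * l $ j)" by simp
    finally show ?thesis .
  qed
  then show ?thesis
    unfolding inner_vec_def of_int_sum by (intro sum.cong refl) (simp only: Dhalf_nth inner_real_def)
qed

lemma cis_2pi_int [simp]: "cis (2 * pi * of_int m) = 1"
  using cis_multiple_2pi[of "of_int m"] by simp

lemma cis_Lat: "\<mu> \<in> Lat d \<Longrightarrow> \<nu> \<in> Lat d \<Longrightarrow> cis (2 * pi * (snd \<nu> \<bullet> fst \<mu>)) = 1"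
  unfolding Lat_iff by (metis Dhalf_inner cis_2pi_int fst_conv snd_conv)

text \<open>Moving a modulation past a translation costs the phase in \<open>cis_Lat\<close>, which
  is 1.\<close>

lemma tf_shift_add:
  assumes "\<mu> \<in> Lat d" "\<nu> \<in> Lat d"
  shows "tf_shift \<mu> (tf_shift \<nu> f) = tf_shift (\<mu> + \<nu>) f"
proof
  fix t
  have "cis (2 * pi * (snd \<nu> \<bullet> (t - fst \<mu>))) * cis (2 * pi * (snd \<nu> \<bullet> fst \<mu>)) = cis (2 * pi * (snd \<nu> \<bullet> t))"
    by (simp add: cis_mult inner_diff_right algebra_simps)
  then have "cis (2 * pi * (snd \<nu> \<bullet> (t - fst \<mu>))) = cis (2 * pi * (snd \<nu> \<bullet> t))"
    by (simp add: cis_Lat[OF assms])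
  moreover have "cis (2 * pi * (snd (\<mu> + \<nu>) \<bullet> t)) = cis (2 * pi * (snd \<mu> \<bullet> t)) * cis (2 * pi * (snd \<nu> \<bullet> t))"
    by (simp add: cis_mult inner_add_left algebra_simps)
  ultimately show "tf_shift \<mu> (tf_shift \<nu> f) t = tf_shift (\<mu> + \<nu>) f t"
    by (simp add: tf_shift_def algebra_simps)
qed

lemma tf_shift_adjoint:
  assumes "\<mu> \<in> Lat d" "f \<in> L2" "g \<in> L2"
  shows "L2_inner (tf_shift \<mu> f) g = L2_inner f (tf_shift (- \<mu>) g)"
proof -
  have "tf_shift \<mu> (tf_shift (- \<mu>) g) = g"
    by (simp add: tf_shift_add[OF assms(1) Lat_uminus[OF assms(1)]])
  then show ?thesis
    using tf_shift_inner[OF assms(2) tf_shift_L2[OF assms(3)], of \<mu> "- \<mu>"] by simp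
qed

text \<open>With N = k^T D l, \<open>chi\<close> contributes (-1)^N = e^(pi i N), while
  \<open>rho\<close> carries e^(- pi i N).\<close>

lemma Srep_eq_tf_shift:
  assumes "\<mu> \<in> Lat d"
  shows "Srep d \<mu> f = tf_shift \<mu> f"
proof -
  obtain k l where \<mu>: "\<mu> = (Dhalf d k, Dhalf d l)" using assms unfolding Lat_iff by blast
  define N where "N = (\<Sum>j\<in>UNIV. k $ j * int (d j) * l $ j)"
  have chi: "chi d \<mu> = (-1) powi N"
    by (simp add: chi_def \<mu> N_def inv_f_f[OF Dhalf_inj])
  have "(-1) powi N = cis (pi * of_int N)"
  proof (cases "even N")
    case True
    then obtain m where "N = 2 * m" by auto
    then show ?thesis using cis_2pi_int[of m] by (simp add: mult_ac)
  next
    case False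
    then obtain m where "N = 2 * m + 1" by (auto elim: oddE)
    then have "pi * of_int N = 2 * pi * of_int m + pi" by (simp add: algebra_simps)
    then have "cis (pi * of_int N) = cis (2 * pi * of_int m) * cis pi"
      by (simp only: cis_mult)
    with False show ?thesis by simp
  qed
  moreover have "fst \<mu> \<bullet> snd \<mu> = of_int N" unfolding \<mu> N_def by (simp add: Dhalf_inner)
  ultimately have "chi d \<mu> * cis (- (pi * (fst \<mu> \<bullet> snd \<mu>))) = 1"
    by (simp add: chi cis_mult)
  then show ?thesis
    unfolding Srep_def rho_eq_tf_shift mult.assoc[symmetric] by simp
qed

text \<open>The number of cells, in each coordinate, by which the translation by
  \<open>Dhalf d k\<close> moves; thus cell indices modulo lattice translations are the residues in
  \<open>Zd d\<close>.\<close>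

definition dmul :: "int^'n \<Rightarrow> int^'n" where
  "dmul k = (\<chi> j. int (d j) * k $ j)"

lemma dmul_nth [simp]: "dmul k $ j = int (d j) * k $ j"
  by (simp add: dmul_def)

lemma dshift_nth [simp]: "dshift d s $ j = of_int (s $ j) / sqrt (real (d j))"
  by (simp add: dshift_def)

lemma dshift_add: "dshift d (s + s') = dshift d s + dshift d s'"
  by (simp add: vec_eq_iff add_divide_distrib)

lemma dshift_dmul: "dshift d (dmul k) = Dhalf d k"
proof -
  have "real (d j) * x / sqrt (real (d j)) = sqrt (real (d j)) * x" for j x
    using sqrt_d_pos[of j] real_sqrt_mult_self[of "real (d j)"]
    by (simp add: divide_eq_eq mult_ac)
  then show ?thesis by (simp add: vec_eq_iff)
qed

lemma dmul_inj: "dmul k = dmul l \<Longrightarrow> k = l"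
  using d_pos by (auto simp: vec_eq_iff) (metis less_irrefl)

lemma Zd_unique:
  assumes "r \<in> Zd d" "r' \<in> Zd d" "r + dmul k = r' + dmul k'"
  shows "r = r'" "k = k'"
proof -
  have "r $ j = r' $ j" for j
  proof -
    have "(r $ j + int (d j) * k $ j) mod int (d j) = (r' $ j + int (d j) * k' $ j) mod int (d j)"
      using assms(3) by (simp add: vec_eq_iff)
    then show ?thesis using assms(1,2) by (simp add: Zd_def)
  qed
  then show r: "r = r'" by (simp add: vec_eq_iff)
  with assms(3) show "k = k'" using dmul_inj by simp
qed

lemma finite_Zd: "finite (Zd d)"
proof -
  have "Zd d \<subseteq> {k. \<forall>j. 0 \<le> k $ j \<and> k $ j \<le> int (d j)}" by (auto simp: Zd_def less_imp_le)
  then show ?thesis using finite_int_box[of "\<lambda>j. 0" "\<lambda>j. int (d j)"] by (rule finite_subset)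
qed

lemma cell_index_translate: "cell_index d (t - Dhalf d k) = cell_index d t - dmul k"
proof -
  have "sqrt (real (d j)) * (t $ j - sqrt (real (d j)) * of_int (k $ j)) + 1 / 2
      = (sqrt (real (d j)) * t $ j + 1 / 2) - of_int (int (d j) * k $ j)" for j
    using real_sqrt_mult_self[of "real (d j)"] by (simp add: algebra_simps)
  then have "\<lfloor>sqrt (real (d j)) * (t $ j - sqrt (real (d j)) * of_int (k $ j)) + 1 / 2\<rfloor>
      = \<lfloor>sqrt (real (d j)) * t $ j + 1 / 2\<rfloor> - int (d j) * k $ j" for j
    by (simp only: floor_diff_of_int)
  then show ?thesis by (simp add: vec_eq_iff cell_index_def)
qed

definition cell_fun :: "int^'n \<Rightarrow> real^'n \<Rightarrow> complex" where
  "cell_fun s t = (if cell_index d t = s then 1 else 0)"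

text \<open>The volume of one cell, equivalently the covolume of the lattice D^(-1/2) Z^n of the
  cell centres; written \<kappa> in the overview.\<close>

definition covolume :: real where
  "covolume = (\<Prod>j\<in>UNIV. 1 / sqrt (real (d j)))"

lemma covolume_pos: "covolume > 0"
  unfolding covolume_def using sqrt_d_pos by (intro prod_pos) simp

text \<open>An interval of length 1 / a carries a whole number m of periods of the frequency a
  m.\<close>

lemma cell_interval_integral:
  fixes s m :: int and a :: real
  assumes a: "a > 0"
  shows "integrable lborel (\<lambda>x::real. (if \<lfloor>a * x + 1/2\<rfloor> = s then 1 else 0) * cis (2 * pi * (a * of_int m) * x))"
    and "(LINT x|lborel. (if \<lfloor>a * x + 1/2\<rfloor> = s then 1 else 0) * cis (2 * pi * (a * of_int m) * x))
      = (if m = 0 then of_real (1 / a) else 0)"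
proof -
  let ?h = "\<lambda>x. (if \<lfloor>x + 1/2\<rfloor> = s then 1 else 0) * cis (2 * pi * of_int m * x)"
  let ?k = "\<lambda>x. indicator {of_int s - 1/2..of_int s + 1/2} x *\<^sub>R cis (2 * pi * of_int m * x)"
  \<comment> \<open>The points rounding to s form a half-open interval. It differs at one endpoint
    from the closed interval on which the fundamental theorem of calculus is applied.\<close>
  have ae: "AE x in lborel. ?h x = ?k x"
  proof -
    have "AE x in lborel. x \<noteq> of_int s + (1/2::real)" by (rule AE_lborel_singleton)
    then show ?thesis
    proof eventually_elim
      case (elim x)
      then have "\<lfloor>x + 1/2\<rfloor> = s \<longleftrightarrow> x \<in> {of_int s - 1/2..of_int s + 1/2}"
        by (auto simp: floor_eq_iff)
      then show ?case by (simp add: indicator_def)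
    qed
  qed
  have cis_cont: "continuous_on A (\<lambda>x. cis (2 * pi * of_int m * x))" for A
    by (intro continuous_intros)
  have kint: "integrable lborel ?k"
    using borel_integrable_atLeastAtMost'[OF cis_cont, of "of_int s - 1/2" "of_int s + 1/2"]
    by (simp add: set_integrable_def)
  have hm: "?h \<in> borel_measurable lborel" by measurable
  have hint: "integrable lborel ?h"
    using integrable_cong_AE[OF hm _ ae] kint by auto
  have "integral\<^sup>L lborel ?h = integral\<^sup>L lborel ?k"
    using kint by (intro integral_cong_AE hm ae) auto
  also have "\<dots> = (if m = 0 then 1 else 0)"
  proof (cases "m = 0")
    case True
    then show ?thesis by simp
  next
    case False
    let ?c = "2 * pi * real_of_int m"
    have D: "((\<lambda>x. - \<i> / of_real c * cis (c * x)) has_vector_derivative cis (c * x)) (at x within S)"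
      if c: "c \<noteq> 0" for c x :: real and S
    proof -
      have "((\<lambda>z. - \<i> / of_real c * exp (\<i> * of_real c * z)) has_field_derivative
          exp (\<i> * of_real c * of_real x)) (at (of_real x))"
        using c by (auto intro!: derivative_eq_intros)
      from has_vector_derivative_real_field[OF this, of S] show ?thesis
        by (simp add: cis_conv_exp mult.assoc)
    qed
    have c: "?c \<noteq> 0" using False by simp
    have "integral\<^sup>L lborel ?k
        = - \<i> / of_real ?c * cis (?c * (of_int s + 1/2)) - - \<i> / of_real ?c * cis (?c * (of_int s - 1/2))"
    proof (rule integral_FTC_Icc)
      fix x
      show "((\<lambda>x. - \<i> / of_real ?c * cis (?c * x)) has_vector_derivative cis (?c * x)) (at x within {of_int s - 1/2..of_int s + 1/2})"
        by (rule D[OF c])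
    qed (auto intro: cis_cont)
    also have "cis (?c * (of_int s + 1/2)) = cis (?c * (of_int s - 1/2))"
    proof -
      have "cis (?c * (of_int s + 1/2)) = cis (?c * (of_int s - 1/2)) * cis (2 * pi * of_int m)"
        by (simp add: cis_mult algebra_simps)
      then show ?thesis by simp
    qed
    finally show ?thesis using False by simp
  qed
  finally have I: "integral\<^sup>L lborel ?h = (if m = 0 then 1 else 0)" .
  have eq: "?h (0 + a * x) = (if \<lfloor>a * x + 1/2\<rfloor> = s then 1 else 0) * cis (2 * pi * (a * of_int m) * x)" for x
    by (simp add: mult_ac)
  show "integrable lborel (\<lambda>x::real. (if \<lfloor>a * x + 1/2\<rfloor> = s then 1 else 0) * cis (2 * pi * (a * of_int m) * x))"
    unfolding eq[symmetric] using lborel_integrable_real_affine[OF hint, of a 0] a by simp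
  have "integral\<^sup>L lborel ?h = \<bar>a\<bar> *\<^sub>R (LINT x|lborel. ?h (0 + a * x))"
    by (rule lborel_integral_real_affine) (use a in auto)
  then show "(LINT x|lborel. (if \<lfloor>a * x + 1/2\<rfloor> = s then 1 else 0) * cis (2 * pi * (a * of_int m) * x))
      = (if m = 0 then of_real (1 / a) else 0)"
    unfolding eq I using a by (auto simp: scaleR_conv_of_real field_simps split: if_splits)
qed

lemma cell_integral:
  "integrable lborel (\<lambda>t::real^'n. cell_fun s t * cis (2 * pi * (Dhalf d l \<bullet> t)))"
  "(LINT t|lborel. cell_fun s t * cis (2 * pi * (Dhalf d l \<bullet> t))) = (if l = 0 then of_real covolume else 0)"
proof -
  \<comment> \<open>Recovers the coordinate from a basis vector, because
    \<open>lborel_product_integral\<close> is indexed by \<open>Basis\<close>.\<close>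
  define idx where "idx b = (SOME j. b = axis j (1::real))" for b :: "real^'n"
  have idx [simp]: "idx (axis j 1) = j" for j
    unfolding idx_def by (rule some_equality) (auto simp: axis_eq_axis)
  let ?a = "\<lambda>j. sqrt (real (d j))"
  let ?g = "\<lambda>j x. (if \<lfloor>?a j * x + 1/2\<rfloor> = s $ j then 1 else 0) * cis (2 * pi * (?a j * of_int (l $ j)) * x)"
  have B: "(Basis :: (real^'n) set) = (\<lambda>j. axis j 1) ` UNIV" by (auto simp: Basis_vec_def)
  have inj: "inj (\<lambda>j::'n. axis j (1::real))" by (auto simp: inj_on_def axis_eq_axis)
  have int: "\<And>b. b \<in> (Basis :: (real^'n) set) \<Longrightarrow> integrable lborel (?g (idx b))"
    by (rule cell_interval_integral(1)[OF sqrt_d_pos])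
  have eq: "(\<Prod>b\<in>Basis. ?g (idx b) (t \<bullet> b)) = cell_fun s t * cis (2 * pi * (Dhalf d l \<bullet> t))" for t :: "real^'n"
  proof -
    have "(\<Prod>b\<in>Basis. ?g (idx b) (t \<bullet> b)) = (\<Prod>j\<in>UNIV. ?g j (t $ j))"
      unfolding B by (subst prod.reindex[OF inj]) (simp add: inner_axis)
    also have "\<dots> = (\<Prod>j\<in>UNIV. (if \<lfloor>?a j * t $ j + 1/2\<rfloor> = s $ j then 1 else 0))
        * cis (\<Sum>j\<in>UNIV. 2 * pi * (?a j * of_int (l $ j)) * t $ j)"
      by (simp only: prod.distrib cis_prod[OF finite])
    also have "(\<Prod>j\<in>UNIV. (if \<lfloor>?a j * t $ j + 1/2\<rfloor> = s $ j then 1 else 0)) = cell_fun s t"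
    proof (cases "cell_index d t = s")
      case True
      then show ?thesis by (auto simp: cell_fun_def cell_index_def)
    next
      case False
      then obtain j where "\<lfloor>?a j * t $ j + 1/2\<rfloor> \<noteq> s $ j" by (auto simp: vec_eq_iff cell_index_def)
      then have "(\<Prod>j\<in>UNIV. (if \<lfloor>?a j * t $ j + 1/2\<rfloor> = s $ j then 1 else 0 :: complex)) = 0"
        by (intro prod_zero) (auto intro!: bexI[of _ j])
      with False show ?thesis by (simp add: cell_fun_def)
    qed
    also have "(\<Sum>j\<in>UNIV. 2 * pi * (?a j * of_int (l $ j)) * t $ j) = 2 * pi * (Dhalf d l \<bullet> t)"
      by (simp add: inner_vec_def sum_distrib_left mult.assoc)
    finally show ?thesis .
  qed
  show "integrable lborel (\<lambda>t::real^'n. cell_fun s t * cis (2 * pi * (Dhalf d l \<bullet> t)))"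
    using lborel_product_integral(1)[of "\<lambda>b. ?g (idx b)", OF int] unfolding eq .
  have "(LINT t|lborel. cell_fun s t * cis (2 * pi * (Dhalf d l \<bullet> t))) = (\<Prod>b\<in>(Basis :: (real^'n) set). integral\<^sup>L lborel (?g (idx b)))"
    using lborel_product_integral(2)[of "\<lambda>b. ?g (idx b)", OF int] unfolding eq .
  also have "\<dots> = (\<Prod>j\<in>UNIV. if l $ j = 0 then of_real (1 / ?a j) else 0)"
    unfolding B by (subst prod.reindex[OF inj]) (simp add: cell_interval_integral(2)[OF sqrt_d_pos] del: of_real_divide cong: if_cong)
  also have "\<dots> = (if l = 0 then of_real covolume else 0)"
  proof (cases "l = 0")
    case True
    then show ?thesis by (simp add: covolume_def)
  next
    case False
    then obtain j where "l $ j \<noteq> 0" by (auto simp: vec_eq_iff)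
    then show ?thesis using False by (auto intro!: prod_zero bexI[of _ j])
  qed
  finally show "(LINT t|lborel. cell_fun s t * cis (2 * pi * (Dhalf d l \<bullet> t))) = (if l = 0 then of_real covolume else 0)" .
qed

lemma cell_fun_measurable [measurable]: "cell_fun s \<in> borel_measurable borel"
  unfolding cell_fun_def using cell_sets[of d s] by (intro measurable_If) auto

lemma cell_fun_L2: "cell_fun s \<in> L2"
proof (rule L2_bound)
  show "integrable lborel (\<lambda>t. cmod (cell_fun s t))"
    using integrable_norm[OF cell_integral(1)[of s 0]] by (simp add: Dhalf_zero)
qed (auto simp: cell_fun_def)

lemma tf_shift_cell_fun:
  "tf_shift (Dhalf d k, m) (cell_fun s) t = cis (2 * pi * (m \<bullet> t)) * cell_fun (s + dmul k) t"
  by (auto simp: tf_shift_def cell_fun_def cell_index_translate)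

text \<open>Shifted cells are equal or disjoint, and on a common cell distinct modulations are
  orthogonal. The offset k lets the base cells be translates of each other; this is how a
  coefficient at \<mu> comes to involve the envelope at a displaced index.\<close>

lemma cell_orthogonal:
  assumes s: "s - s' = dmul k" and \<mu>: "\<mu> \<in> Lat d" and \<nu>: "\<nu> \<in> Lat d"
  shows "L2_inner (tf_shift \<mu> (cell_fun s)) (tf_shift \<nu> (cell_fun s'))
    = (if \<nu> = \<mu> + (Dhalf d k, 0) then of_real covolume else 0)"
proof -
  obtain k1 l1 where \<mu>': "\<mu> = (Dhalf d k1, Dhalf d l1)" using \<mu> unfolding Lat_iff by blast
  obtain k2 l2 where \<nu>': "\<nu> = (Dhalf d k2, Dhalf d l2)" using \<nu> unfolding Lat_iff by blast
  have cond: "s + dmul k1 = s' + dmul k2 \<longleftrightarrow> k2 = k1 + k"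
  proof -
    have "s + dmul k1 = s' + dmul k2 \<longleftrightarrow> dmul k2 = dmul (k1 + k)"
      using s by (auto simp: vec_eq_iff algebra_simps)
    then show ?thesis using dmul_inj by auto
  qed
  have iff: "\<nu> = \<mu> + (Dhalf d k, 0) \<longleftrightarrow> k2 = k1 + k \<and> l2 = l1"
    unfolding \<mu>' \<nu>' by (simp add: Dhalf_add[symmetric] inj_eq[OF Dhalf_inj])
  show ?thesis
  proof (cases "k2 = k1 + k")
    case False
    have "tf_shift \<mu> (cell_fun s) t * cnj (tf_shift \<nu> (cell_fun s') t) = 0" for t
      using False cond unfolding \<mu>' \<nu>' tf_shift_cell_fun by (auto simp: cell_fun_def)
    then show ?thesis using False iff unfolding L2_inner_def by (simp only: integral_zero if_False simp_thms)
  next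
    case True
    have "tf_shift \<mu> (cell_fun s) t * cnj (tf_shift \<nu> (cell_fun s') t)
        = cell_fun (s + dmul k1) t * cis (2 * pi * (Dhalf d (l1 - l2) \<bullet> t))" for t
    proof -
      have "Dhalf d (l1 - l2) = Dhalf d l1 - Dhalf d l2"
        using Dhalf_add[of l1 "- l2"] by (simp add: Dhalf_uminus)
      then have "cis (2 * pi * (Dhalf d (l1 - l2) \<bullet> t)) = cis (2 * pi * (Dhalf d l1 \<bullet> t)) * cnj (cis (2 * pi * (Dhalf d l2 \<bullet> t)))"
        unfolding inner_diff_left right_diff_distrib by (simp add: cis_cnj cis_mult inner_diff_left right_diff_distrib)
      moreover have "cell_fun (s + dmul k1) t * cnj (cell_fun (s' + dmul k2) t) = cell_fun (s + dmul k1) t"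
        using True cond by (simp add: cell_fun_def)
      ultimately show ?thesis
        unfolding \<mu>' \<nu>' tf_shift_cell_fun by (simp add: mult_ac)
    qed
    then show ?thesis using True iff by (auto simp: L2_inner_def cell_integral(2))
  qed
qed

text \<open>Cells of different residues remain disjoint under all lattice translations.\<close>

lemma cell_orthogonal_Zd:
  assumes r: "r \<in> Zd d" "r' \<in> Zd d" and \<mu>: "\<mu> \<in> Lat d" and \<nu>: "\<nu> \<in> Lat d"
  shows "L2_inner (tf_shift \<mu> (cell_fun r)) (tf_shift \<nu> (cell_fun r'))
    = (if \<mu> = \<nu> \<and> r = r' then of_real covolume else 0)"
proof (cases "r = r'")
  case True
  have "r - r' = dmul 0" using True by (simp add: vec_eq_iff)
  from cell_orthogonal[OF this \<mu> \<nu>] True show ?thesis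
    by (auto simp: Dhalf_zero prod_eq_iff)
next
  case False
  obtain k1 l1 where \<mu>': "\<mu> = (Dhalf d k1, Dhalf d l1)" using \<mu> unfolding Lat_iff by blast
  obtain k2 l2 where \<nu>': "\<nu> = (Dhalf d k2, Dhalf d l2)" using \<nu> unfolding Lat_iff by blast
  have "tf_shift \<mu> (cell_fun r) t * cnj (tf_shift \<nu> (cell_fun r') t) = 0" for t
    using False Zd_unique[OF r, of k1 k2] unfolding \<mu>' \<nu>' tf_shift_cell_fun by (auto simp: cell_fun_def)
  then show ?thesis using False unfolding L2_inner_def by (simp only: integral_zero if_False simp_thms)
qed

lemma cell_orthonormal:
  assumes "\<mu> \<in> Lat d" "\<nu> \<in> Lat d"
  shows "L2_inner (tf_shift \<mu> (cell_fun s)) (tf_shift \<nu> (cell_fun s))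
    = (if \<mu> = \<nu> then of_real covolume else 0)"
proof -
  have "s - s = dmul 0" by (simp add: vec_eq_iff)
  from cell_orthogonal[OF this assms] show ?thesis by (auto simp: Dhalf_zero prod_eq_iff)
qed

lemma tf_sum_cell_norm:
  assumes "finite X" "X \<subseteq> Lat d"
  shows "L2_norm (tf_sum X w (cell_fun s)) = sqrt covolume * L2_set (\<lambda>\<mu>. cmod (w \<mu>)) X"
proof -
  have "(L2_norm (tf_sum X w (cell_fun s)))\<^sup>2 = covolume * (\<Sum>\<mu>\<in>X. (cmod (w \<mu>))\<^sup>2)"
    unfolding tf_sum_def
    by (intro orthogonal_sum_norm assms(1) tf_shift_L2 cell_fun_L2 cell_orthonormal subsetD[OF assms(2)])
  then show ?thesis
    unfolding L2_set_def real_sqrt_mult[symmetric] by (simp add: L2_norm_nonneg real_sqrt_unique)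
qed

end

subsection \<open>Square-summable sequences\<close>

lemma L2_set_le_ell2_norm:
  assumes "ell2 d w" "finite Y" "Y \<subseteq> Lat d"
  shows "L2_set (\<lambda>\<mu>. cmod (w \<mu>)) Y \<le> ell2_norm d w"
  unfolding L2_set_def ell2_norm_def
  using assms by (intro real_sqrt_le_mono finite_sum_le_infsum) (auto simp: ell2_def)

lemma ell2_norm_nonneg: "0 \<le> ell2_norm d w"
  by (simp add: ell2_norm_def infsum_nonneg)

lemma ell2_norm_sq: "(ell2_norm d w)\<^sup>2 = (\<Sum>\<^sub>\<infinity>\<mu>\<in>Lat d. (cmod (w \<mu>))\<^sup>2)"
  by (simp add: ell2_norm_def infsum_nonneg)

lemma ell2_boundedI:
  assumes "\<And>Y. finite Y \<Longrightarrow> Y \<subseteq> Lat d \<Longrightarrow> L2_set (\<lambda>\<mu>. cmod (w \<mu>)) Y \<le> c"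
  shows "ell2 d w" "ell2_norm d w \<le> c"
proof -
  have c: "0 \<le> c" using assms[of "{}"] by simp
  have le: "(\<Sum>\<mu>\<in>Y. (cmod (w \<mu>))\<^sup>2) \<le> c\<^sup>2" if "finite Y" "Y \<subseteq> Lat d" for Y
    using assms[OF that] c unfolding L2_set_def by (simp add: sqrt_le_D)
  show s: "ell2 d w"
    unfolding ell2_def
    by (rule nonneg_bdd_above_summable_on) (auto intro!: bdd_aboveI2[where M = "c\<^sup>2"] le)
  have "(ell2_norm d w)\<^sup>2 \<le> c\<^sup>2"
    unfolding ell2_norm_sq using s le by (intro infsum_le_finite_sums) (auto simp: ell2_def)
  then show "ell2_norm d w \<le> c" using c by (rule power2_le_imp_le)
qed

lemma L2_set_norm_triangle:
  "L2_set (\<lambda>\<mu>. cmod (a \<mu> + b \<mu>)) Y \<le> L2_set (\<lambda>\<mu>. cmod (a \<mu>)) Y + L2_set (\<lambda>\<mu>. cmod (b \<mu>)) Y"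
  by (rule order_trans[OF L2_set_mono L2_set_triangle_ineq]) (auto simp: norm_triangle_ineq)

lemma L2_set_norm_sum:
  "L2_set (\<lambda>\<mu>. cmod (\<Sum>i\<in>I. a i \<mu>)) Y \<le> (\<Sum>i\<in>I. L2_set (\<lambda>\<mu>. cmod (a i \<mu>)) Y)"
proof (induction I rule: infinite_finite_induct)
  case (insert x F)
  then show ?case
    using L2_set_norm_triangle[of "a x" "\<lambda>\<mu>. \<Sum>i\<in>F. a i \<mu>" Y] by simp
qed (auto simp: L2_set_def)

lemma L2_set_norm_cmult: "L2_set (\<lambda>\<mu>. cmod (c * a \<mu>)) Y = cmod c * L2_set (\<lambda>\<mu>. cmod (a \<mu>)) Y"
  by (simp add: norm_mult L2_set_right_distrib)

lemma ell2_norm_add: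
  assumes "ell2 d u" "ell2 d w"
  shows "ell2 d (\<lambda>\<mu>. u \<mu> + w \<mu>)" "ell2_norm d (\<lambda>\<mu>. u \<mu> + w \<mu>) \<le> ell2_norm d u + ell2_norm d w"
proof -
  have "L2_set (\<lambda>\<mu>. cmod (u \<mu> + w \<mu>)) Y \<le> ell2_norm d u + ell2_norm d w"
    if "finite Y" "Y \<subseteq> Lat d" for Y
    using that by (intro order_trans[OF L2_set_norm_triangle] add_mono L2_set_le_ell2_norm assms)
  from ell2_boundedI[of d "\<lambda>\<mu>. u \<mu> + w \<mu>", OF this]
  show "ell2 d (\<lambda>\<mu>. u \<mu> + w \<mu>)" "ell2_norm d (\<lambda>\<mu>. u \<mu> + w \<mu>) \<le> ell2_norm d u + ell2_norm d w"
    by auto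
qed

lemma ell2_uminus: "ell2 d w \<Longrightarrow> ell2 d (\<lambda>\<mu>. - w \<mu>)" "ell2_norm d (\<lambda>\<mu>. - w \<mu>) = ell2_norm d w"
  by (simp_all add: ell2_def ell2_norm_def)

lemma ell2_norm_diff:
  assumes "ell2 d u" "ell2 d w"
  shows "ell2 d (\<lambda>\<mu>. u \<mu> - w \<mu>)" "ell2_norm d (\<lambda>\<mu>. u \<mu> - w \<mu>) \<le> ell2_norm d u + ell2_norm d w"
  using ell2_norm_add[OF assms(1) ell2_uminus(1)[OF assms(2)]] by (simp_all add: ell2_uminus(2))

lemma ell2_finite_support:
  assumes X: "finite X" "X \<subseteq> Lat d" and w: "\<forall>\<mu>. \<mu> \<notin> X \<longrightarrow> w \<mu> = 0"
  shows "ell2 d w" "ell2_norm d w = L2_set (\<lambda>\<mu>. cmod (w \<mu>)) X"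
proof -
  have "(\<lambda>\<mu>. (cmod (w \<mu>))\<^sup>2) summable_on X" using X by simp
  moreover have "(\<lambda>\<mu>. (cmod (w \<mu>))\<^sup>2) summable_on X \<longleftrightarrow> (\<lambda>\<mu>. (cmod (w \<mu>))\<^sup>2) summable_on Lat d"
    by (rule summable_on_cong_neutral) (use X w in auto)
  ultimately show "ell2 d w" by (simp add: ell2_def)
  have "(\<Sum>\<^sub>\<infinity>\<mu>\<in>Lat d. (cmod (w \<mu>))\<^sup>2) = (\<Sum>\<^sub>\<infinity>\<mu>\<in>X. (cmod (w \<mu>))\<^sup>2)"
    by (rule infsum_cong_neutral) (use X w in auto)
  then show "ell2_norm d w = L2_set (\<lambda>\<mu>. cmod (w \<mu>)) X"
    using X by (simp add: ell2_norm_def L2_set_def)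
qed

context gabor_lattice
begin

lemma ell2_shift:
  assumes \<nu>: "\<nu> \<in> Lat d" and w: "ell2 d w"
  shows "ell2 d (\<lambda>\<mu>. w (\<mu> - \<nu>))" "ell2_norm d (\<lambda>\<mu>. w (\<mu> - \<nu>)) = ell2_norm d w"
proof -
  have bij: "bij_betw (\<lambda>\<mu>. \<mu> - \<nu>) (Lat d) (Lat d)"
    by (rule bij_betw_byWitness[where f' = "\<lambda>\<mu>. \<mu> + \<nu>"])
      (use Lat_diff[OF _ \<nu>] Lat_add[OF _ \<nu>] in auto)
  show "ell2 d (\<lambda>\<mu>. w (\<mu> - \<nu>))"
    using w summable_on_reindex_bij_betw[OF bij, of "\<lambda>\<mu>. (cmod (w \<mu>))\<^sup>2"] by (simp add: ell2_def)
  show "ell2_norm d (\<lambda>\<mu>. w (\<mu> - \<nu>)) = ell2_norm d w"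
    using infsum_reindex_bij_betw[OF bij, of "\<lambda>\<mu>. (cmod (w \<mu>))\<^sup>2"] by (simp add: ell2_norm_def)
qed

text \<open>Numerator of the hypothesis on the envelopes. All errors are measured by these
  quantities, for finitely many \<nu>, and by the norm.\<close>

definition shift_diff ::
  "(real^'n) \<times> (real^'n) \<Rightarrow> ((real^'n) \<times> (real^'n) \<Rightarrow> complex) \<Rightarrow> real" where
  "shift_diff \<nu> w = ell2_norm d (\<lambda>\<mu>. w (\<mu> - \<nu>) - w \<mu>)"

lemma shift_diff_nonneg: "0 \<le> shift_diff \<nu> w"
  by (simp add: shift_diff_def ell2_norm_nonneg)

lemma shift_diff_le: "\<nu> \<in> Lat d \<Longrightarrow> ell2 d w \<Longrightarrow> shift_diff \<nu> w \<le> 2 * ell2_norm d w"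
  using ell2_norm_diff(2)[OF ell2_shift(1), of \<nu> w w] ell2_shift(2)[of \<nu> w] by (simp add: shift_diff_def)

end

section \<open>Coefficients of almost shift-invariant superpositions of cell functions\<close>

context gabor_lattice
begin

definition cell_coord :: "real^'n \<Rightarrow> real^'n" where
  "cell_coord t = t - dshift d (cell_index d t)"

text \<open>The values of h on the cell s, repeated over all cells. This function is invariant under
  lattice translations, so it can be taken out of \<open>tf_shift\<close>.\<close>

definition cell_periodic :: "(real^'n \<Rightarrow> complex) \<Rightarrow> int^'n \<Rightarrow> real^'n \<Rightarrow> complex" where
  "cell_periodic h s t = h (cell_coord t + dshift d s)"

lemma cell_coord_measurable [measurable]: "cell_coord \<in> borel_measurable borel"
proof -
  have "(\<lambda>t. cell_coord t \<bullet> b) \<in> borel_measurable borel" if "b \<in> Basis" for b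
  proof -
    obtain j where b: "b = axis j 1" using \<open>b \<in> Basis\<close> by (auto simp: Basis_vec_def)
    have "(\<lambda>t. t $ j - of_int (cell_index d t $ j) / sqrt (real (d j))) \<in> borel_measurable borel"
      by measurable
    then show ?thesis unfolding b cell_coord_def by (simp add: inner_axis)
  qed
  then show ?thesis by (subst borel_measurable_euclidean_space) auto
qed

lemma cell_periodic_measurable [measurable]:
  "h \<in> borel_measurable borel \<Longrightarrow> cell_periodic h s \<in> borel_measurable borel"
  unfolding cell_periodic_def
  by (rule measurable_compose[of "\<lambda>t. cell_coord t + dshift d s" _ borel h]) measurable

lemma cell_index_cell_coord: "cell_index d (cell_coord t + dshift d s) = s"
proof -
  have "sqrt (real (d j)) * (t $ j - of_int c / sqrt (real (d j)) + of_int (s $ j) / sqrt (real (d j))) + 1 / 2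
      = (sqrt (real (d j)) * t $ j + 1 / 2) - of_int (c - s $ j)" for j c
    using sqrt_d_pos[of j] by (simp add: algebra_simps)
  then have "\<lfloor>sqrt (real (d j)) * (t $ j - of_int c / sqrt (real (d j)) + of_int (s $ j) / sqrt (real (d j))) + 1 / 2\<rfloor>
      = \<lfloor>sqrt (real (d j)) * t $ j + 1 / 2\<rfloor> - (c - s $ j)" for j c
    by (simp only: floor_diff_of_int)
  then show ?thesis by (simp add: vec_eq_iff cell_index_def cell_coord_def)
qed

text \<open>Where the shifted cell function is nonzero, t - \<open>Dhalf d k\<close> is the point of
  the cell s at the same relative position as t.\<close>

lemma tf_shift_cell_piece:
  assumes "\<mu> \<in> Lat d"
  shows "tf_shift \<mu> (\<lambda>t. h t * cell_fun s t) t = cell_periodic h s t * tf_shift \<mu> (cell_fun s) t"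
proof -
  obtain k m where \<mu>: "\<mu> = (Dhalf d k, m)" using assms unfolding Lat_iff by blast
  show ?thesis
  proof (cases "cell_index d (t - Dhalf d k) = s")
    case True
    then have "cell_coord t + dshift d s = t - Dhalf d k"
      unfolding cell_coord_def cell_index_translate
      by (auto simp: dshift_dmul[symmetric] vec_eq_iff diff_divide_distrib add_divide_distrib algebra_simps)
    then show ?thesis by (simp add: \<mu> tf_shift_def cell_periodic_def)
  next
    case False
    then show ?thesis by (simp add: \<mu> tf_shift_def cell_fun_def)
  qed
qed

lemma cell_coord_bound: "\<bar>sqrt (real (d j)) * cell_coord t $ j\<bar> \<le> 1/2"
proof -
  have "sqrt (real (d j)) * cell_coord t $ j
      = (sqrt (real (d j)) * t $ j) - of_int \<lfloor>sqrt (real (d j)) * t $ j + 1/2\<rfloor>"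
    using sqrt_d_pos[of j] by (simp add: cell_coord_def cell_index_def right_diff_distrib)
  then show ?thesis
    using of_int_floor_le[of "sqrt (real (d j)) * t $ j + 1/2"]
      real_of_int_floor_add_one_gt[of "sqrt (real (d j)) * t $ j + 1/2"] by linarith
qed

section \<open>Lattice characters and concentration at the centres of the cells\<close>

definition unit_mod :: "'n \<Rightarrow> (real^'n) \<times> (real^'n)" where
  "unit_mod j = (0, Dhalf d (axis j 1))"

lemma unit_mod_Lat: "unit_mod j \<in> Lat d"
  unfolding unit_mod_def Lat_iff by (metis Dhalf_zero)

definition lattice_char :: "'n \<Rightarrow> real^'n \<Rightarrow> complex" where
  "lattice_char j t = cis (2 * pi * (sqrt (real (d j)) * t $ j))"

lemma Dhalf_axis: "Dhalf d (axis j 1) \<bullet> t = sqrt (real (d j)) * t $ j"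
proof -
  have "Dhalf d (axis j 1) = axis j (sqrt (real (d j)))"
    by (auto simp: vec_eq_iff axis_def)
  then show ?thesis by (simp add: inner_axis_axis inner_commute inner_axis)
qed

text \<open>A lattice character is itself a modulation from the lattice, so multiplying by it only
  relabels the terms of a superposition.\<close>

lemma lattice_char_tf_shift:
  "lattice_char j t * tf_shift \<nu> f t = tf_shift (\<nu> + unit_mod j) f t"
  unfolding lattice_char_def tf_shift_def unit_mod_def Dhalf_axis[symmetric]
  by (simp add: inner_add_left distrib_left cis_mult[symmetric] mult_ac)

text \<open>The characters equal 1 at all centres, so they see only the position inside the
  cell.\<close>

lemma lattice_char_cell_coord: "lattice_char j t = lattice_char j (cell_coord t)"
proof -
  have "sqrt (real (d j)) * t $ j = sqrt (real (d j)) * cell_coord t $ j + of_int (cell_index d t $ j)"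
    using sqrt_d_pos[of j] by (simp add: cell_coord_def right_diff_distrib)
  then have "lattice_char j t = lattice_char j (cell_coord t) * cis (2 * pi * of_int (cell_index d t $ j))"
    unfolding lattice_char_def cis_mult by (simp add: distrib_left)
  then show ?thesis by simp
qed

lemma lattice_char_measurable [measurable]: "lattice_char j \<in> borel_measurable borel"
  unfolding lattice_char_def by measurable

lemma cis_minus_1_lower:
  assumes "0 < \<theta>" "\<theta> \<le> \<bar>x\<bar>" "\<bar>x\<bar> \<le> pi"
  shows "1 - cos \<theta> \<le> cmod (cis x - 1)"
proof -
  have "cos \<bar>x\<bar> \<le> cos \<theta>" using assms by (intro cos_monotone_0_pi_le) auto
  then have "1 - cos \<theta> \<le> - Re (cis x - 1)" by simp
  also have "\<dots> \<le> cmod (cis x - 1)" using abs_Re_le_cmod[of "cis x - 1"] by linarith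
  finally show ?thesis .
qed

text \<open>Away from the centre of the cell some lattice character is far from \<open>1\<close>; this is what
  localises almost shift-invariant superpositions to the centres of the cells.\<close>

lemma cell_periodic_modulus:
  fixes g :: "real^'n \<Rightarrow> complex"
  assumes g: "continuous_on UNIV g" and M: "\<And>t. cmod (g t) \<le> M (cell_index d t)" and e: "e > 0"
  obtains C where "C \<ge> 0"
    "\<And>t. cmod (cell_periodic g s t - g (dshift d s)) \<le> e + C * (\<Sum>j\<in>UNIV. cmod (lattice_char j t - 1))"
proof -
  obtain \<delta> where \<delta>: "\<delta> > 0" "\<And>u. dist u (dshift d s) < \<delta> \<Longrightarrow> dist (g u) (g (dshift d s)) < e"
    using g[unfolded continuous_on_iff, rule_format, of "dshift d s" e] e by auto
  \<comment> \<open>The first bound makes the l1 norm of the position smaller than \<delta>; the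
    second keeps 2 pi \<rho> in [0, pi], where the cosine decreases.\<close>
  define \<rho> where "\<rho> = min (\<delta> / (2 * CARD('n))) (1/2)"
  have \<rho>: "\<rho> > 0" "\<rho> \<le> 1/2" "\<rho> \<le> \<delta> / (2 * CARD('n))" using \<delta> by (auto simp: \<rho>_def)
  define c where "c = 1 - cos (2 * pi * \<rho>)"
  have "cos (2 * pi * \<rho>) < cos 0" using \<rho> by (intro cos_monotone_0_pi) auto
  then have c: "c > 0" by (simp add: c_def)
  have cidx: "cell_index d (dshift d s) = s"
    using cell_index_cell_coord[of 0 s] by (simp add: cell_coord_def cell_index_def vec_eq_iff)
  have M0: "M s \<ge> 0" using order_trans[OF norm_ge_zero M[of "dshift d s"]] by (simp add: cidx)
  show thesis
  \<comment> \<open>Away from the centre the left-hand side is at most 2 M s, while some character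
    differs from 1 by at least c.\<close>
  proof (rule that[of "2 * M s / c"])
    show "0 \<le> 2 * M s / c" using M0 c by simp
    fix t
    let ?\<tau> = "cell_coord t"
    have S0: "0 \<le> (\<Sum>j\<in>UNIV. cmod (lattice_char j t - 1))" by (intro sum_nonneg) auto
    show "cmod (cell_periodic g s t - g (dshift d s))
        \<le> e + 2 * M s / c * (\<Sum>j\<in>UNIV. cmod (lattice_char j t - 1))"
    proof (cases "\<forall>j. \<bar>sqrt (real (d j)) * ?\<tau> $ j\<bar> < \<rho>")
      case True
      have "norm ?\<tau> \<le> (\<Sum>j\<in>UNIV. \<bar>?\<tau> $ j\<bar>)" by (rule norm_le_l1_cart)
      also have "\<dots> \<le> (\<Sum>j\<in>(UNIV::'n set). \<rho>)"
      proof (rule sum_mono)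
        fix j
        have "1 * \<bar>?\<tau> $ j\<bar> \<le> sqrt (real (d j)) * \<bar>?\<tau> $ j\<bar>"
          using d_pos[of j] by (intro mult_right_mono) auto
        also have "\<dots> = \<bar>sqrt (real (d j)) * ?\<tau> $ j\<bar>" by (simp add: abs_mult)
        also have "\<dots> \<le> \<rho>" using True[rule_format, of j] by (rule less_imp_le)
        finally show "\<bar>?\<tau> $ j\<bar> \<le> \<rho>" by simp
      qed
      also have "\<dots> = CARD('n) * \<rho>" by simp
      also have "\<dots> \<le> CARD('n) * (\<delta> / (2 * CARD('n)))" using \<rho>(3) by (intro mult_left_mono) auto
      also have "\<dots> < \<delta>" using \<delta> by simp
      finally have "dist (g (?\<tau> + dshift d s)) (g (dshift d s)) < e"
        by (intro \<delta>(2)) (simp add: dist_norm)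
      then have "cmod (cell_periodic g s t - g (dshift d s)) \<le> e"
        by (simp add: cell_periodic_def dist_norm)
      also have "\<dots> \<le> e + 2 * M s / c * (\<Sum>j\<in>UNIV. cmod (lattice_char j t - 1))"
        using S0 M0 c by simp
      finally show ?thesis .
    next
      case False
      then obtain j where j: "\<rho> \<le> \<bar>sqrt (real (d j)) * ?\<tau> $ j\<bar>" by (auto simp: not_less)
      have "c \<le> cmod (lattice_char j t - 1)"
        unfolding c_def lattice_char_cell_coord[of j t] unfolding lattice_char_def
      proof (rule cis_minus_1_lower)
        show "0 < 2 * pi * \<rho>" using \<rho> by simp
        show "2 * pi * \<rho> \<le> \<bar>2 * pi * (sqrt (real (d j)) * ?\<tau> $ j)\<bar>"
          using j by (simp add: abs_mult)
        show "\<bar>2 * pi * (sqrt (real (d j)) * ?\<tau> $ j)\<bar> \<le> pi"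
          using mult_left_mono[OF cell_coord_bound[of j t], of "2 * pi"] by (simp add: abs_mult)
      qed
      also have "\<dots> \<le> (\<Sum>j\<in>UNIV. cmod (lattice_char j t - 1))"
        by (rule member_le_sum) auto
      finally have "2 * M s / c * c \<le> 2 * M s / c * (\<Sum>j\<in>UNIV. cmod (lattice_char j t - 1))"
        using M0 c by (intro mult_left_mono) auto
      then have "2 * M s \<le> 2 * M s / c * (\<Sum>j\<in>UNIV. cmod (lattice_char j t - 1))" using c by simp
      moreover have "cmod (cell_periodic g s t - g (dshift d s)) \<le> M s + M s"
        using norm_triangle_ineq4[of "cell_periodic g s t" "g (dshift d s)"]
          M[of "?\<tau> + dshift d s"] M[of "dshift d s"]
        by (simp add: cell_index_cell_coord cidx cell_periodic_def)
      ultimately show ?thesis using e by simp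
    qed
  qed
qed

text \<open>Summation by parts: shifting the functions is shifting the coefficients. The index set
  is enlarged so as to hold both supports.\<close>

lemma tf_sum_shift:
  assumes X: "finite X" and w: "\<forall>\<mu>. \<mu> \<notin> X \<longrightarrow> w \<mu> = 0"
  shows "tf_sum (X \<union> (\<lambda>\<mu>. \<mu> + \<nu>) ` X) (\<lambda>\<mu>. w (\<mu> - \<nu>) - w \<mu>) f t
    = (\<Sum>\<mu>\<in>X. w \<mu> * (tf_shift (\<mu> + \<nu>) f t - tf_shift \<mu> f t))"
proof -
  let ?X' = "X \<union> (\<lambda>\<mu>. \<mu> + \<nu>) ` X"
  have "(\<Sum>\<mu>\<in>?X'. w (\<mu> - \<nu>) * tf_shift \<mu> f t) = (\<Sum>\<mu>\<in>(\<lambda>\<mu>. \<mu> + \<nu>) ` X. w (\<mu> - \<nu>) * tf_shift \<mu> f t)"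
  proof (intro sum.mono_neutral_right ballI)
    fix \<mu> assume "\<mu> \<in> ?X' - (\<lambda>\<mu>. \<mu> + \<nu>) ` X"
    then have "\<mu> - \<nu> \<notin> X" by (auto intro: image_eqI[of _ _ "\<mu> - \<nu>"])
    then show "w (\<mu> - \<nu>) * tf_shift \<mu> f t = 0" using w[rule_format, of "\<mu> - \<nu>"] by simp
  qed (use X in auto)
  also have "\<dots> = (\<Sum>\<mu>\<in>X. w \<mu> * tf_shift (\<mu> + \<nu>) f t)"
    by (subst sum.reindex) (auto simp: inj_on_def)
  finally have 1: "(\<Sum>\<mu>\<in>?X'. w (\<mu> - \<nu>) * tf_shift \<mu> f t) = (\<Sum>\<mu>\<in>X. w \<mu> * tf_shift (\<mu> + \<nu>) f t)" .
  have 2: "(\<Sum>\<mu>\<in>?X'. w \<mu> * tf_shift \<mu> f t) = (\<Sum>\<mu>\<in>X. w \<mu> * tf_shift \<mu> f t)"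
    by (intro sum.mono_neutral_right) (use X w in auto)
  show ?thesis
    unfolding tf_sum_def left_diff_distrib right_diff_distrib sum_subtractf 1 2 ..
qed

lemma shift_diff_finite_support:
  assumes X: "finite X" "X \<subseteq> Lat d" and w: "\<forall>\<mu>. \<mu> \<notin> X \<longrightarrow> w \<mu> = 0" and \<nu>: "\<nu> \<in> Lat d"
  shows "shift_diff \<nu> w = L2_set (\<lambda>\<mu>. cmod (w (\<mu> - \<nu>) - w \<mu>)) (X \<union> (\<lambda>\<mu>. \<mu> + \<nu>) ` X)"
  unfolding shift_diff_def
proof (rule ell2_finite_support(2))
  show "\<forall>\<mu>. \<mu> \<notin> X \<union> (\<lambda>\<mu>. \<mu> + \<nu>) ` X \<longrightarrow> w (\<mu> - \<nu>) - w \<mu> = 0"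
  proof (intro allI impI)
    fix \<mu> assume \<mu>: "\<mu> \<notin> X \<union> (\<lambda>\<mu>. \<mu> + \<nu>) ` X"
    have "\<mu> - \<nu> \<notin> X" using \<mu> by (auto intro: image_eqI[of _ _ "\<mu> - \<nu>"])
    with \<mu> show "w (\<mu> - \<nu>) - w \<mu> = 0"
      using w[rule_format, of "\<mu> - \<nu>"] w[rule_format, of \<mu>] by simp
  qed
qed (use X Lat_add[OF _ \<nu>] in auto)

text \<open>The factor turns into a difference of coefficients by \<open>tf_sum_shift\<close>, and
  orthogonality of the shifted cell functions computes the norm exactly.\<close>

lemma lattice_char_cell_sum:
  assumes X: "finite X" "X \<subseteq> Lat d" and w: "\<forall>\<mu>. \<mu> \<notin> X \<longrightarrow> w \<mu> = 0"
  shows "(\<lambda>t. (lattice_char j t - 1) * tf_sum X w (cell_fun r) t) \<in> L2"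
    and "L2_norm (\<lambda>t. (lattice_char j t - 1) * tf_sum X w (cell_fun r) t) = sqrt covolume * shift_diff (unit_mod j) w"
proof -
  let ?X' = "X \<union> (\<lambda>\<mu>. \<mu> + unit_mod j) ` X"
  have eq: "(\<lambda>t. (lattice_char j t - 1) * tf_sum X w (cell_fun r) t)
      = tf_sum ?X' (\<lambda>\<mu>. w (\<mu> - unit_mod j) - w \<mu>) (cell_fun r)"
  proof
    fix t
    have "(lattice_char j t - 1) * (w \<mu> * tf_shift \<mu> (cell_fun r) t)
        = w \<mu> * (tf_shift (\<mu> + unit_mod j) (cell_fun r) t - tf_shift \<mu> (cell_fun r) t)" for \<mu>
      unfolding lattice_char_tf_shift[symmetric] by (simp add: algebra_simps)
    then have "(lattice_char j t - 1) * tf_sum X w (cell_fun r) t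
        = (\<Sum>\<mu>\<in>X. w \<mu> * (tf_shift (\<mu> + unit_mod j) (cell_fun r) t - tf_shift \<mu> (cell_fun r) t))"
      by (simp only: tf_sum_def sum_distrib_left)
    then show "(lattice_char j t - 1) * tf_sum X w (cell_fun r) t
        = tf_sum ?X' (\<lambda>\<mu>. w (\<mu> - unit_mod j) - w \<mu>) (cell_fun r) t"
      by (rule trans) (rule tf_sum_shift[where w = w, OF X(1) w, symmetric])
  qed
  show "(\<lambda>t. (lattice_char j t - 1) * tf_sum X w (cell_fun r) t) \<in> L2"
    unfolding eq by (intro tf_sum_L2 cell_fun_L2)
  have "finite ?X'" "?X' \<subseteq> Lat d" using X Lat_add[OF _ unit_mod_Lat] by auto
  then show "L2_norm (\<lambda>t. (lattice_char j t - 1) * tf_sum X w (cell_fun r) t) = sqrt covolume * shift_diff (unit_mod j) w"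
    unfolding eq shift_diff_finite_support[where w = w, OF X w unit_mod_Lat] by (rule tf_sum_cell_norm)
qed

text \<open>\<open>L2_norm\<close> takes complex functions, so real majorants enter through
  \<open>complex_of_real\<close>.\<close>

lemma L2_norm_of_real_cmod:
  assumes "f \<in> L2" "C \<ge> 0"
  shows "(\<lambda>t. complex_of_real (C * cmod (f t))) \<in> L2"
    "L2_norm (\<lambda>t. complex_of_real (C * cmod (f t))) = C * L2_norm f"
proof -
  have [measurable]: "f \<in> borel_measurable borel" using assms(1) by (rule L2_borel)
  have c: "cmod (complex_of_real (C * cmod (f t))) = cmod (of_real C * f t)" for t
    using assms(2) by (simp add: norm_mult)
  show "(\<lambda>t. complex_of_real (C * cmod (f t))) \<in> L2"
    by (rule L2_norm_mono(1)[OF _ L2_cmult[OF assms(1), of "of_real C"]]) (measurable, simp only: c order_refl)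
  have "L2_norm (\<lambda>t. complex_of_real (C * cmod (f t))) = L2_norm (\<lambda>t. of_real C * f t)"
    unfolding L2_norm_def c ..
  then show "L2_norm (\<lambda>t. complex_of_real (C * cmod (f t))) = C * L2_norm f"
    using assms(2) by (simp add: L2_norm_cmult)
qed

text \<open>Multiplied by the superposition, each term of the bound on q has a norm known from
  \<open>tf_sum_cell_norm\<close> or \<open>lattice_char_cell_sum\<close>. The case C = 0 is used as
  well, for cells far out where only the size of q matters.\<close>

lemma cell_remainder_small:
  assumes X: "finite X" "X \<subseteq> Lat d" and w: "\<forall>\<mu>. \<mu> \<notin> X \<longrightarrow> w \<mu> = 0"
    and q: "q \<in> borel_measurable borel" and e: "e \<ge> 0" and C: "C \<ge> 0"
    and bound: "\<And>t. cmod (q t) \<le> e + C * (\<Sum>j\<in>UNIV. cmod (lattice_char j t - 1))"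
  shows "L2_norm (\<lambda>t. tf_sum X w (cell_fun r) t * cnj (q t))
    \<le> sqrt covolume * (e * ell2_norm d w + C * (\<Sum>j\<in>UNIV. shift_diff (unit_mod j) w))"
proof -
  let ?F = "tf_sum X w (cell_fun r)"
  have F: "?F \<in> L2" by (intro tf_sum_L2 cell_fun_L2)
  have [measurable]: "?F \<in> borel_measurable borel" using F by (rule L2_borel)
  note [measurable] = borel_measurable_cnj[OF q]
  let ?G = "\<lambda>j t. (lattice_char j t - 1) * ?F t"
  note G = lattice_char_cell_sum[where w = w, OF X w, where r = r]
  let ?H = "\<lambda>t. complex_of_real (e * cmod (?F t)) + (\<Sum>j\<in>UNIV. complex_of_real (C * cmod (?G j t)))"
  have HL: "(\<lambda>t. \<Sum>j\<in>UNIV. complex_of_real (C * cmod (?G j t))) \<in> L2"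
    by (intro L2_finite_sum L2_norm_of_real_cmod(1) G C)
  have H: "?H \<in> L2"
    by (intro L2_add HL L2_norm_of_real_cmod(1) F e)
  have "L2_norm (\<lambda>t. ?F t * cnj (q t)) \<le> L2_norm ?H"
  proof (rule L2_norm_mono(2)[OF _ H])
    fix t
    have "cmod (?F t * cnj (q t)) \<le> cmod (?F t) * (e + C * (\<Sum>j\<in>UNIV. cmod (lattice_char j t - 1)))"
      using bound[of t] by (simp add: norm_mult mult_left_mono)
    also have "\<dots> = e * cmod (?F t) + (\<Sum>j\<in>UNIV. C * cmod (?G j t))"
      by (simp only: norm_mult distrib_left sum_distrib_left mult_ac)
    also have "\<dots> = Re (?H t)" by (simp add: Re_sum)
    also have "\<dots> \<le> cmod (?H t)" by (rule complex_Re_le_cmod)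
    finally show "cmod (?F t * cnj (q t)) \<le> cmod (?H t)" .
  qed measurable
  also have "\<dots> \<le> L2_norm (\<lambda>t. complex_of_real (e * cmod (?F t))) + L2_norm (\<lambda>t. \<Sum>j\<in>UNIV. complex_of_real (C * cmod (?G j t)))"
    by (intro L2_triangle HL L2_norm_of_real_cmod(1) F e)
  also have "\<dots> \<le> e * L2_norm ?F + (\<Sum>j\<in>UNIV. C * L2_norm (?G j))"
  proof (rule add_mono)
    show "L2_norm (\<lambda>t. complex_of_real (e * cmod (?F t))) \<le> e * L2_norm ?F"
      by (simp only: L2_norm_of_real_cmod(2)[OF F e])
    have "L2_norm (\<lambda>t. \<Sum>j\<in>UNIV. complex_of_real (C * cmod (?G j t))) \<le> (\<Sum>j\<in>UNIV. L2_norm (\<lambda>t. complex_of_real (C * cmod (?G j t))))"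
      by (intro L2_triangle_sum L2_norm_of_real_cmod(1) G C)
    then show "L2_norm (\<lambda>t. \<Sum>j\<in>UNIV. complex_of_real (C * cmod (?G j t))) \<le> (\<Sum>j\<in>UNIV. C * L2_norm (?G j))"
      unfolding L2_norm_of_real_cmod(2)[OF G(1) C] .
  qed
  also have "L2_norm ?F = sqrt covolume * ell2_norm d w"
    by (simp add: tf_sum_cell_norm[OF X] ell2_finite_support(2)[where w = w, OF X w])
  also have "(\<Sum>j\<in>UNIV. C * L2_norm (?G j)) = sqrt covolume * (C * (\<Sum>j\<in>UNIV. shift_diff (unit_mod j) w))"
    unfolding G(2) by (simp add: sum_distrib_left mult_ac)
  finally show ?thesis by (simp add: algebra_simps)
qed

text \<open>A finite superposition lives on finitely many cells, so cutting g into cells involves no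
  limit. Any larger set S serves as well, and the same S serves for all \<mu> in Y.\<close>

lemma inner_cell_decomposition:
  assumes X: "finite X" "X \<subseteq> Lat d" and Y: "finite Y" "Y \<subseteq> Lat d" and g: "g \<in> L2"
  obtains S0 where "finite S0"
    "\<And>S \<mu>. finite S \<Longrightarrow> S0 \<subseteq> S \<Longrightarrow> \<mu> \<in> Y \<Longrightarrow>
      L2_inner (tf_sum X w (cell_fun r)) (tf_shift \<mu> g)
      = (\<Sum>s\<in>S. L2_inner (tf_sum X w (cell_fun r)) (tf_shift \<mu> (\<lambda>t. g t * cell_fun s t)))"
proof -
  let ?F = "tf_sum X w (cell_fun r)"
  define kk where "kk \<mu> = inv (Dhalf d) (fst \<mu>)" for \<mu> :: "(real^'n) \<times> (real^'n)"
  have kk: "fst \<mu> = Dhalf d (kk \<mu>)" if "\<mu> \<in> Lat d" for \<mu>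
    using that unfolding Lat_iff kk_def by (auto simp: inv_f_f[OF Dhalf_inj])
  \<comment> \<open>The cells occupied by the superposition, moved back by the translations in
    \<open>Y\<close>.\<close>
  define S0 where "S0 = (\<lambda>(\<nu>, \<mu>). r + dmul (kk \<nu>) - dmul (kk \<mu>)) ` (X \<times> Y)"
  have supp: "\<exists>\<nu>\<in>X. cell_index d t = r + dmul (kk \<nu>)" if nz: "?F t \<noteq> 0" for t
  proof -
    obtain \<nu> where \<nu>: "\<nu> \<in> X" "tf_shift \<nu> (cell_fun r) t \<noteq> 0"
    proof -
      have "\<exists>\<nu>\<in>X. tf_shift \<nu> (cell_fun r) t \<noteq> 0"
        by (rule ccontr) (use nz in \<open>simp add: tf_sum_def\<close>)
      then show ?thesis using that by blast
    qed
    then have "\<nu> = (Dhalf d (kk \<nu>), snd \<nu>)" using X(2) kk[of \<nu>] by (metis prod.collapse subsetD)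
    then have "cell_fun (r + dmul (kk \<nu>)) t \<noteq> 0" using \<nu>(2) tf_shift_cell_fun by (metis mult_zero_right)
    with \<nu>(1) show ?thesis by (auto simp: cell_fun_def split: if_splits)
  qed
  have piece: "(\<lambda>t. g t * cell_fun s t) \<in> L2" for s
  proof (rule L2_norm_mono(1)[OF _ g])
    show "(\<lambda>t. g t * cell_fun s t) \<in> borel_measurable borel"
      using L2_borel[OF g] by measurable
  qed (simp add: norm_mult cell_fun_def)
  show thesis
  proof (rule that)
    show "finite S0" unfolding S0_def using X Y by auto
    fix S \<mu> assume S: "finite S" "S0 \<subseteq> S" and \<mu>: "\<mu> \<in> Y"
    \<comment> \<open>Where \<open>?F t\<close> is nonzero, t - \<open>fst \<mu>\<close> lies in
      exactly one cell, whose index belongs to \<open>S0\<close>; elsewhere both sides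
      vanish.\<close>
    have "?F t * cnj (tf_shift \<mu> g t) = ?F t * cnj (\<Sum>s\<in>S. tf_shift \<mu> (\<lambda>t. g t * cell_fun s t) t)" for t
    proof (cases "?F t = 0")
      case False
      then obtain \<nu> where \<nu>: "\<nu> \<in> X" "cell_index d t = r + dmul (kk \<nu>)" using supp by blast
      let ?s = "r + dmul (kk \<nu>) - dmul (kk \<mu>)"
      have s: "?s \<in> S" using S \<nu> \<mu> unfolding S0_def by force
      have c: "cell_index d (t - fst \<mu>) = ?s"
        using \<nu>(2) kk[of \<mu>] \<mu> Y by (auto simp: cell_index_translate)
      have "(\<Sum>s\<in>S. tf_shift \<mu> (\<lambda>t. g t * cell_fun s t) t)
          = (\<Sum>s\<in>S. if s = ?s then tf_shift \<mu> g t else 0)"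
        by (intro sum.cong refl) (auto simp: tf_shift_def cell_fun_def c)
      also have "\<dots> = tf_shift \<mu> g t" using S s by (simp add: sum.delta)
      finally show ?thesis by simp
    qed simp
    then have "L2_inner ?F (tf_shift \<mu> g) = L2_inner ?F (\<lambda>t. \<Sum>s\<in>S. tf_shift \<mu> (\<lambda>t. g t * cell_fun s t) t)"
      unfolding L2_inner_def by (simp only:)
    also have "\<dots> = (\<Sum>s\<in>S. L2_inner ?F (tf_shift \<mu> (\<lambda>t. g t * cell_fun s t)))"
      by (intro L2_inner_sum_right tf_shift_L2 piece tf_sum_L2 cell_fun_L2)
    finally show "L2_inner ?F (tf_shift \<mu> g) = (\<Sum>s\<in>S. L2_inner ?F (tf_shift \<mu> (\<lambda>t. g t * cell_fun s t)))" .
  qed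
qed

text \<open>Only translates of the cell r meet its superposition, and the translate by k reads off a
  single coefficient, displaced by k in time.\<close>

lemma inner_cell_shift:
  assumes X: "finite X" "X \<subseteq> Lat d" and w: "\<forall>\<mu>. \<mu> \<notin> X \<longrightarrow> w \<mu> = 0" and \<mu>: "\<mu> \<in> Lat d"
  shows "L2_inner (tf_sum X w (cell_fun r)) (tf_shift \<mu> (cell_fun (r + dmul k)))
      = of_real covolume * w (\<mu> + (Dhalf d k, 0))"
    and "(\<nexists>k. s = r + dmul k) \<Longrightarrow> L2_inner (tf_sum X w (cell_fun r)) (tf_shift \<mu> (cell_fun s)) = 0"
proof -
  have eq: "r - (r + dmul k) = dmul (- k)" by (simp add: vec_eq_iff)
  have "L2_inner (tf_sum X w (cell_fun r)) (tf_shift \<mu> (cell_fun (r + dmul k)))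
      = (\<Sum>\<nu>\<in>X. w \<nu> * (if \<mu> = \<nu> + (Dhalf d (- k), 0) then of_real covolume else 0))"
    unfolding L2_inner_tf_sum_left[OF cell_fun_L2 tf_shift_L2[OF cell_fun_L2]]
  proof (intro sum.cong refl)
    fix \<nu> assume "\<nu> \<in> X"
    then have "\<nu> \<in> Lat d" using X by blast
    from cell_orthogonal[OF eq this \<mu>]
    show "w \<nu> * L2_inner (tf_shift \<nu> (cell_fun r)) (tf_shift \<mu> (cell_fun (r + dmul k)))
        = w \<nu> * (if \<mu> = \<nu> + (Dhalf d (- k), 0) then of_real covolume else 0)" by simp
  qed
  also have "\<dots> = (\<Sum>\<nu>\<in>X. if \<nu> = \<mu> + (Dhalf d k, 0) then w \<nu> * of_real covolume else 0)"
    by (intro sum.cong refl) (auto simp: Dhalf_uminus prod_eq_iff)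
  also have "\<dots> = of_real covolume * w (\<mu> + (Dhalf d k, 0))"
    using X(1) w[rule_format, of "\<mu> + (Dhalf d k, 0)"] by (simp add: sum.delta)
  finally show "L2_inner (tf_sum X w (cell_fun r)) (tf_shift \<mu> (cell_fun (r + dmul k)))
      = of_real covolume * w (\<mu> + (Dhalf d k, 0))" .
  assume s: "\<nexists>k. s = r + dmul k"
  have "L2_inner (tf_shift \<nu> (cell_fun r)) (tf_shift \<mu> (cell_fun s)) = 0" if \<nu>X: "\<nu> \<in> X" for \<nu>
  proof -
    obtain k1 l1 where \<mu>': "\<mu> = (Dhalf d k1, Dhalf d l1)" using \<mu> unfolding Lat_iff by blast
    obtain k2 l2 where \<nu>': "\<nu> = (Dhalf d k2, Dhalf d l2)"
      using subsetD[OF X(2) \<nu>X] unfolding Lat_iff by blast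
    have ne: "r + dmul k2 \<noteq> s + dmul k1"
    proof
      assume "r + dmul k2 = s + dmul k1"
      then have "s = r + dmul (k2 - k1)" by (auto simp: vec_eq_iff algebra_simps)
      with s show False by blast
    qed
    have "tf_shift \<nu> (cell_fun r) t * cnj (tf_shift \<mu> (cell_fun s) t) = 0" for t
      using ne unfolding \<mu>' \<nu>' tf_shift_cell_fun by (auto simp: cell_fun_def)
    then show ?thesis unfolding L2_inner_def by (simp only: integral_zero)
  qed
  then show "L2_inner (tf_sum X w (cell_fun r)) (tf_shift \<mu> (cell_fun s)) = 0"
    unfolding L2_inner_tf_sum_left[OF cell_fun_L2 tf_shift_L2[OF cell_fun_L2]] by simp
qed

text \<open>At the origin all phases are 1, and the samples at the cell centres inherit the summable
  majorant. The Zak series thus converges absolutely, and k may be reflected to -k.\<close>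

lemma Zak_vec_has_sum:
  assumes M: "M summable_on UNIV" "\<And>t. cmod (g t) \<le> M (cell_index d t)" and r: "r \<in> Zd d"
  shows "((\<lambda>k. g (dshift d r + Dhalf d k)) has_sum Zak_vec d g 0 0 r) UNIV"
    and "(\<lambda>k. M (r + dmul k)) summable_on UNIV"
    and "\<And>k. cmod (g (dshift d r + Dhalf d k)) \<le> M (r + dmul k)"
proof -
  have inj: "inj (\<lambda>k. r + dmul k)" by (auto intro!: injI dest: dmul_inj)
  show A: "(\<lambda>k. M (r + dmul k)) summable_on UNIV"
    using summable_on_reindex[OF inj, of M] summable_on_subset_banach[OF M(1), of "range (\<lambda>k. r + dmul k)"]
    by (simp add: o_def)
  have c: "cell_index d (dshift d s) = s" for s
    using cell_index_cell_coord[of 0 s] by (simp add: cell_coord_def cell_index_def vec_eq_iff)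
  show bd: "cmod (g (dshift d r + Dhalf d k)) \<le> M (r + dmul k)" for k
    using M(2)[of "dshift d (r + dmul k)"] unfolding c by (simp add: dshift_add dshift_dmul)
  have summ: "(\<lambda>k. g (dshift d r + Dhalf d k)) summable_on UNIV"
    by (rule abs_summable_summable[OF summable_on_comparison_test[OF A]]) (use bd in auto)
  have "Zak_vec d g 0 0 r = (\<Sum>\<^sub>\<infinity>\<gamma>\<in>range (Dhalf d). g (dshift d r - \<gamma>))"
    using r by (simp add: Zak_vec_def Zak_def)
  also have "\<dots> = (\<Sum>\<^sub>\<infinity>k. g (dshift d r - Dhalf d k))"
    by (subst infsum_reindex[OF Dhalf_inj]) (simp add: o_def)
  also have "\<dots> = (\<Sum>\<^sub>\<infinity>k. g (dshift d r + Dhalf d k))"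
    using infsum_reindex[of uminus UNIV "\<lambda>k. g (dshift d r + Dhalf d k)"]
    by (simp add: o_def Dhalf_uminus inj_on_def)
  finally show "((\<lambda>k. g (dshift d r + Dhalf d k)) has_sum Zak_vec d g 0 0 r) UNIV"
    using has_sum_infsum[OF summ] by simp
qed

text \<open>Used with a sharp bound on finitely many terms and a crude bound on the others, whose
  weights have a small sum.\<close>

lemma sum_split_tail:
  fixes b :: "'i \<Rightarrow> real"
  assumes "finite S" "S1 \<subseteq> S" "\<And>i. i \<in> S1 \<Longrightarrow> b i \<le> b1 i" "\<And>i. i \<in> S - S1 \<Longrightarrow> b i \<le> b2 i"
    and "(\<Sum>i\<in>S - S1. b2 i) \<le> T"
  shows "(\<Sum>i\<in>S. b i) \<le> (\<Sum>i\<in>S1. b1 i) + T"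
proof -
  have "(\<Sum>i\<in>S. b i) = (\<Sum>i\<in>S1. b i) + (\<Sum>i\<in>S - S1. b i)"
    using assms(1,2) by (simp add: sum.subset_diff add.commute)
  also have "\<dots> \<le> (\<Sum>i\<in>S1. b1 i) + (\<Sum>i\<in>S - S1. b2 i)"
    by (intro add_mono sum_mono assms)
  finally show ?thesis using assms(5) by linarith
qed

end

context gabor_lattice
begin

lemma cell_index_dshift: "cell_index d (dshift d s) = s"
  using cell_index_cell_coord[of 0 s] by (simp add: cell_coord_def cell_index_def vec_eq_iff)

text \<open>On the cell s, g is its value at the centre plus an oscillation. Periodised, the
  oscillation moves over to F, so the remainder is again a coefficient against a cell function and
  Bessel's inequality applies to it.\<close>

lemma inner_cell_piece:
  assumes \<mu>: "\<mu> \<in> Lat d" and F: "F \<in> L2" and g: "g \<in> borel_measurable borel"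
    and M: "\<And>t. cmod (g t) \<le> M (cell_index d t)"
  shows "(\<lambda>t. F t * cnj (cell_periodic g s t - g (dshift d s))) \<in> L2" (is "?R \<in> L2")
    and "L2_inner F (tf_shift \<mu> (\<lambda>t. g t * cell_fun s t))
      = cnj (g (dshift d s)) * L2_inner F (tf_shift \<mu> (cell_fun s))
        + L2_inner (\<lambda>t. F t * cnj (cell_periodic g s t - g (dshift d s))) (tf_shift \<mu> (cell_fun s))"
    and "cmod (cell_periodic g s t - g (dshift d s)) \<le> 2 * M s"
proof -
  have b: "cmod (cell_periodic g s t - g (dshift d s)) \<le> 2 * M s" for t
    using norm_triangle_ineq4[of "cell_periodic g s t" "g (dshift d s)"]
      M[of "cell_coord t + dshift d s"] M[of "dshift d s"]
    by (simp add: cell_index_cell_coord cell_index_dshift cell_periodic_def)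
  then show "cmod (cell_periodic g s t - g (dshift d s)) \<le> 2 * M s" .
  have M0: "0 \<le> M s" using order_trans[OF norm_ge_zero M[of "dshift d s"]] by (simp add: cell_index_dshift)
  show R: "?R \<in> L2"
  proof (rule L2_norm_mono(1)[OF _ L2_cmult[OF F, of "of_real (2 * M s)"]])
    have [measurable]: "F \<in> borel_measurable borel" using F by (rule L2_borel)
    have "(\<lambda>t. cell_periodic g s t - g (dshift d s)) \<in> borel_measurable borel"
      using cell_periodic_measurable[OF g, of s] by measurable
    note [measurable] = borel_measurable_cnj[OF this]
    show "?R \<in> borel_measurable borel" by measurable
    fix t
    show "cmod (?R t) \<le> cmod (of_real (2 * M s) * F t)"
      using mult_left_mono[OF b[of t], of "cmod (F t)"] M0
      by (simp only: norm_mult complex_mod_cnj norm_of_real) (simp add: mult.commute)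
  qed
  have U: "tf_shift \<mu> (cell_fun s) \<in> L2" by (intro tf_shift_L2 cell_fun_L2)
  have "L2_inner F (tf_shift \<mu> (\<lambda>t. g t * cell_fun s t))
      = L2_inner (\<lambda>t. cnj (g (dshift d s)) * F t + ?R t) (tf_shift \<mu> (cell_fun s))"
    unfolding L2_inner_def tf_shift_cell_piece[OF \<mu>]
    by (rule Bochner_Integration.integral_cong[OF refl]) (simp add: algebra_simps)
  also have "\<dots> = cnj (g (dshift d s)) * L2_inner F (tf_shift \<mu> (cell_fun s))
        + L2_inner ?R (tf_shift \<mu> (cell_fun s))"
    by (subst L2_inner_add_left[OF L2_cmult[OF F] R U]) (simp add: L2_inner_cmult_left)
  finally show "L2_inner F (tf_shift \<mu> (\<lambda>t. g t * cell_fun s t))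
      = cnj (g (dshift d s)) * L2_inner F (tf_shift \<mu> (cell_fun s))
        + L2_inner ?R (tf_shift \<mu> (cell_fun s))" .
qed

lemma has_sum_tail_bound:
  fixes a :: "'i \<Rightarrow> complex"
  assumes a: "(a has_sum v) UNIV" and A: "\<And>k. cmod (a k) \<le> A k"
    and K: "finite K" and tail: "\<And>Z. finite Z \<Longrightarrow> Z \<subseteq> UNIV - K \<Longrightarrow> sum A Z \<le> e"
  shows "cmod (v - sum a K) \<le> e"
proof (rule tendsto_upperbound)
  show "((\<lambda>Z. cmod (sum a Z - sum a K)) \<longlongrightarrow> cmod (v - sum a K)) (finite_subsets_at_top UNIV)"
    using a unfolding has_sum_def by (intro tendsto_intros)
  show "eventually (\<lambda>Z. cmod (sum a Z - sum a K) \<le> e) (finite_subsets_at_top UNIV)"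
  proof (rule eventually_finite_subsets_at_topI[OF K])
    fix Z :: "'i set" assume Z: "finite Z" "K \<subseteq> Z"
    have "cmod (sum a Z - sum a K) = cmod (sum a (Z - K))" using Z by (simp add: sum_diff K)
    also have "\<dots> \<le> sum A (Z - K)" by (intro sum_norm_le A)
    also have "\<dots> \<le> e" using Z by (intro tail) auto
    finally show "cmod (sum a Z - sum a K) \<le> e" .
  qed simp
qed simp

text \<open>There are three sources of error: the envelope is read at displaced indices instead of
  \<mu>, the Zak series is cut to the cells in S, and g is replaced by its values at the centres.
  Without them every sample multiplies the same w \<mu>, and the samples add up to the Zak
  component.\<close>

lemma coefficient_decomposition:
  assumes X: "finite X" "X \<subseteq> Lat d" and w: "\<forall>\<mu>. \<mu> \<notin> X \<longrightarrow> w \<mu> = 0" and \<mu>: "\<mu> \<in> Lat d"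
    and g: "g \<in> L2" and M: "\<And>t. cmod (g t) \<le> M (cell_index d t)"
    and S: "finite S" and K: "K = {k. r + dmul k \<in> S}"
    and dec: "L2_inner (tf_sum X w (cell_fun r)) (tf_shift \<mu> g)
      = (\<Sum>s\<in>S. L2_inner (tf_sum X w (cell_fun r)) (tf_shift \<mu> (\<lambda>t. g t * cell_fun s t)))"
  shows "L2_inner (tf_sum X w (cell_fun r)) (tf_shift \<mu> g) - of_real covolume * cnj v * w \<mu>
    = (\<Sum>k\<in>K. (of_real covolume * cnj (g (dshift d r + Dhalf d k))) * (w (\<mu> + (Dhalf d k, 0)) - w \<mu>))
      + (- (of_real covolume * cnj (v - (\<Sum>k\<in>K. g (dshift d r + Dhalf d k))))) * w \<mu>
      + (\<Sum>s\<in>S. L2_inner (\<lambda>t. tf_sum X w (cell_fun r) t * cnj (cell_periodic g s t - g (dshift d s)))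
          (tf_shift \<mu> (cell_fun s)))"
    (is "_ = ?T1 + ?T2 + ?T3")
proof -
  let ?F = "tf_sum X w (cell_fun r)"
  let ?a = "\<lambda>k. g (dshift d r + Dhalf d k)"
  have F: "?F \<in> L2" by (intro tf_sum_L2 cell_fun_L2)
  have inj: "inj_on (\<lambda>k. r + dmul k) K" by (auto intro!: inj_onI dest: dmul_inj)
  have Kfin: "finite K"
    unfolding K using finite_vimageI[OF S, of "\<lambda>k. r + dmul k"]
    by (simp add: vimage_def inj_def) (metis dmul_inj)
  have "(\<Sum>s\<in>S. cnj (g (dshift d s)) * L2_inner ?F (tf_shift \<mu> (cell_fun s)))
      = (\<Sum>s\<in>(\<lambda>k. r + dmul k) ` K. cnj (g (dshift d s)) * L2_inner ?F (tf_shift \<mu> (cell_fun s)))"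
  proof (rule sum.mono_neutral_right[OF S])
    show "\<forall>s\<in>S - (\<lambda>k. r + dmul k) ` K. cnj (g (dshift d s)) * L2_inner ?F (tf_shift \<mu> (cell_fun s)) = 0"
    proof
      fix s assume s: "s \<in> S - (\<lambda>k. r + dmul k) ` K"
      then have "\<nexists>k. s = r + dmul k" unfolding K by blast
      from inner_cell_shift(2)[OF X w \<mu> this]
      show "cnj (g (dshift d s)) * L2_inner ?F (tf_shift \<mu> (cell_fun s)) = 0" by simp
    qed
  qed (auto simp: K)
  also have "\<dots> = (\<Sum>k\<in>K. cnj (?a k) * (of_real covolume * w (\<mu> + (Dhalf d k, 0))))"
    by (subst sum.reindex[OF inj])
      (simp add: inner_cell_shift(1)[OF X w \<mu>] dshift_add dshift_dmul)
  finally have main: "L2_inner ?F (tf_shift \<mu> g)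
      = (\<Sum>k\<in>K. cnj (?a k) * (of_real covolume * w (\<mu> + (Dhalf d k, 0)))) + ?T3"
    unfolding dec inner_cell_piece(2)[OF \<mu> F L2_borel[OF g] M] sum.distrib by simp
  have "?T1 + ?T2 = (\<Sum>k\<in>K. cnj (?a k) * (of_real covolume * w (\<mu> + (Dhalf d k, 0)))) - of_real covolume * cnj v * w \<mu>"
    by (simp add: right_diff_distrib left_diff_distrib sum_subtractf sum_distrib_left sum_distrib_right mult_ac)
  with main show ?thesis by simp
qed

text \<open>N and C depend on the window, the residue and \<eta>, but not on X, w or Y. This
  uniformity allows first the truncation of the envelope to be removed and then the envelope itself
  to vary.\<close>

lemma coefficient_asymptotics:
  assumes g: "continuous_on UNIV g" "g \<in> L2"
    and M: "M summable_on UNIV" "\<And>t. cmod (g t) \<le> M (cell_index d t)"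
    and r: "r \<in> Zd d" and \<eta>: "\<eta> > 0"
  obtains N C where "finite N" "N \<subseteq> Lat d" "C \<ge> 0"
    "\<And>X w Y. finite X \<Longrightarrow> X \<subseteq> Lat d \<Longrightarrow> \<forall>\<mu>. \<mu> \<notin> X \<longrightarrow> w \<mu> = 0 \<Longrightarrow> finite Y \<Longrightarrow> Y \<subseteq> Lat d \<Longrightarrow>
      L2_set (\<lambda>\<mu>. cmod (L2_inner (tf_sum X w (cell_fun r)) (tf_shift \<mu> g)
          - of_real covolume * cnj (Zak_vec d g 0 0 r) * w \<mu>)) Y
      \<le> \<eta> * ell2_norm d w + C * (\<Sum>\<nu>\<in>N. shift_diff \<nu> w)"
proof -
  note \<kappa> = covolume_pos
  \<comment> \<open>The three error terms contribute 2, 1 and 3 times covolume * e * norm.\<close>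
  define e where "e = \<eta> / (6 * covolume)"
  have e: "e > 0" using \<eta> \<kappa> by (simp add: e_def)
  define A where "A k = M (r + dmul k)" for k
  note Z = Zak_vec_has_sum[OF M r]
  have M0: "0 \<le> M s" for s
    using order_trans[OF norm_ge_zero M(2)[of "dshift d s"]] by (simp add: cell_index_dshift)
  obtain S1 where S1: "finite S1" "S1 \<subseteq> UNIV"
    "\<And>Z. finite Z \<Longrightarrow> Z \<subseteq> UNIV - S1 \<Longrightarrow> sum M Z \<le> e"
    by (rule summable_on_small_tail[OF M(1) M0 e]) (rule that)
  have Asum: "A summable_on UNIV" unfolding A_def by (rule Z(2))
  have A0: "0 \<le> A k" for k by (simp add: A_def M0)
  obtain K0 where K0: "finite K0" "K0 \<subseteq> UNIV"
    "\<And>Z. finite Z \<Longrightarrow> Z \<subseteq> UNIV - K0 \<Longrightarrow> sum A Z \<le> e"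
    by (rule summable_on_small_tail[OF Asum A0 e]) (rule that)
  define e1 where "e1 = e / (real (card S1) + 1)"
  have e1: "e1 > 0" using e by (simp add: e1_def add_nonneg_pos)
  have e1S: "real (card S1) * e1 \<le> e"
    using e by (simp add: e1_def divide_le_eq mult.commute[of e] add_nonneg_pos mult_right_mono)
  have "\<forall>s. \<exists>C\<ge>0. \<forall>t. cmod (cell_periodic g s t - g (dshift d s))
      \<le> e1 + C * (\<Sum>j\<in>UNIV. cmod (lattice_char j t - 1))"
    using cell_periodic_modulus[OF g(1) M(2) e1] by metis
  then obtain Cs where Cs: "\<And>s. Cs s \<ge> 0" "\<And>s t. cmod (cell_periodic g s t - g (dshift d s))
      \<le> e1 + Cs s * (\<Sum>j\<in>UNIV. cmod (lattice_char j t - 1))"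
    by metis
  \<comment> \<open>Time shifts along the leading terms of the Zak series, together with the
    frequency shifts that realise the lattice characters.\<close>
  define N where "N = (\<lambda>k. (- Dhalf d k, 0)) ` K0 \<union> range unit_mod"
  define C where "C = covolume * (\<Sum>k\<in>K0. A k) + covolume * ((\<Sum>s\<in>S1. Cs s) * real CARD('n))"
  have N: "finite N" unfolding N_def using K0(1) by simp
  have shiftLat: "(- Dhalf d k, 0) \<in> Lat d" for k
    unfolding Lat_iff by (metis Dhalf_uminus Dhalf_zero)
  have NL: "N \<subseteq> Lat d" unfolding N_def using unit_mod_Lat shiftLat by auto
  have C: "C \<ge> 0" unfolding C_def
    using \<kappa> A0 Cs(1) by (intro add_nonneg_nonneg mult_nonneg_nonneg sum_nonneg) auto
  show thesis
  proof (rule that[OF N NL C])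
    fix X Y :: "((real^'n) \<times> (real^'n)) set" and w :: "(real^'n) \<times> (real^'n) \<Rightarrow> complex"
    assume X: "finite X" "X \<subseteq> Lat d" and w: "\<forall>\<mu>. \<mu> \<notin> X \<longrightarrow> w \<mu> = 0" and Y: "finite Y" "Y \<subseteq> Lat d"
    let ?F = "tf_sum X w (cell_fun r)"
    let ?v = "Zak_vec d g 0 0 r"
    let ?a = "\<lambda>k. g (dshift d r + Dhalf d k)"
    let ?q = "\<lambda>s t. cell_periodic g s t - g (dshift d s)"
    define n where "n = ell2_norm d w"
    define D where "D = (\<Sum>\<nu>\<in>N. shift_diff \<nu> w)"
    have n0: "n \<ge> 0" by (simp add: n_def ell2_norm_nonneg)
    have D0: "D \<ge> 0" unfolding D_def by (intro sum_nonneg shift_diff_nonneg)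
    have sdN: "shift_diff \<nu> w \<le> D" if "\<nu> \<in> N" for \<nu>
      unfolding D_def using N that by (intro member_le_sum) (auto simp: shift_diff_nonneg)
    have wl: "ell2 d w" using ell2_finite_support(1)[where w = w, OF X w] .
    have F: "?F \<in> L2" by (intro tf_sum_L2 cell_fun_L2)
    obtain S0 where S0: "finite S0" "\<And>S \<mu>. finite S \<Longrightarrow> S0 \<subseteq> S \<Longrightarrow> \<mu> \<in> Y \<Longrightarrow>
        L2_inner ?F (tf_shift \<mu> g) = (\<Sum>s\<in>S. L2_inner ?F (tf_shift \<mu> (\<lambda>t. g t * cell_fun s t)))"
      by (rule inner_cell_decomposition[OF X Y g(2), of w r]) (rule that)
    \<comment> \<open>\<open>S0\<close> makes the expansion over cells exact. Including
      \<open>S1\<close> and the cells of \<open>K0\<close> leaves outside them only terms whose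
      majorants have a small sum.\<close>
    define S where "S = S0 \<union> S1 \<union> (\<lambda>k. r + dmul k) ` K0"
    define K where "K = {k. r + dmul k \<in> S}"
    have S: "finite S" "S0 \<subseteq> S" "S1 \<subseteq> S" using S0 S1 K0 by (auto simp: S_def)
    have K: "finite K" "K0 \<subseteq> K"
      unfolding K_def using finite_vimageI[OF S(1), of "\<lambda>k. r + dmul k"]
      by (simp_all add: vimage_def inj_def) (metis dmul_inj, auto simp: S_def)
    let ?T1 = "\<lambda>\<mu>. \<Sum>k\<in>K. (of_real covolume * cnj (?a k)) * (w (\<mu> + (Dhalf d k, 0)) - w \<mu>)"
    let ?T2 = "\<lambda>\<mu>. (- (of_real covolume * cnj (?v - (\<Sum>k\<in>K. ?a k)))) * w \<mu>"
    let ?T3 = "\<lambda>\<mu>. \<Sum>s\<in>S. L2_inner (\<lambda>t. ?F t * cnj (?q s t)) (tf_shift \<mu> (cell_fun s))"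
    have T1: "L2_set (\<lambda>\<mu>. cmod (?T1 \<mu>)) Y \<le> covolume * (\<Sum>k\<in>K0. A k) * D + 2 * covolume * e * n"
    proof -
      have "L2_set (\<lambda>\<mu>. cmod (?T1 \<mu>)) Y
          \<le> (\<Sum>k\<in>K. L2_set (\<lambda>\<mu>. cmod ((of_real covolume * cnj (?a k)) * (w (\<mu> + (Dhalf d k, 0)) - w \<mu>))) Y)"
        by (rule L2_set_norm_sum)
      also have "\<dots> \<le> (\<Sum>k\<in>K. covolume * A k * shift_diff (- Dhalf d k, 0) w)"
      proof (rule sum_mono)
        fix k
        have "L2_set (\<lambda>\<mu>. cmod (w (\<mu> + (Dhalf d k, 0)) - w \<mu>)) Y \<le> shift_diff (- Dhalf d k, 0) w"
        proof -
          have shift: "\<mu> - (- Dhalf d k, 0) = \<mu> + (Dhalf d k, 0)" for \<mu> :: "(real^'n) \<times> (real^'n)"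
            by (rule prod_eqI) simp_all
          from L2_set_le_ell2_norm[OF ell2_norm_diff(1)[OF ell2_shift(1)[OF shiftLat[of k] wl] wl] Y]
          show ?thesis unfolding shift_diff_def shift .
        qed
        then have "cmod (of_real covolume * cnj (?a k)) * L2_set (\<lambda>\<mu>. cmod (w (\<mu> + (Dhalf d k, 0)) - w \<mu>)) Y
            \<le> (covolume * A k) * shift_diff (- Dhalf d k, 0) w"
        proof (intro mult_mono)
          show "cmod (of_real covolume * cnj (?a k)) \<le> covolume * A k"
            unfolding norm_mult complex_mod_cnj A_def using \<kappa> Z(3)[of k] by simp
          show "0 \<le> covolume * A k" using \<kappa> A0[of k] by simp
        qed simp_all
        then show "L2_set (\<lambda>\<mu>. cmod ((of_real covolume * cnj (?a k)) * (w (\<mu> + (Dhalf d k, 0)) - w \<mu>))) Y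
            \<le> covolume * A k * shift_diff (- Dhalf d k, 0) w"
          unfolding L2_set_norm_cmult .
      qed
      also have "\<dots> \<le> (\<Sum>k\<in>K0. covolume * A k * D) + 2 * covolume * e * n"
      \<comment> \<open>On \<open>K0\<close> the shifts belong to \<open>N\<close>. Elsewhere only
        the trivial bound \<open>shift_diff_le\<close> is at hand, and the small sum of the
        majorants pays for it.\<close>
      proof (rule sum_split_tail[OF K])
        show "covolume * A k * shift_diff (- Dhalf d k, 0) w \<le> covolume * A k * D" if "k \<in> K0" for k
          using \<kappa> A0[of k] that by (intro mult_left_mono sdN) (auto simp: N_def)
        show "covolume * A k * shift_diff (- Dhalf d k, 0) w \<le> (2 * covolume * n) * A k" for k
        proof -
          have "covolume * A k * shift_diff (- Dhalf d k, 0) w \<le> covolume * A k * (2 * n)"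
            using \<kappa> A0[of k] shift_diff_le[OF shiftLat[of k] wl]
            by (intro mult_left_mono) (auto simp: n_def)
          then show ?thesis by (simp add: mult_ac)
        qed
        have "(2 * covolume * n) * (\<Sum>k\<in>K - K0. A k) \<le> (2 * covolume * n) * e"
          using K0(3)[of "K - K0"] K \<kappa> n0 by (intro mult_left_mono) auto
        then show "(\<Sum>k\<in>K - K0. (2 * covolume * n) * A k) \<le> 2 * covolume * e * n"
          unfolding sum_distrib_left by (simp add: mult_ac)
      qed
      finally show ?thesis by (simp add: sum_distrib_left sum_distrib_right mult_ac)
    qed
    have T2: "L2_set (\<lambda>\<mu>. cmod (?T2 \<mu>)) Y \<le> covolume * e * n"
    proof -
      have tail: "cmod (?v - (\<Sum>k\<in>K. ?a k)) \<le> e"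
      proof (rule has_sum_tail_bound[OF Z(1) _ K(1), where A = A])
        show "cmod (?a k) \<le> A k" for k unfolding A_def by (rule Z(3))
        show "sum A Z \<le> e" if "finite Z" "Z \<subseteq> UNIV - K" for Z
          using that K(2) by (intro K0(3)) auto
      qed
      have "L2_set (\<lambda>\<mu>. cmod (?T2 \<mu>)) Y
          = (covolume * cmod (?v - (\<Sum>k\<in>K. ?a k))) * L2_set (\<lambda>\<mu>. cmod (w \<mu>)) Y"
        unfolding L2_set_norm_cmult
        using \<kappa> by (simp only: norm_minus_cancel norm_mult complex_mod_cnj norm_of_real abs_of_pos)
      also have "\<dots> \<le> (covolume * e) * n"
        using \<kappa> e tail L2_set_le_ell2_norm[OF wl Y]
        by (intro mult_mono mult_left_mono) (auto simp: n_def)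
      finally show ?thesis .
    qed
    have T3: "L2_set (\<lambda>\<mu>. cmod (?T3 \<mu>)) Y
        \<le> covolume * (e * n + ((\<Sum>s\<in>S1. Cs s) * real CARD('n)) * D) + 2 * covolume * e * n"
    proof -
      let ?R = "\<lambda>s t. ?F t * cnj (?q s t)"
      have R: "?R s \<in> L2" for s
        by (rule inner_cell_piece(1)[OF Lat_add[OF unit_mod_Lat unit_mod_Lat] F L2_borel[OF g(2)] M(2)])
      have q: "?q s \<in> borel_measurable borel" for s
        using cell_periodic_measurable[OF L2_borel[OF g(2)], of s] by measurable
      have sds: "(\<Sum>j\<in>UNIV. shift_diff (unit_mod j) w) \<le> real CARD('n) * D"
        using sum_mono[of "UNIV::'n set" "\<lambda>j. shift_diff (unit_mod j) w" "\<lambda>j. D"] sdN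
        by (auto simp: N_def)
      have "L2_set (\<lambda>\<mu>. cmod (?T3 \<mu>)) Y \<le> (\<Sum>s\<in>S. L2_set (\<lambda>\<mu>. cmod (L2_inner (?R s) (tf_shift \<mu> (cell_fun s)))) Y)"
        by (rule L2_set_norm_sum)
      \<comment> \<open>Bessel's inequality cell by cell: for fixed s the functions
        \<open>tf_shift \<mu> (cell_fun s)\<close> are orthogonal.\<close>
      also have "\<dots> \<le> (\<Sum>s\<in>S. sqrt covolume * L2_norm (?R s))"
        by (intro sum_mono bessel_inequality Y tf_shift_L2 cell_fun_L2 R \<kappa> cell_orthonormal subsetD[OF Y(2)])
      also have "\<dots> \<le> (\<Sum>s\<in>S1. covolume * (e1 * n + Cs s * (real CARD('n) * D))) + 2 * covolume * e * n"
      proof (rule sum_split_tail[OF S(1,3)])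
        have sq: "sqrt covolume * (sqrt covolume * x) = covolume * x" for x
          using \<kappa> by (simp add: mult.assoc[symmetric])
        fix s
        have "L2_norm (?R s) \<le> sqrt covolume * (e1 * ell2_norm d w + Cs s * (\<Sum>j\<in>UNIV. shift_diff (unit_mod j) w))"
          by (rule cell_remainder_small[OF X w q less_imp_le[OF e1] Cs])
        also have "\<dots> \<le> sqrt covolume * (e1 * n + Cs s * (real CARD('n) * D))"
          unfolding n_def using \<kappa> by (intro mult_left_mono[OF add_left_mono] mult_left_mono[OF sds] Cs(1)) auto
        finally have "sqrt covolume * L2_norm (?R s) \<le> sqrt covolume * (sqrt covolume * (e1 * n + Cs s * (real CARD('n) * D)))"
          using \<kappa> by (intro mult_left_mono) auto
        then show "sqrt covolume * L2_norm (?R s) \<le> covolume * (e1 * n + Cs s * (real CARD('n) * D))"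
          unfolding sq .
        \<comment> \<open>This bound ignores localisation and uses only the supremum of the
          oscillation; it serves outside \<open>S1\<close>.\<close>
        have "L2_norm (?R s) \<le> sqrt covolume * (2 * M s * ell2_norm d w + 0 * (\<Sum>j\<in>UNIV. shift_diff (unit_mod j) w))"
          by (rule cell_remainder_small[OF X w q])
            (use M0[of s] inner_cell_piece(3)[OF unit_mod_Lat F L2_borel[OF g(2)] M(2), of s] in auto)
        then have "sqrt covolume * L2_norm (?R s) \<le> sqrt covolume * (sqrt covolume * (2 * M s * n))"
          using \<kappa> by (intro mult_left_mono) (auto simp: n_def)
        then show "sqrt covolume * L2_norm (?R s) \<le> (2 * covolume * n) * M s"
          unfolding sq by (simp add: mult_ac)
      next
        have "(2 * covolume * n) * (\<Sum>s\<in>S - S1. M s) \<le> (2 * covolume * n) * e"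
          using S1(3)[of "S - S1"] S \<kappa> n0 by (intro mult_left_mono) auto
        then show "(\<Sum>s\<in>S - S1. (2 * covolume * n) * M s) \<le> 2 * covolume * e * n"
          unfolding sum_distrib_left by (simp add: mult_ac)
      qed
      also have "(\<Sum>s\<in>S1. covolume * (e1 * n + Cs s * (real CARD('n) * D)))
          = covolume * ((real (card S1) * e1) * n + ((\<Sum>s\<in>S1. Cs s) * real CARD('n)) * D)"
        by (simp add: sum_distrib_left[symmetric] sum_distrib_right sum.distrib mult_ac)
      also have "\<dots> \<le> covolume * (e * n + ((\<Sum>s\<in>S1. Cs s) * real CARD('n)) * D)"
        using \<kappa> e1S n0 by (intro mult_left_mono[OF add_right_mono] mult_right_mono) auto
      finally show ?thesis by simp
    qed
    have "L2_set (\<lambda>\<mu>. cmod (L2_inner ?F (tf_shift \<mu> g) - of_real covolume * cnj ?v * w \<mu>)) Y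
        = L2_set (\<lambda>\<mu>. cmod (?T1 \<mu> + ?T2 \<mu> + ?T3 \<mu>)) Y"
    proof (intro L2_set_cong refl arg_cong[where f = cmod])
      fix \<mu> assume \<mu>: "\<mu> \<in> Y"
      show "L2_inner ?F (tf_shift \<mu> g) - of_real covolume * cnj ?v * w \<mu> = ?T1 \<mu> + ?T2 \<mu> + ?T3 \<mu>"
        by (rule coefficient_decomposition[OF X w subsetD[OF Y(2) \<mu>] g(2) M(2) S(1) K_def S0(2)[OF S(1,2) \<mu>]])
    qed
    also have "\<dots> \<le> L2_set (\<lambda>\<mu>. cmod (?T1 \<mu>)) Y + L2_set (\<lambda>\<mu>. cmod (?T2 \<mu>)) Y + L2_set (\<lambda>\<mu>. cmod (?T3 \<mu>)) Y"
      using L2_set_norm_triangle[of "\<lambda>\<mu>. ?T1 \<mu> + ?T2 \<mu>" ?T3 Y] L2_set_norm_triangle[of ?T1 ?T2 Y] by linarith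
    also have "\<dots> \<le> 6 * covolume * e * n + C * D"
      using T1 T2 T3 unfolding C_def by (simp add: algebra_simps)
    also have "6 * covolume * e = \<eta>" using \<kappa> by (simp add: e_def)
    finally show "L2_set (\<lambda>\<mu>. cmod (L2_inner ?F (tf_shift \<mu> g) - of_real covolume * cnj ?v * w \<mu>)) Y
        \<le> \<eta> * ell2_norm d w + C * (\<Sum>\<nu>\<in>N. shift_diff \<nu> w)"
      unfolding n_def D_def .
  qed
qed

end

section \<open>Superpositions of the dual windows\<close>

lemma L2_set_product_le:
  fixes f :: "'a \<times> 'b \<Rightarrow> real"
  assumes Z: "finite Z" "Z \<subseteq> Y \<times> R" and fin: "finite Y" "finite R"
    and le: "\<And>r. r \<in> R \<Longrightarrow> L2_set (\<lambda>\<mu>. f (\<mu>, r)) Y \<le> E r"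
  shows "L2_set f Z \<le> (\<Sum>r\<in>R. E r)"
proof -
  have "L2_set f Z \<le> L2_set f (Y \<times> R)"
    unfolding L2_set_def using Z fin by (intro real_sqrt_le_mono sum_mono2) auto
  also have "\<dots> = L2_set (\<lambda>r. L2_set (\<lambda>\<mu>. f (\<mu>, r)) Y) R"
  proof -
    have "(\<Sum>i\<in>Y \<times> R. (f i)\<^sup>2) = (\<Sum>\<mu>\<in>Y. \<Sum>r\<in>R. (f (\<mu>, r))\<^sup>2)"
      by (simp add: sum.cartesian_product)
    also have "\<dots> = (\<Sum>r\<in>R. \<Sum>\<mu>\<in>Y. (f (\<mu>, r))\<^sup>2)" by (rule sum.swap)
    finally show ?thesis by (simp add: L2_set_def sum_nonneg)
  qed
  also have "\<dots> \<le> (\<Sum>r\<in>R. L2_set (\<lambda>\<mu>. f (\<mu>, r)) Y)"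
    by (rule L2_set_le_sum) simp
  also have "\<dots> \<le> (\<Sum>r\<in>R. E r)" by (intro sum_mono le)
  finally show ?thesis .
qed

lemma has_sum_finite_sum:
  fixes f :: "'j \<Rightarrow> 'i \<Rightarrow> 'b::topological_comm_monoid_add"
  assumes "\<And>j. j \<in> J \<Longrightarrow> (f j has_sum s j) I"
  shows "((\<lambda>i. \<Sum>j\<in>J. f j i) has_sum (\<Sum>j\<in>J. s j)) I"
  using assms
  by (induction J rule: infinite_finite_induct) (auto intro: has_sum_add)

lemma has_sum_diff:
  fixes f h :: "'i \<Rightarrow> 'b::real_normed_vector"
  assumes "(f has_sum a) I" "(h has_sum b) I"
  shows "((\<lambda>i. f i - h i) has_sum (a - b)) I"
proof -
  have "((\<lambda>i. - h i) has_sum - b) I" using assms(2) by (simp add: has_sum_uminus)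
  from has_sum_add[OF assms(1) this] show ?thesis by simp
qed

lemma norm_has_sum_bound:
  fixes f :: "'i \<Rightarrow> complex"
  assumes "(f has_sum S) I" "\<And>Z. finite Z \<Longrightarrow> Z \<subseteq> I \<Longrightarrow> cmod (sum f Z) \<le> K"
  shows "cmod S \<le> K"
proof (rule tendsto_upperbound)
  show "((\<lambda>Z. cmod (sum f Z)) \<longlongrightarrow> cmod S) (finite_subsets_at_top I)"
    using assms(1) unfolding has_sum_def by (intro tendsto_intros)
  show "eventually (\<lambda>Z. cmod (sum f Z) \<le> K) (finite_subsets_at_top I)"
    by (rule eventually_finite_subsets_at_topI[of "{}"]) (use assms(2) in auto)
qed simp

text \<open>Collects what the argument takes from the hypotheses: membership of the windows in M1 is
  represented by continuity and a summable majorant, and the frame inequalities are written with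
  \<open>tf_shift\<close>, as \<open>rho_coefficient\<close> permits.\<close>

locale gabor_frame_dual = gabor_lattice d for d :: "'n::finite \<Rightarrow> nat" +
  fixes m :: nat and g \<gamma> :: "nat \<Rightarrow> real^'n \<Rightarrow> complex" and A B :: real
  assumes g_L2: "\<And>j. j \<in> {1..m} \<Longrightarrow> g j \<in> L2"
    and g_cont: "\<And>j. j \<in> {1..m} \<Longrightarrow> continuous_on UNIV (g j)"
    and g_majorant: "\<And>j. j \<in> {1..m} \<Longrightarrow>
      \<exists>M. M summable_on UNIV \<and> (\<forall>t. cmod (g j t) \<le> M (cell_index d t))"
    and A_pos: "A > 0" and B_pos: "B > 0"
    and frame_summable: "\<And>f. f \<in> L2 \<Longrightarrow>
      (\<lambda>i. (cmod (L2_inner f (tf_shift (fst i) (g (snd i)))))\<^sup>2) summable_on (Lat d \<times> {1..m})"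
    and frame_lower: "\<And>f. f \<in> L2 \<Longrightarrow> A * (L2_norm f)\<^sup>2
      \<le> (\<Sum>\<^sub>\<infinity>i\<in>Lat d \<times> {1..m}. (cmod (L2_inner f (tf_shift (fst i) (g (snd i)))))\<^sup>2)"
    and frame_upper: "\<And>f. f \<in> L2 \<Longrightarrow>
      (\<Sum>\<^sub>\<infinity>i\<in>Lat d \<times> {1..m}. (cmod (L2_inner f (tf_shift (fst i) (g (snd i)))))\<^sup>2) \<le> B * (L2_norm f)\<^sup>2"
    and \<gamma>_L2: "\<And>j. j \<in> {1..m} \<Longrightarrow> \<gamma> j \<in> L2"
    and \<gamma>_dual: "\<And>j. j \<in> {1..m} \<Longrightarrow> AE t in lborel. frame_op d m g (\<gamma> j) t = g j t"
begin

section \<open>The frame operator and duality in weak form\<close>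

definition frame_elem :: "((real^'n) \<times> (real^'n)) \<times> nat \<Rightarrow> real^'n \<Rightarrow> complex" where
  "frame_elem i = tf_shift (fst i) (g (snd i))"

definition frame_index :: "(((real^'n) \<times> (real^'n)) \<times> nat) set" where
  "frame_index = Lat d \<times> {1..m}"

lemma frame_elem_L2: "i \<in> frame_index \<Longrightarrow> frame_elem i \<in> L2"
  by (auto simp: frame_index_def frame_elem_def intro!: tf_shift_L2 g_L2)

lemma analysis_bound:
  assumes f: "f \<in> L2" and Z: "finite Z" "Z \<subseteq> frame_index"
  shows "L2_set (\<lambda>i. cmod (L2_inner f (frame_elem i))) Z \<le> sqrt B * L2_norm f"
proof -
  have "(\<Sum>i\<in>Z. (cmod (L2_inner f (frame_elem i)))\<^sup>2) \<le> B * (L2_norm f)\<^sup>2"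
    using finite_sum_le_infsum[OF frame_summable[OF f] Z(1)] Z(2) frame_upper[OF f]
    unfolding frame_elem_def frame_index_def by (auto intro: order_trans)
  then have "L2_set (\<lambda>i. cmod (L2_inner f (frame_elem i))) Z \<le> sqrt (B * (L2_norm f)\<^sup>2)"
    unfolding L2_set_def by (rule real_sqrt_le_mono)
  then show ?thesis by (simp add: real_sqrt_mult L2_norm_nonneg)
qed

lemma cmod_sum_Cauchy_Schwarz:
  "cmod (\<Sum>i\<in>Z. a i * b i) \<le> L2_set (\<lambda>i. cmod (a i)) Z * L2_set (\<lambda>i. cmod (b i)) Z"
proof -
  have "cmod (\<Sum>i\<in>Z. a i * b i) \<le> (\<Sum>i\<in>Z. \<bar>cmod (a i)\<bar> * \<bar>cmod (b i)\<bar>)"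
    by (rule order_trans[OF norm_sum]) (simp add: norm_mult)
  also have "\<dots> \<le> L2_set (\<lambda>i. cmod (a i)) Z * L2_set (\<lambda>i. cmod (b i)) Z" by (rule L2_set_mult_ineq)
  finally show ?thesis .
qed

text \<open>Synthesis is the adjoint of analysis: pairing the sum with itself brings in its own
  frame coefficients, which \<open>analysis_bound\<close> controls, and one factor of the norm
  cancels.\<close>

lemma synthesis_bound:
  assumes Z: "finite Z" "Z \<subseteq> frame_index"
  shows "L2_norm (\<lambda>t. \<Sum>i\<in>Z. a i * frame_elem i t) \<le> sqrt B * L2_set (\<lambda>i. cmod (a i)) Z"
proof -
  let ?z = "\<lambda>t. \<Sum>i\<in>Z. a i * frame_elem i t"
  have e: "i \<in> Z \<Longrightarrow> frame_elem i \<in> L2" for i using Z frame_elem_L2 by blast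
  have z: "?z \<in> L2" by (intro L2_finite_sum L2_cmult e)
  have "(L2_norm ?z)\<^sup>2 = cmod (L2_inner ?z ?z)"
    unfolding L2_inner_self norm_of_real by simp
  also have "L2_inner ?z ?z = (\<Sum>i\<in>Z. a i * L2_inner (frame_elem i) ?z)"
    using e z by (subst L2_inner_sum_left) (auto intro: L2_cmult simp: L2_inner_cmult_left)
  also have "cmod \<dots> \<le> L2_set (\<lambda>i. cmod (a i)) Z * L2_set (\<lambda>i. cmod (L2_inner (frame_elem i) ?z)) Z"
    by (rule cmod_sum_Cauchy_Schwarz)
  also have "(\<lambda>i. cmod (L2_inner (frame_elem i) ?z)) = (\<lambda>i. cmod (L2_inner ?z (frame_elem i)))"
    by (subst L2_inner_sym) simp
  also have "L2_set (\<lambda>i. cmod (a i)) Z * L2_set (\<lambda>i. cmod (L2_inner ?z (frame_elem i))) Z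
      \<le> L2_set (\<lambda>i. cmod (a i)) Z * (sqrt B * L2_norm ?z)"
    by (intro mult_left_mono analysis_bound z Z) simp
  finally have le: "L2_norm ?z * L2_norm ?z \<le> (sqrt B * L2_set (\<lambda>i. cmod (a i)) Z) * L2_norm ?z"
    by (simp add: power2_eq_square mult_ac)
  show ?thesis
  proof (cases "L2_norm ?z = 0")
    case True
    then show ?thesis using B_pos by simp
  next
    case False
    then have "L2_norm ?z > 0" using L2_norm_nonneg[of ?z] by linarith
    with le show ?thesis by (rule mult_right_le_imp_le)
  qed
qed

text \<open>\<open>frame_op\<close> is a chosen limit and carries information only once convergence
  is known; the required Bessel bound is \<open>synthesis_bound\<close>.\<close>

lemma frame_op_has_sum:
  assumes f: "f \<in> L2"
  shows "L2_has_sum (\<lambda>i t. L2_inner f (frame_elem i) * frame_elem i t) frame_index (frame_op d m g f)"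
proof -
  have eq: "(\<lambda>(\<mu>, j) t. L2_inner f (rho \<mu> (g j)) * rho \<mu> (g j) t)
      = (\<lambda>i t. L2_inner f (frame_elem i) * frame_elem i t)"
    by (simp add: fun_eq_iff frame_elem_def rho_coefficient(1))
  have "\<exists>F. L2_has_sum (\<lambda>i t. L2_inner f (frame_elem i) * frame_elem i t) frame_index F"
  proof (rule L2_has_sum_bessel[OF frame_elem_L2 synthesis_bound])
    show "(\<lambda>i. (cmod (L2_inner f (frame_elem i)))\<^sup>2) summable_on frame_index"
      using frame_summable[OF f] by (simp add: frame_elem_def frame_index_def)
  qed auto
  from L2_has_sum_L2_sum[OF this] show ?thesis
    unfolding frame_op_def eq frame_index_def .
qed

text \<open>The weak form of S (\<gamma> j) = g j. The equation holds only almost everywhere, which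
  is enough after pairing with y.\<close>

lemma dual_has_sum:
  assumes j: "j \<in> {1..m}" and y: "y \<in> L2"
  shows "((\<lambda>i. L2_inner (\<gamma> j) (frame_elem i) * cnj (L2_inner y (frame_elem i))) has_sum L2_inner (g j) y) frame_index"
proof -
  note s = frame_op_has_sum[OF \<gamma>_L2[OF j]]
  have "L2_inner (frame_op d m g (\<gamma> j)) y = L2_inner (g j) y"
    by (rule L2_inner_cong_AE[OF _ g_L2[OF j] y \<gamma>_dual[OF j]]) (use s in \<open>simp add: L2_has_sum_def\<close>)
  moreover have "(\<lambda>i. L2_inner (\<lambda>t. L2_inner (\<gamma> j) (frame_elem i) * frame_elem i t) y)
      = (\<lambda>i. L2_inner (\<gamma> j) (frame_elem i) * cnj (L2_inner y (frame_elem i)))"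
    unfolding L2_inner_cmult_left by (subst (2) L2_inner_sym) (rule refl)
  ultimately show ?thesis using L2_has_sum_tendsto_inner[OF s y] by simp
qed

text \<open>The frame operator commutes with lattice shifts. In weak form this means moving the
  shift onto y and reindexing the frame by \<nu>.\<close>

lemma dual_shift_has_sum:
  assumes j: "j \<in> {1..m}" and y: "y \<in> L2" and \<nu>: "\<nu> \<in> Lat d"
  shows "((\<lambda>i. L2_inner (tf_shift \<nu> (\<gamma> j)) (frame_elem i) * cnj (L2_inner y (frame_elem i)))
    has_sum L2_inner (tf_shift \<nu> (g j)) y) frame_index"
proof -
  let ?y = "tf_shift (- \<nu>) y"
  let ?s = "\<lambda>i::((real^'n) \<times> (real^'n)) \<times> nat. (\<nu> + fst i, snd i)"
  have bij: "bij_betw ?s frame_index frame_index"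
    by (rule bij_betw_byWitness[where f' = "\<lambda>i. (fst i - \<nu>, snd i)"])
      (use Lat_add[OF \<nu>] Lat_diff[OF _ \<nu>] in \<open>auto simp: frame_index_def\<close>)
  have "((\<lambda>i. L2_inner (\<gamma> j) (frame_elem i) * cnj (L2_inner ?y (frame_elem i))) has_sum L2_inner (g j) ?y) frame_index"
    by (intro dual_has_sum j tf_shift_L2 y)
  also have "L2_inner (g j) ?y = L2_inner (tf_shift \<nu> (g j)) y"
    by (rule tf_shift_adjoint[OF \<nu> g_L2[OF j] y, symmetric])
  finally have "((\<lambda>i. L2_inner (tf_shift \<nu> (\<gamma> j)) (frame_elem (?s i)) * cnj (L2_inner y (frame_elem (?s i))))
      has_sum L2_inner (tf_shift \<nu> (g j)) y) frame_index"
  proof (rule has_sum_cong[THEN iffD1, rotated])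
    fix i assume i: "i \<in> frame_index"
    have \<mu>: "fst i \<in> Lat d" using i by (auto simp: frame_index_def)
    have e: "frame_elem (?s i) = tf_shift \<nu> (frame_elem i)"
      by (simp add: frame_elem_def tf_shift_add[OF \<nu> \<mu>])
    have "L2_inner ?y (frame_elem i) = L2_inner y (frame_elem (?s i))"
      unfolding e using tf_shift_adjoint[OF Lat_uminus[OF \<nu>] y frame_elem_L2[OF i]] by simp
    moreover have "L2_inner (\<gamma> j) (frame_elem i) = L2_inner (tf_shift \<nu> (\<gamma> j)) (frame_elem (?s i))"
      unfolding e by (rule tf_shift_inner[OF \<gamma>_L2[OF j] frame_elem_L2[OF i], symmetric])
    ultimately show "L2_inner (\<gamma> j) (frame_elem i) * cnj (L2_inner ?y (frame_elem i))
        = L2_inner (tf_shift \<nu> (\<gamma> j)) (frame_elem (?s i)) * cnj (L2_inner y (frame_elem (?s i)))"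
      by simp
  qed
  then show ?thesis
    using has_sum_reindex_bij_betw[OF bij,
      of "\<lambda>i. L2_inner (tf_shift \<nu> (\<gamma> j)) (frame_elem i) * cnj (L2_inner y (frame_elem i))"] by simp
qed

section \<open>Lattice superpositions of combinations of dual windows\<close>

definition dual_comb :: "(nat \<Rightarrow> complex) \<Rightarrow> real^'n \<Rightarrow> complex" where
  "dual_comb b = (\<lambda>t. \<Sum>j\<in>{1..m}. b j * \<gamma> j t)"

lemma dual_comb_L2: "dual_comb b \<in> L2"
  unfolding dual_comb_def by (intro L2_finite_sum L2_cmult \<gamma>_L2)

text \<open>By linearity, the frame coefficients of a superposition of dual windows, paired with
  those of y, give the same superposition of the windows themselves.\<close>

lemma dual_comb_has_sum:
  assumes X: "finite X" "X \<subseteq> Lat d" and y: "y \<in> L2"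
  shows "((\<lambda>i. L2_inner (tf_sum X w (dual_comb b)) (frame_elem i) * cnj (L2_inner y (frame_elem i)))
    has_sum (\<Sum>j\<in>{1..m}. b j * L2_inner (tf_sum X w (g j)) y)) frame_index"
proof -
  have eq: "tf_sum X w (dual_comb b) = (\<lambda>t. \<Sum>j\<in>{1..m}. \<Sum>\<mu>\<in>X. b j * (w \<mu> * tf_shift \<mu> (\<gamma> j) t))"
    unfolding tf_sum_def dual_comb_def tf_shift_sum tf_shift_cmult sum_distrib_left
    by (subst sum.swap) (simp add: mult_ac)
  have L: "L2_inner (tf_sum X w (dual_comb b)) h
      = (\<Sum>j\<in>{1..m}. \<Sum>\<mu>\<in>X. b j * (w \<mu> * L2_inner (tf_shift \<mu> (\<gamma> j)) h))" if "h \<in> L2" for h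
  proof -
    have u: "(\<lambda>t. b j * (w \<mu> * tf_shift \<mu> (\<gamma> j) t)) \<in> L2" if "j \<in> {1..m}" for j \<mu>
      using that by (intro L2_cmult tf_shift_L2 \<gamma>_L2)
    have "L2_inner (tf_sum X w (dual_comb b)) h
        = (\<Sum>j\<in>{1..m}. L2_inner (\<lambda>t. \<Sum>\<mu>\<in>X. b j * (w \<mu> * tf_shift \<mu> (\<gamma> j) t)) h)"
      unfolding eq by (intro L2_inner_sum_left L2_finite_sum u \<open>h \<in> L2\<close>)
    also have "\<dots> = (\<Sum>j\<in>{1..m}. \<Sum>\<mu>\<in>X. L2_inner (\<lambda>t. b j * (w \<mu> * tf_shift \<mu> (\<gamma> j) t)) h)"
      by (intro sum.cong refl L2_inner_sum_left u \<open>h \<in> L2\<close>)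
    finally show ?thesis by (simp only: L2_inner_cmult_left)
  qed
  have "((\<lambda>i. \<Sum>j\<in>{1..m}. \<Sum>\<mu>\<in>X. b j * (w \<mu> * (L2_inner (tf_shift \<mu> (\<gamma> j)) (frame_elem i) * cnj (L2_inner y (frame_elem i)))))
    has_sum (\<Sum>j\<in>{1..m}. \<Sum>\<mu>\<in>X. b j * (w \<mu> * L2_inner (tf_shift \<mu> (g j)) y))) frame_index"
    using X(2) by (intro has_sum_finite_sum has_sum_cmult_right dual_shift_has_sum y) auto
  also have "(\<Sum>j\<in>{1..m}. \<Sum>\<mu>\<in>X. b j * (w \<mu> * L2_inner (tf_shift \<mu> (g j)) y))
      = (\<Sum>j\<in>{1..m}. b j * L2_inner (tf_sum X w (g j)) y)"
    by (intro sum.cong refl) (simp add: L2_inner_tf_sum_left[OF g_L2 y] sum_distrib_left)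
  finally show ?thesis
    by (rule has_sum_cong[THEN iffD1, rotated])
      (simp add: L frame_elem_L2 sum_distrib_right mult.assoc)
qed

lemma frame_square_has_sum:
  assumes y: "y \<in> L2"
  obtains S where "((\<lambda>i. L2_inner y (frame_elem i) * cnj (L2_inner y (frame_elem i))) has_sum of_real S) frame_index"
    "A * (L2_norm y)\<^sup>2 \<le> S"
proof
  let ?S = "\<Sum>\<^sub>\<infinity>i\<in>frame_index. (cmod (L2_inner y (frame_elem i)))\<^sup>2"
  have "((\<lambda>i. (cmod (L2_inner y (frame_elem i)))\<^sup>2) has_sum ?S) frame_index"
    using frame_summable[OF y] unfolding frame_elem_def frame_index_def by (rule has_sum_infsum)
  then have "((\<lambda>i. complex_of_real ((cmod (L2_inner y (frame_elem i)))\<^sup>2)) has_sum complex_of_real ?S) frame_index"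
    by (rule has_sum_of_real)
  then show "((\<lambda>i. L2_inner y (frame_elem i) * cnj (L2_inner y (frame_elem i))) has_sum complex_of_real ?S) frame_index"
    by (simp only: complex_norm_square)
  show "A * (L2_norm y)\<^sup>2 \<le> ?S"
    using frame_lower[OF y] unfolding frame_elem_def frame_index_def .
qed

lemma window_sum_bound:
  assumes X: "finite X" "X \<subseteq> Lat d" and j: "j \<in> {1..m}"
  shows "L2_norm (tf_sum X w (g j)) \<le> sqrt B * L2_set (\<lambda>\<mu>. cmod (w \<mu>)) X"
proof -
  have inj: "inj_on (\<lambda>\<mu>. (\<mu>, j)) X" by (auto simp: inj_on_def)
  have Z: "finite ((\<lambda>\<mu>. (\<mu>, j)) ` X)" "(\<lambda>\<mu>. (\<mu>, j)) ` X \<subseteq> frame_index"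
    using X j by (auto simp: frame_index_def)
  from synthesis_bound[OF Z, of "\<lambda>i. w (fst i)"] show ?thesis
    unfolding tf_sum_def L2_set_def sum.reindex[OF inj] by (simp add: frame_elem_def)
qed

text \<open>A Bessel bound for the lattice shifts of the dual windows. The lower frame bound for the
  superposition, combined with duality, bounds its squared norm by inner products with finite
  superpositions of the \<open>g j\<close>; these obey \<open>window_sum_bound\<close>, and one
  factor of the norm cancels.\<close>

lemma dual_comb_bound:
  obtains C where "C \<ge> 0" "\<And>X w. finite X \<Longrightarrow> X \<subseteq> Lat d \<Longrightarrow>
    L2_norm (tf_sum X w (dual_comb b)) \<le> C * L2_set (\<lambda>\<mu>. cmod (w \<mu>)) X"
proof
  let ?C = "(\<Sum>j\<in>{1..m}. cmod (b j)) * sqrt B / A"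
  show "?C \<ge> 0" using A_pos B_pos by (intro divide_nonneg_pos mult_nonneg_nonneg sum_nonneg) auto
  fix X :: "((real^'n) \<times> (real^'n)) set" and w :: "(real^'n) \<times> (real^'n) \<Rightarrow> complex"
  assume X: "finite X" "X \<subseteq> Lat d"
  let ?x = "tf_sum X w (dual_comb b)"
  let ?n = "L2_set (\<lambda>\<mu>. cmod (w \<mu>)) X"
  have x: "?x \<in> L2" by (intro tf_sum_L2 dual_comb_L2)
  obtain S where S: "((\<lambda>i. L2_inner ?x (frame_elem i) * cnj (L2_inner ?x (frame_elem i))) has_sum of_real S) frame_index"
    "A * (L2_norm ?x)\<^sup>2 \<le> S"
    using frame_square_has_sum[OF x] by blast
  have "complex_of_real S = (\<Sum>j\<in>{1..m}. b j * L2_inner (tf_sum X w (g j)) ?x)"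
    by (rule has_sum_unique[OF S(1) dual_comb_has_sum[OF X x]])
  then have "\<bar>S\<bar> = cmod (\<Sum>j\<in>{1..m}. b j * L2_inner (tf_sum X w (g j)) ?x)"
    by (metis norm_of_real)
  also have "\<dots> \<le> (\<Sum>j\<in>{1..m}. cmod (b j) * (sqrt B * ?n * L2_norm ?x))"
  proof (rule sum_norm_le)
    fix j assume j: "j \<in> {1..m}"
    have "cmod (L2_inner (tf_sum X w (g j)) ?x) \<le> L2_norm (tf_sum X w (g j)) * L2_norm ?x"
      by (intro L2_Cauchy_Schwarz tf_sum_L2 g_L2 j x)
    also have "\<dots> \<le> sqrt B * ?n * L2_norm ?x"
      by (intro mult_right_mono window_sum_bound X j L2_norm_nonneg)
    finally show "cmod (b j * L2_inner (tf_sum X w (g j)) ?x) \<le> cmod (b j) * (sqrt B * ?n * L2_norm ?x)"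
      unfolding norm_mult by (intro mult_left_mono) auto
  qed
  also have "\<dots> = (\<Sum>j\<in>{1..m}. cmod (b j)) * sqrt B * ?n * L2_norm ?x"
    by (simp add: sum_distrib_right mult.assoc)
  finally have le: "A * L2_norm ?x * L2_norm ?x \<le> (\<Sum>j\<in>{1..m}. cmod (b j)) * sqrt B * ?n * L2_norm ?x"
    using S(2) by (simp add: power2_eq_square mult.assoc)
  show "L2_norm ?x \<le> ?C * ?n"
  proof (cases "L2_norm ?x = 0")
    case True
    show ?thesis unfolding True by (rule mult_nonneg_nonneg[OF \<open>?C \<ge> 0\<close> L2_set_nonneg])
  next
    case False
    then have "L2_norm ?x > 0" using L2_norm_nonneg[of ?x] by linarith
    with le have "A * L2_norm ?x \<le> (\<Sum>j\<in>{1..m}. cmod (b j)) * sqrt B * ?n" by (rule mult_right_le_imp_le)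
    then show ?thesis using A_pos by (simp add: pos_le_divide_eq mult.commute)
  qed
qed

text \<open>The lower frame bound is applied to the difference \<open>y\<close> itself. By duality the coefficients of the first
  summand pair with those of \<open>y\<close> as \<open>b r * w \<mu>\<close> would, which leaves only the coefficient
  errors of the cell superposition.\<close>

lemma dual_comb_near_cell_sum:
  assumes X: "finite X" "X \<subseteq> Lat d" and w: "\<forall>\<mu>. \<mu> \<notin> X \<longrightarrow> w \<mu> = 0"
    and E: "\<And>r Y. r \<in> {1..m} \<Longrightarrow> finite Y \<Longrightarrow> Y \<subseteq> Lat d \<Longrightarrow>
      L2_set (\<lambda>\<mu>. cmod (L2_inner (tf_sum X w (cell_fun s)) (tf_shift \<mu> (g r)) - of_real covolume * b r * w \<mu>)) Y \<le> E r"
  shows "L2_norm (\<lambda>t. tf_sum X w (dual_comb b) t - of_real (1 / covolume) * tf_sum X w (cell_fun s) t)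
    \<le> sqrt B / (covolume * A) * (\<Sum>r\<in>{1..m}. E r)"
proof -
  let ?F = "tf_sum X w (cell_fun s)"
  let ?G = "tf_sum X w (dual_comb b)"
  let ?k = "complex_of_real (1 / covolume)"
  define y where "y = (\<lambda>t. ?G t - ?k * ?F t)"
  define c where "c i = cnj (L2_inner y (frame_elem i))" for i
  have F: "?F \<in> L2" and G: "?G \<in> L2" by (intro tf_sum_L2 cell_fun_L2 dual_comb_L2)+
  have y: "y \<in> L2" unfolding y_def by (intro L2_diff G L2_cmult F)
  obtain S where S: "((\<lambda>i. L2_inner y (frame_elem i) * c i) has_sum of_real S) frame_index"
    "A * (L2_norm y)\<^sup>2 \<le> S"
    using frame_square_has_sum[OF y] unfolding c_def by blast
  have h1: "((\<lambda>i. L2_inner ?G (frame_elem i) * c i) has_sum (\<Sum>j\<in>{1..m}. b j * L2_inner (tf_sum X w (g j)) y)) frame_index"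
    unfolding c_def by (rule dual_comb_has_sum[OF X y])
  \<comment> \<open>This series has the value of \<open>h1\<close>, computed here from finite sums,
    so the differences of the two summands form a series with sum zero.\<close>
  have h2: "((\<lambda>i. b (snd i) * w (fst i) * c i) has_sum (\<Sum>j\<in>{1..m}. b j * L2_inner (tf_sum X w (g j)) y)) frame_index"
  proof -
    have "(\<Sum>j\<in>{1..m}. b j * L2_inner (tf_sum X w (g j)) y) = (\<Sum>j\<in>{1..m}. \<Sum>\<mu>\<in>X. b j * w \<mu> * c (\<mu>, j))"
    proof (intro sum.cong refl)
      fix j assume j: "j \<in> {1..m}"
      have "L2_inner (tf_shift \<mu> (g j)) y = c (\<mu>, j)" for \<mu>
        unfolding c_def frame_elem_def fst_conv snd_conv by (rule L2_inner_sym)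
      then show "b j * L2_inner (tf_sum X w (g j)) y = (\<Sum>\<mu>\<in>X. b j * w \<mu> * c (\<mu>, j))"
        by (simp add: L2_inner_tf_sum_left[OF g_L2[OF j] y] sum_distrib_left mult.assoc)
    qed
    also have "\<dots> = (\<Sum>\<mu>\<in>X. \<Sum>j\<in>{1..m}. b j * w \<mu> * c (\<mu>, j))" by (rule sum.swap)
    also have "\<dots> = (\<Sum>i\<in>X \<times> {1..m}. b (snd i) * w (fst i) * c i)"
      by (simp add: sum.cartesian_product case_prod_unfold)
    finally have eq: "(\<Sum>j\<in>{1..m}. b j * L2_inner (tf_sum X w (g j)) y) = (\<Sum>i\<in>X \<times> {1..m}. b (snd i) * w (fst i) * c i)" .
    have "((\<lambda>i. b (snd i) * w (fst i) * c i) has_sum (\<Sum>i\<in>X \<times> {1..m}. b (snd i) * w (fst i) * c i)) (X \<times> {1..m})"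
      using X by (intro has_sum_finite) auto
    then show ?thesis
      unfolding eq
    proof (rule has_sum_cong_neutral[THEN iffD1, rotated -1])
      show "b (snd i) * w (fst i) * c i = 0" if "i \<in> frame_index - X \<times> {1..m}" for i
      proof -
        have "fst i \<notin> X" using that by (cases i) (auto simp: frame_index_def)
        then show ?thesis using w[rule_format, of "fst i"] by simp
      qed
    qed (use X in \<open>auto simp: frame_index_def\<close>)
  qed
  \<comment> \<open>Subtracting that null series from the series of squared coefficients of
    \<open>y\<close> eliminates the coefficients of the dual superposition
    \<open>?G\<close>.\<close>
  have split: "L2_inner y (frame_elem i) * c i - (L2_inner ?G (frame_elem i) * c i - b (snd i) * w (fst i) * c i)
      = (- ?k * (L2_inner ?F (frame_elem i) - of_real covolume * b (snd i) * w (fst i))) * c i"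
    if i: "i \<in> frame_index" for i
  proof -
    have yi: "L2_inner y (frame_elem i) = L2_inner ?G (frame_elem i) - ?k * L2_inner ?F (frame_elem i)"
      unfolding y_def by (simp only: L2_inner_diff_left[OF G L2_cmult[OF F] frame_elem_L2[OF i]] L2_inner_cmult_left)
    have kv: "?k * (of_real covolume * b (snd i) * w (fst i)) = b (snd i) * w (fst i)"
      using covolume_pos by simp
    have gen: "(G' - k * F') * z - (G' * z - v * z) = (- k * (F' - K)) * z" if "k * K = v"
      for G' F' k K v z :: complex
      unfolding that[symmetric] by (simp add: algebra_simps)
    show ?thesis unfolding yi by (rule gen[OF kv])
  qed
  have "((\<lambda>i. L2_inner y (frame_elem i) * c i - (L2_inner ?G (frame_elem i) * c i - b (snd i) * w (fst i) * c i))
      has_sum (of_real S - 0)) frame_index"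
    using has_sum_diff[OF S(1) has_sum_diff[OF h1 h2]] by simp
  then have h3: "((\<lambda>i. (- ?k * (L2_inner ?F (frame_elem i) - of_real covolume * b (snd i) * w (fst i))) * c i)
      has_sum of_real S) frame_index"
    by (subst has_sum_cong[OF split, symmetric]) simp_all
  \<comment> \<open>Cauchy-Schwarz on finite sets: coefficient errors on one side, coefficients of
    \<open>y\<close> on the other, the latter controlled by the upper frame bound.\<close>
  have "cmod (of_real S) \<le> (1 / covolume * (\<Sum>r\<in>{1..m}. E r)) * (sqrt B * L2_norm y)"
  proof (rule norm_has_sum_bound[OF h3])
    fix Z assume Z: "finite Z" "Z \<subseteq> frame_index"
    let ?f = "\<lambda>i. cmod (L2_inner ?F (frame_elem i) - of_real covolume * b (snd i) * w (fst i))"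
    have fZ: "L2_set ?f Z \<le> (\<Sum>r\<in>{1..m}. E r)"
    proof (rule L2_set_product_le[where Y = "fst ` Z"])
      show "Z \<subseteq> fst ` Z \<times> {1..m}" using Z by (force simp: frame_index_def)
      fix r assume r: "r \<in> {1..m}"
      have "fst ` Z \<subseteq> Lat d" using Z by (auto simp: frame_index_def)
      then show "L2_set (\<lambda>\<mu>. ?f (\<mu>, r)) (fst ` Z) \<le> E r"
        using E[OF r, of "fst ` Z"] Z(1) by (simp add: frame_elem_def)
    qed (use Z in auto)
    have "cmod (\<Sum>i\<in>Z. (- ?k * (L2_inner ?F (frame_elem i) - of_real covolume * b (snd i) * w (fst i))) * c i)
        \<le> L2_set (\<lambda>i. cmod (- ?k * (L2_inner ?F (frame_elem i) - of_real covolume * b (snd i) * w (fst i)))) Z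
          * L2_set (\<lambda>i. cmod (c i)) Z"
      by (rule cmod_sum_Cauchy_Schwarz)
    also have "L2_set (\<lambda>i. cmod (- ?k * (L2_inner ?F (frame_elem i) - of_real covolume * b (snd i) * w (fst i)))) Z
        = 1 / covolume * L2_set ?f Z"
      unfolding L2_set_norm_cmult norm_minus_cancel norm_of_real using covolume_pos by simp
    also have "1 / covolume * L2_set ?f Z * L2_set (\<lambda>i. cmod (c i)) Z
        \<le> (1 / covolume * (\<Sum>r\<in>{1..m}. E r)) * (sqrt B * L2_norm y)"
    proof (rule mult_mono)
      show "1 / covolume * L2_set ?f Z \<le> 1 / covolume * (\<Sum>r\<in>{1..m}. E r)"
        using fZ covolume_pos by (intro mult_left_mono) auto
      show "L2_set (\<lambda>i. cmod (c i)) Z \<le> sqrt B * L2_norm y"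
        using analysis_bound[OF y Z] by (simp add: c_def)
      show "0 \<le> 1 / covolume * (\<Sum>r\<in>{1..m}. E r)"
        using order_trans[OF L2_set_nonneg fZ] covolume_pos by (intro mult_nonneg_nonneg) auto
    qed simp
    finally show "cmod (\<Sum>i\<in>Z. (- ?k * (L2_inner ?F (frame_elem i) - of_real covolume * b (snd i) * w (fst i))) * c i)
        \<le> (1 / covolume * (\<Sum>r\<in>{1..m}. E r)) * (sqrt B * L2_norm y)" .
  qed
  then have le: "(A * L2_norm y) * L2_norm y \<le> (1 / covolume * (\<Sum>r\<in>{1..m}. E r) * sqrt B) * L2_norm y"
    using S(2) by (simp add: power2_eq_square mult.assoc)
  have E0: "0 \<le> (\<Sum>r\<in>{1..m}. E r)"
    using E[of _ "{}"] by (intro sum_nonneg) auto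
  have "L2_norm y \<le> sqrt B / (covolume * A) * (\<Sum>r\<in>{1..m}. E r)"
  proof (cases "L2_norm y = 0")
    case True
    then show ?thesis using E0 A_pos B_pos covolume_pos by simp
  next
    case False
    then have "L2_norm y > 0" using L2_norm_nonneg[of y] by linarith
    with le have "A * L2_norm y \<le> 1 / covolume * (\<Sum>r\<in>{1..m}. E r) * sqrt B" by (rule mult_right_le_imp_le)
    then have "L2_norm y \<le> (1 / covolume * (\<Sum>r\<in>{1..m}. E r) * sqrt B) / A"
      using A_pos by (simp only: pos_le_divide_eq mult.commute[of A])
    then show ?thesis by (simp add: mult_ac)
  qed
  then show ?thesis unfolding y_def .
qed

end

section \<open>Passage from finitely supported to square-summable envelopes\<close>

lemma L2_inner_tendsto:
  assumes f: "eventually (\<lambda>x. f x \<in> L2) Fl" "f0 \<in> L2" "((\<lambda>x. L2_norm (\<lambda>t. f x t - f0 t)) \<longlongrightarrow> 0) Fl"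
    and h: "eventually (\<lambda>x. h x \<in> L2) Fl" "h0 \<in> L2" "((\<lambda>x. L2_norm (\<lambda>t. h x t - h0 t)) \<longlongrightarrow> 0) Fl"
  shows "((\<lambda>x. L2_inner (f x) (h x)) \<longlongrightarrow> L2_inner f0 h0) Fl"
proof (rule tendsto_norm_zero_cancel[THEN LIM_zero_cancel], rule tendsto_sandwich[OF _ _ tendsto_const])
  let ?a = "\<lambda>x. L2_norm (\<lambda>t. f x t - f0 t)" and ?b = "\<lambda>x. L2_norm (\<lambda>t. h x t - h0 t)"
  have "((\<lambda>x. ?a x * (?b x + L2_norm h0) + L2_norm f0 * ?b x) \<longlongrightarrow> 0 * (0 + L2_norm h0) + L2_norm f0 * 0) Fl"
    by (intro tendsto_intros f h)
  then show "((\<lambda>x. ?a x * (?b x + L2_norm h0) + L2_norm f0 * ?b x) \<longlongrightarrow> 0) Fl" by simp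
  show "eventually (\<lambda>x. norm (L2_inner (f x) (h x) - L2_inner f0 h0)
      \<le> ?a x * (?b x + L2_norm h0) + L2_norm f0 * ?b x) Fl"
    using f(1) h(1)
  proof eventually_elim
    case (elim x)
    have d: "(\<lambda>t. f x t - f0 t) \<in> L2" "(\<lambda>t. h x t - h0 t) \<in> L2" using elim f(2) h(2) by (auto intro: L2_diff)
    have "L2_inner (f x) (h x) - L2_inner f0 h0
        = L2_inner (\<lambda>t. f x t - f0 t) (h x) + L2_inner f0 (\<lambda>t. h x t - h0 t)"
      using elim f(2) h(2) by (simp add: L2_inner_diff_left L2_inner_diff_right)
    also have "norm \<dots> \<le> ?a x * L2_norm (h x) + L2_norm f0 * ?b x"
      by (rule order_trans[OF norm_triangle_ineq])
        (intro add_mono L2_Cauchy_Schwarz d elim f(2))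
    also have "\<dots> \<le> ?a x * (?b x + L2_norm h0) + L2_norm f0 * ?b x"
      using L2_norm_diff_abs[OF elim(2) h(2)]
      by (intro add_mono mult_left_mono L2_norm_nonneg) auto
    finally show ?case .
  qed
qed auto

definition restrict_seq :: "'a set \<Rightarrow> ('a \<Rightarrow> complex) \<Rightarrow> 'a \<Rightarrow> complex" where
  "restrict_seq X w = (\<lambda>\<mu>. if \<mu> \<in> X then w \<mu> else 0)"

lemma restrict_seq_support: "\<forall>\<mu>. \<mu> \<notin> X \<longrightarrow> restrict_seq X w \<mu> = 0"
  by (simp add: restrict_seq_def)

text \<open>The square of this norm is the total square sum minus the partial sum over X.\<close>

lemma ell2_restrict_tail_tendsto:
  assumes w: "ell2 d w"
  shows "((\<lambda>X. ell2_norm d (\<lambda>\<mu>. w \<mu> - restrict_seq X w \<mu>)) \<longlongrightarrow> 0) (finite_subsets_at_top (Lat d))"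
proof -
  let ?q = "\<lambda>\<mu>. (cmod (w \<mu>))\<^sup>2"
  have s: "?q summable_on Lat d" using w by (simp add: ell2_def)
  have "((\<lambda>X. sum ?q X) \<longlongrightarrow> infsum ?q (Lat d)) (finite_subsets_at_top (Lat d))"
    using has_sum_infsum[OF s] by (simp add: has_sum_def)
  from tendsto_real_sqrt[OF tendsto_diff[OF tendsto_const[of "infsum ?q (Lat d)"] this]]
  have "((\<lambda>X. sqrt (infsum ?q (Lat d) - sum ?q X)) \<longlongrightarrow> 0) (finite_subsets_at_top (Lat d))" by simp
  moreover have "eventually (\<lambda>X. sqrt (infsum ?q (Lat d) - sum ?q X)
      = ell2_norm d (\<lambda>\<mu>. w \<mu> - restrict_seq X w \<mu>)) (finite_subsets_at_top (Lat d))"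
  proof (rule eventually_finite_subsets_at_topI[of "{}"])
    fix X assume X: "finite X" "X \<subseteq> Lat d"
    have "infsum (\<lambda>\<mu>. (cmod (w \<mu> - restrict_seq X w \<mu>))\<^sup>2) (Lat d) = infsum ?q (Lat d - X)"
      by (rule infsum_cong_neutral) (auto simp: restrict_seq_def)
    also have "\<dots> = infsum ?q (Lat d) - infsum ?q X"
      using X s by (intro infsum_Diff) auto
    finally show "sqrt (infsum ?q (Lat d) - sum ?q X) = ell2_norm d (\<lambda>\<mu>. w \<mu> - restrict_seq X w \<mu>)"
      using X by (simp add: ell2_norm_def)
  qed auto
  ultimately show ?thesis by (rule Lim_transform_eventually)
qed

lemma ell2_restrict:
  assumes "finite X" "X \<subseteq> Lat d"
  shows "ell2 d (restrict_seq X w)"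
  by (rule ell2_finite_support(1)[where w = "restrict_seq X w", OF assms restrict_seq_support])

lemma ell2_norm_diff_abs:
  assumes "ell2 d u" "ell2 d w"
  shows "\<bar>ell2_norm d u - ell2_norm d w\<bar> \<le> ell2_norm d (\<lambda>\<mu>. w \<mu> - u \<mu>)"
proof -
  have "ell2_norm d w \<le> ell2_norm d u + ell2_norm d (\<lambda>\<mu>. w \<mu> - u \<mu>)"
    using ell2_norm_add(2)[OF assms(1) ell2_norm_diff(1)[OF assms(2,1)]] by simp
  moreover have "ell2_norm d u \<le> ell2_norm d w + ell2_norm d (\<lambda>\<mu>. w \<mu> - u \<mu>)"
    using ell2_norm_diff(2)[OF assms(2) ell2_norm_diff(1)[OF assms(2,1)]] by simp
  ultimately show ?thesis by linarith
qed

context gabor_lattice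
begin

text \<open>As functions of the envelope, both quantities are Lipschitz for the l2 norm, with
  constants 1 and 2.\<close>

lemma restrict_seq_limits:
  assumes w: "ell2 d w"
  shows "((\<lambda>X. ell2_norm d (restrict_seq X w)) \<longlongrightarrow> ell2_norm d w) (finite_subsets_at_top (Lat d))"
    and "\<nu> \<in> Lat d \<Longrightarrow> ((\<lambda>X. shift_diff \<nu> (restrict_seq X w)) \<longlongrightarrow> shift_diff \<nu> w) (finite_subsets_at_top (Lat d))"
proof -
  let ?t = "\<lambda>X. ell2_norm d (\<lambda>\<mu>. w \<mu> - restrict_seq X w \<mu>)"
  note lim = ell2_restrict_tail_tendsto[OF w]
  show "((\<lambda>X. ell2_norm d (restrict_seq X w)) \<longlongrightarrow> ell2_norm d w) (finite_subsets_at_top (Lat d))"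
  proof (rule LIM_zero_cancel, rule Lim_null_comparison[OF _ lim])
    show "eventually (\<lambda>X. norm (ell2_norm d (restrict_seq X w) - ell2_norm d w) \<le> ?t X) (finite_subsets_at_top (Lat d))"
      by (rule eventually_finite_subsets_at_topI[of "{}"])
        (auto intro!: ell2_norm_diff_abs ell2_restrict w)
  qed
  assume \<nu>: "\<nu> \<in> Lat d"
  show "((\<lambda>X. shift_diff \<nu> (restrict_seq X w)) \<longlongrightarrow> shift_diff \<nu> w) (finite_subsets_at_top (Lat d))"
  proof (rule LIM_zero_cancel, rule Lim_null_comparison)
    show "((\<lambda>X. 2 * ?t X) \<longlongrightarrow> 0) (finite_subsets_at_top (Lat d))"
      using tendsto_mult_right_zero[OF lim] .
    show "eventually (\<lambda>X. norm (shift_diff \<nu> (restrict_seq X w) - shift_diff \<nu> w) \<le> 2 * ?t X) (finite_subsets_at_top (Lat d))"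
    proof (rule eventually_finite_subsets_at_topI[of "{}"])
      fix X assume X: "finite X" "X \<subseteq> Lat d"
      let ?u = "restrict_seq X w"
      note u = ell2_restrict[OF X, of w]
      have "norm (shift_diff \<nu> ?u - shift_diff \<nu> w)
          \<le> ell2_norm d (\<lambda>\<mu>. (w (\<mu> - \<nu>) - w \<mu>) - (?u (\<mu> - \<nu>) - ?u \<mu>))"
        unfolding shift_diff_def real_norm_def
        by (intro ell2_norm_diff_abs ell2_norm_diff(1) ell2_shift(1) \<nu> u w)
      also have "(\<lambda>\<mu>. (w (\<mu> - \<nu>) - w \<mu>) - (?u (\<mu> - \<nu>) - ?u \<mu>))
          = (\<lambda>\<mu>. (w (\<mu> - \<nu>) - ?u (\<mu> - \<nu>)) - (w \<mu> - ?u \<mu>))" by (simp add: algebra_simps)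
      also have "ell2_norm d \<dots> \<le> 2 * ?t X"
        using shift_diff_le[OF \<nu> ell2_norm_diff(1)[OF w u]] by (simp add: shift_diff_def)
      finally show "norm (shift_diff \<nu> ?u - shift_diff \<nu> w) \<le> 2 * ?t X" .
    qed auto
  qed
qed

lemma Srep_sum_eq_tf_sum:
  assumes "X \<subseteq> Lat d"
  shows "(\<Sum>\<mu>\<in>X. w \<mu> * Srep d \<mu> f t) = tf_sum X w f t"
  unfolding tf_sum_def
proof (rule sum.cong[OF refl])
  fix \<mu> assume "\<mu> \<in> X"
  then have "\<mu> \<in> Lat d" using assms by blast
  then show "w \<mu> * Srep d \<mu> f t = w \<mu> * tf_shift \<mu> f t" by (simp only: Srep_eq_tf_shift)
qed

lemma tf_sum_restrict_seq: "tf_sum X (restrict_seq X w) f = tf_sum X w f"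
  unfolding tf_sum_def restrict_seq_def by (intro ext sum.cong refl) simp

lemma cell_sum_inner:
  assumes X: "finite X" "X \<subseteq> Lat d" and r: "r \<in> Zd d" "s \<in> Zd d"
  shows "L2_inner (tf_sum X w (cell_fun r)) (tf_sum X w (cell_fun s))
    = (if r = s then of_real (covolume * (L2_set (\<lambda>\<mu>. cmod (w \<mu>)) X)\<^sup>2) else 0)"
proof (cases "r = s")
  case True
  then show ?thesis
    using covolume_pos by (simp add: L2_inner_self tf_sum_cell_norm[OF X] power_mult_distrib)
next
  case False
  have "L2_inner (tf_shift \<mu> (cell_fun r)) (tf_sum X w (cell_fun s)) = 0" if "\<mu> \<in> X" for \<mu>
  proof -
    have "L2_inner (tf_sum X w (cell_fun s)) (tf_shift \<mu> (cell_fun r)) = 0"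
      unfolding L2_inner_tf_sum_left[OF cell_fun_L2 tf_shift_L2[OF cell_fun_L2]]
      using False cell_orthogonal_Zd[OF r(2,1) _ subsetD[OF X(2) that]] X(2)
      by (intro sum.neutral ballI) auto
    then show ?thesis by (subst L2_inner_sym) simp
  qed
  with False show ?thesis
    unfolding L2_inner_tf_sum_left[OF cell_fun_L2 tf_sum_L2[OF cell_fun_L2]] by simp
qed

text \<open>The origin of the factor sqrt d in the theorem: it is the reciprocal volume of a
  cell.\<close>

lemma covolume_inverse: "1 / covolume = sqrt (real (\<Prod>j\<in>UNIV. d j))"
proof -
  have "sqrt (real (\<Prod>j\<in>J. d j)) = (\<Prod>j\<in>J. sqrt (real (d j)))" for J
    by (induction J rule: infinite_finite_induct) (auto simp: real_sqrt_mult)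
  then show ?thesis unfolding covolume_def by (simp add: prod_dividef)
qed

section \<open>Coordinates in the symbol space\<close>

definition basis_vec :: "int^'n \<Rightarrow> int^'n \<Rightarrow> complex" where
  "basis_vec s = (\<lambda>r. if r = s then 1 else 0)"

lemma basis_vec_Hd: "s \<in> Zd d \<Longrightarrow> basis_vec s \<in> Hd d"
  by (auto simp: basis_vec_def Hd_def)

lemma Hd_inner_basis_vec: "s \<in> Zd d \<Longrightarrow> Hd_inner d (basis_vec s) v = cnj (v s)"
proof -
  assume s: "s \<in> Zd d"
  have "Hd_inner d (basis_vec s) v = (\<Sum>r\<in>Zd d. if r = s then cnj (v r) else 0)"
    unfolding Hd_inner_def basis_vec_def by (intro sum.cong refl) auto
  then show ?thesis using s finite_Zd by (simp add: sum.delta)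
qed

lemma Hd_component_le:
  assumes "r \<in> Zd d"
  shows "cmod (c r) \<le> Hd_norm d c"
proof -
  have "(cmod (c r))\<^sup>2 \<le> (\<Sum>r\<in>Zd d. (cmod (c r))\<^sup>2)"
    using finite_Zd assms by (intro member_le_sum) auto
  then show ?thesis unfolding Hd_norm_def by (rule real_le_rsqrt)
qed

lemma Hd_norm_le_sum: "Hd_norm d c \<le> (\<Sum>r\<in>Zd d. cmod (c r))"
  using L2_set_le_sum[of "Zd d" "\<lambda>r. cmod (c r)"] by (simp add: Hd_norm_def L2_set_def)

lemma Zd_nonempty: "Zd d \<noteq> {}"
proof -
  have "0 \<in> Zd d" using d_pos by (simp add: Zd_def)
  then show ?thesis by blast
qed

end

context gabor_frame_dual
begin

text \<open>The coefficient of \<open>\<gamma> j\<close> in \<open>Gam\<close> for the basis symbol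
  e_s; the conjugate comes from the second argument of \<open>Hd_inner\<close>.\<close>

definition window_coeff :: "int^'n \<Rightarrow> nat \<Rightarrow> complex" where
  "window_coeff s j = cnj (Zak_vec d (g j) 0 0 s)"

text \<open>There are finitely many windows and residues, so the sets of shifts can be united and
  the constants added.\<close>

lemma dual_comb_near_cell_sum_uniform:
  assumes \<eta>: "\<eta> > 0"
  shows "\<exists>N C. finite N \<and> N \<subseteq> Lat d \<and> C \<ge> 0 \<and> (\<forall>X w s. finite X \<longrightarrow> X \<subseteq> Lat d \<longrightarrow>
      (\<forall>\<mu>. \<mu> \<notin> X \<longrightarrow> w \<mu> = 0) \<longrightarrow> s \<in> Zd d \<longrightarrow>
      L2_norm (\<lambda>t. tf_sum X w (dual_comb (window_coeff s)) t - of_real (1 / covolume) * tf_sum X w (cell_fun s) t)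
        \<le> \<eta> * ell2_norm d w + C * (\<Sum>\<nu>\<in>N. shift_diff \<nu> w))"
proof -
  define K where "K = sqrt B / (covolume * A)"
  have K: "K \<ge> 0" using A_pos B_pos covolume_pos by (simp add: K_def)
  \<comment> \<open>Compensates for the sum over m windows and the factor \<open>K\<close> from
    \<open>dual_comb_near_cell_sum\<close>; the added 1 keeps the denominator positive.\<close>
  define \<eta>' where "\<eta>' = \<eta> / (K * real m + 1)"
  have \<eta>': "\<eta>' > 0" using \<eta> K by (simp add: \<eta>'_def add_nonneg_pos)
  have K\<eta>: "K * real m * \<eta>' \<le> \<eta>"
  proof -
    have pos: "K * real m + 1 > 0" using K by (simp add: add_nonneg_pos)
    have "K * real m * \<eta>' \<le> (K * real m + 1) * \<eta>'" using \<eta>' by (intro mult_right_mono) auto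
    also have "\<dots> = \<eta>" using pos by (simp add: \<eta>'_def)
    finally show ?thesis .
  qed
  let ?Q = "\<lambda>p N C. finite N \<and> N \<subseteq> Lat d \<and> C \<ge> 0 \<and> (\<forall>X w Y. finite X \<longrightarrow> X \<subseteq> Lat d \<longrightarrow>
      (\<forall>\<mu>. \<mu> \<notin> X \<longrightarrow> w \<mu> = 0) \<longrightarrow> finite Y \<longrightarrow> Y \<subseteq> Lat d \<longrightarrow>
      L2_set (\<lambda>\<mu>. cmod (L2_inner (tf_sum X w (cell_fun (snd p))) (tf_shift \<mu> (g (fst p)))
          - of_real covolume * window_coeff (snd p) (fst p) * w \<mu>)) Y
      \<le> \<eta>' * ell2_norm d w + C * (\<Sum>\<nu>\<in>N. shift_diff \<nu> w))"
  have "\<exists>NC. ?Q p (fst NC) (snd NC)" if p: "p \<in> {1..m} \<times> Zd d" for p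
  proof -
    have j: "fst p \<in> {1..m}" and s: "snd p \<in> Zd d" using p by auto
    obtain M where M: "M summable_on UNIV" "\<And>t. cmod (g (fst p) t) \<le> M (cell_index d t)"
      using g_majorant[OF j] by blast
    obtain N C where "finite N" "N \<subseteq> Lat d" "C \<ge> 0"
      and *: "\<And>X w Y. finite X \<Longrightarrow> X \<subseteq> Lat d \<Longrightarrow> \<forall>\<mu>. \<mu> \<notin> X \<longrightarrow> w \<mu> = 0 \<Longrightarrow> finite Y \<Longrightarrow> Y \<subseteq> Lat d \<Longrightarrow>
      L2_set (\<lambda>\<mu>. cmod (L2_inner (tf_sum X w (cell_fun (snd p))) (tf_shift \<mu> (g (fst p)))
          - of_real covolume * cnj (Zak_vec d (g (fst p)) 0 0 (snd p)) * w \<mu>)) Y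
      \<le> \<eta>' * ell2_norm d w + C * (\<Sum>\<nu>\<in>N. shift_diff \<nu> w)"
      by (rule coefficient_asymptotics[OF g_cont[OF j] g_L2[OF j] M s \<eta>']) (rule that)
    then have "?Q p N C" unfolding window_coeff_def by simp
    then show ?thesis by (intro exI[of _ "(N, C)"]) simp
  qed
  then have "\<forall>p\<in>{1..m} \<times> Zd d. \<exists>NC. ?Q p (fst NC) (snd NC)" by blast
  then obtain NC where NC: "\<forall>p\<in>{1..m} \<times> Zd d. ?Q p (fst (NC p)) (snd (NC p))" by (rule bchoice[THEN exE])
  define NN where "NN p = fst (NC p)" for p
  define CC where "CC p = snd (NC p)" for p
  let ?P = "{1..m} \<times> Zd d"
  have P: "finite ?P" using finite_Zd by simp
  define N where "N = (\<Union>p\<in>?P. NN p)"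
  define C where "C = (\<Sum>p\<in>?P. CC p)"
  have NN: "finite (NN p)" "NN p \<subseteq> Lat d" "CC p \<ge> 0" if "p \<in> ?P" for p
    using NC that unfolding NN_def CC_def by blast+
  have N: "finite N" "N \<subseteq> Lat d" unfolding N_def using NN(1,2) P by blast+
  have C: "C \<ge> 0" unfolding C_def by (intro sum_nonneg NN(3))
  show ?thesis
  proof (intro exI[of _ N] exI[of _ "K * real m * C"] conjI allI impI N)
    show "0 \<le> K * real m * C" using K C by simp
    fix X s and w :: "(real^'n) \<times> (real^'n) \<Rightarrow> complex"
    assume X: "finite X" "X \<subseteq> Lat d" and w: "\<forall>\<mu>. \<mu> \<notin> X \<longrightarrow> w \<mu> = 0" and s: "s \<in> Zd d"
    define D where "D = (\<Sum>\<nu>\<in>N. shift_diff \<nu> w)"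
    have D0: "D \<ge> 0" unfolding D_def by (intro sum_nonneg shift_diff_nonneg)
    have "L2_norm (\<lambda>t. tf_sum X w (dual_comb (window_coeff s)) t - of_real (1 / covolume) * tf_sum X w (cell_fun s) t)
        \<le> K * (\<Sum>r\<in>{1..m}. \<eta>' * ell2_norm d w + C * D)"
      unfolding K_def
    proof (rule dual_comb_near_cell_sum[OF X w])
      fix r :: nat and Y :: "((real^'n) \<times> (real^'n)) set"
      assume r: "r \<in> {1..m}" and Y: "finite Y" "Y \<subseteq> Lat d"
      have p: "(r, s) \<in> ?P" using r s by simp
      have "L2_set (\<lambda>\<mu>. cmod (L2_inner (tf_sum X w (cell_fun s)) (tf_shift \<mu> (g r))
            - of_real covolume * window_coeff s r * w \<mu>)) Y
          \<le> \<eta>' * ell2_norm d w + CC (r, s) * (\<Sum>\<nu>\<in>NN (r, s). shift_diff \<nu> w)"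
        using NC[rule_format, OF p] X w Y unfolding NN_def CC_def by (simp only: fst_conv snd_conv)
      also have "\<dots> \<le> \<eta>' * ell2_norm d w + C * D"
      proof (intro add_left_mono mult_mono)
        show "CC (r, s) \<le> C" unfolding C_def using NN(3) P p by (intro member_le_sum) auto
        show "(\<Sum>\<nu>\<in>NN (r, s). shift_diff \<nu> w) \<le> D"
        proof -
          have "NN (r, s) \<subseteq> N" unfolding N_def by (rule UN_upper[OF p])
          then show ?thesis unfolding D_def by (intro sum_mono2 N(1) shift_diff_nonneg)
        qed
      qed (auto intro!: sum_nonneg shift_diff_nonneg C)
      finally show "L2_set (\<lambda>\<mu>. cmod (L2_inner (tf_sum X w (cell_fun s)) (tf_shift \<mu> (g r))
            - of_real covolume * window_coeff s r * w \<mu>)) Y \<le> \<eta>' * ell2_norm d w + C * D" .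
    qed
    also have "\<dots> = (K * real m * \<eta>') * ell2_norm d w + K * real m * C * D"
      by (simp add: algebra_simps)
    also have "\<dots> \<le> \<eta> * ell2_norm d w + K * real m * C * D"
      by (intro add_right_mono mult_right_mono K\<eta> ell2_norm_nonneg)
    finally show "L2_norm (\<lambda>t. tf_sum X w (dual_comb (window_coeff s)) t - of_real (1 / covolume) * tf_sum X w (cell_fun s) t)
        \<le> \<eta> * ell2_norm d w + K * real m * C * (\<Sum>\<nu>\<in>N. shift_diff \<nu> w)" unfolding D_def .
  qed
qed

text \<open>The size bounds are placed on the approximants f and f', since these will be the vectors
  with explicitly known norms.\<close>

lemma inner_perturbation:
  assumes z: "z \<in> L2" "z' \<in> L2" and f: "f \<in> L2" "f' \<in> L2"
    and near: "L2_norm (\<lambda>t. z t - f t) \<le> e" "L2_norm (\<lambda>t. z' t - f' t) \<le> e"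
    and size: "L2_norm f \<le> c" "L2_norm f' \<le> c"
  shows "cmod (L2_inner z z' - L2_inner f f') \<le> e * (2 * c + e)"
proof -
  have e: "e \<ge> 0" using order_trans[OF L2_norm_nonneg near(1)] .
  have c: "c \<ge> 0" using order_trans[OF L2_norm_nonneg size(1)] .
  have "L2_inner z z' - L2_inner f f' = L2_inner (\<lambda>t. z t - f t) z' + L2_inner f (\<lambda>t. z' t - f' t)"
    using z f by (simp add: L2_inner_diff_left L2_inner_diff_right)
  also have "cmod \<dots> \<le> L2_norm (\<lambda>t. z t - f t) * L2_norm z' + L2_norm f * L2_norm (\<lambda>t. z' t - f' t)"
    by (rule order_trans[OF norm_triangle_ineq]) (intro add_mono L2_Cauchy_Schwarz L2_diff z f)
  also have "\<dots> \<le> e * (e + c) + c * e"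
  proof (intro add_mono mult_mono near size)
    show "L2_norm z' \<le> e + c"
      using L2_norm_diff_abs[OF z(2) f(2)] near(2) size(2) by linarith
  qed (use e c L2_norm_nonneg in auto)
  finally show ?thesis by (simp add: algebra_simps)
qed

section \<open>States of the basis symbols and their Gram matrix\<close>

definition basis_state :: "((real^'n) \<times> (real^'n) \<Rightarrow> complex) \<Rightarrow> int^'n \<Rightarrow> real^'n \<Rightarrow> complex" where
  "basis_state w s = Psi d m g \<gamma> w (basis_vec s)"

lemma Gam_eq_dual_comb:
  "Gam d m g \<gamma> c = dual_comb (\<lambda>r. Hd_inner d c (Zak_vec d (g r) 0 0))"
  by (simp add: Gam_def dual_comb_def)

lemma Gam_basis_vec: "s \<in> Zd d \<Longrightarrow> Gam d m g \<gamma> (basis_vec s) = dual_comb (window_coeff s)"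
  by (simp add: Gam_eq_dual_comb Hd_inner_basis_vec window_coeff_def[abs_def])

text \<open>\<open>Psi\<close> is a chosen limit, so convergence has to be established first;
  \<open>dual_comb_bound\<close> supplies the Bessel estimate.\<close>

lemma Psi_has_sum:
  assumes w: "ell2 d w"
  shows "L2_has_sum (\<lambda>\<mu> t. w \<mu> * Srep d \<mu> (Gam d m g \<gamma> c) t) (Lat d) (Psi d m g \<gamma> w c)"
proof -
  let ?b = "\<lambda>r. Hd_inner d c (Zak_vec d (g r) 0 0)"
  obtain C where C: "C \<ge> 0" "\<And>X w. finite X \<Longrightarrow> X \<subseteq> Lat d \<Longrightarrow>
    L2_norm (tf_sum X w (dual_comb ?b)) \<le> C * L2_set (\<lambda>\<mu>. cmod (w \<mu>)) X"
    by (rule dual_comb_bound[of ?b]) (rule that)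
  have "\<exists>F. L2_has_sum (\<lambda>\<mu> t. w \<mu> * Srep d \<mu> (Gam d m g \<gamma> c) t) (Lat d) F"
  proof (rule L2_has_sum_bessel)
    show "Srep d \<mu> (Gam d m g \<gamma> c) \<in> L2" if "\<mu> \<in> Lat d" for \<mu>
      unfolding Srep_eq_tf_shift[OF that] Gam_eq_dual_comb by (intro tf_shift_L2 dual_comb_L2)
    show "L2_norm (\<lambda>t. \<Sum>\<mu>\<in>X. w \<mu> * Srep d \<mu> (Gam d m g \<gamma> c) t) \<le> C * L2_set (\<lambda>\<mu>. cmod (w \<mu>)) X"
      if X: "finite X" "X \<subseteq> Lat d" for X
    proof -
      have "(\<lambda>t. \<Sum>\<mu>\<in>X. w \<mu> * Srep d \<mu> (Gam d m g \<gamma> c) t) = tf_sum X w (dual_comb ?b)"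
        unfolding Gam_eq_dual_comb by (intro ext Srep_sum_eq_tf_sum X(2))
      then show ?thesis using C(2)[OF X] by simp
    qed
    show "(\<lambda>\<mu>. (cmod (w \<mu>))\<^sup>2) summable_on Lat d" using w by (simp add: ell2_def)
  qed
  then show ?thesis unfolding Psi_def by (rule L2_has_sum_L2_sum)
qed

lemma Psi_L2: "ell2 d w \<Longrightarrow> Psi d m g \<gamma> w c \<in> L2"
  using Psi_has_sum unfolding L2_has_sum_def by blast

lemma basis_state_tendsto:
  assumes w: "ell2 d w" and s: "s \<in> Zd d"
  shows "((\<lambda>X. L2_norm (\<lambda>t. tf_sum X (restrict_seq X w) (dual_comb (window_coeff s)) t - basis_state w s t)) \<longlongrightarrow> 0)
    (finite_subsets_at_top (Lat d))"
proof -
  have "((\<lambda>X. L2_norm (\<lambda>t. (\<Sum>\<mu>\<in>X. w \<mu> * Srep d \<mu> (Gam d m g \<gamma> (basis_vec s)) t) - basis_state w s t)) \<longlongrightarrow> 0)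
      (finite_subsets_at_top (Lat d))"
    using Psi_has_sum[OF w] unfolding L2_has_sum_def basis_state_def by blast
  then show ?thesis
  proof (rule Lim_transform_eventually, intro eventually_finite_subsets_at_topI[of "{}"])
    fix X assume X: "finite X" "X \<subseteq> Lat d"
    have "(\<Sum>\<mu>\<in>X. w \<mu> * Srep d \<mu> (Gam d m g \<gamma> (basis_vec s)) t)
        = tf_sum X (restrict_seq X w) (dual_comb (window_coeff s)) t" for t
      unfolding Gam_basis_vec[OF s] tf_sum_restrict_seq by (rule Srep_sum_eq_tf_sum[OF X(2)])
    then show "L2_norm (\<lambda>t. (\<Sum>\<mu>\<in>X. w \<mu> * Srep d \<mu> (Gam d m g \<gamma> (basis_vec s)) t) - basis_state w s t)
        = L2_norm (\<lambda>t. tf_sum X (restrict_seq X w) (dual_comb (window_coeff s)) t - basis_state w s t)"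
      by simp
  qed auto
qed

text \<open>The right-hand side is the one of \<open>inner_perturbation\<close>, with the error of
  \<open>dual_comb_near_cell_sum_uniform\<close> and the norm of the rescaled cell superposition. It
  is built from the norm and finitely many shift differences, so it is stable under
  truncation.\<close>

lemma basis_state_gram:
  assumes \<eta>: "\<eta> > 0"
  shows "\<exists>N C. finite N \<and> N \<subseteq> Lat d \<and> C \<ge> 0 \<and> (\<forall>w r s. ell2 d w \<longrightarrow> r \<in> Zd d \<longrightarrow> s \<in> Zd d \<longrightarrow>
    cmod (L2_inner (basis_state w r) (basis_state w s) - (if r = s then of_real ((ell2_norm d w)\<^sup>2 / covolume) else 0))
    \<le> (\<eta> * ell2_norm d w + C * (\<Sum>\<nu>\<in>N. shift_diff \<nu> w))
      * (2 * (ell2_norm d w / sqrt covolume) + (\<eta> * ell2_norm d w + C * (\<Sum>\<nu>\<in>N. shift_diff \<nu> w))))"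
proof -
  note \<kappa> = covolume_pos
  obtain N C where N: "finite N" "N \<subseteq> Lat d" "C \<ge> 0" and near: "\<forall>X w s. finite X \<longrightarrow> X \<subseteq> Lat d \<longrightarrow>
      (\<forall>\<mu>. \<mu> \<notin> X \<longrightarrow> w \<mu> = 0) \<longrightarrow> s \<in> Zd d \<longrightarrow>
      L2_norm (\<lambda>t. tf_sum X w (dual_comb (window_coeff s)) t - of_real (1 / covolume) * tf_sum X w (cell_fun s) t)
        \<le> \<eta> * ell2_norm d w + C * (\<Sum>\<nu>\<in>N. shift_diff \<nu> w)"
    using dual_comb_near_cell_sum_uniform[OF \<eta>] by blast
  define err where "err w = \<eta> * ell2_norm d w + C * (\<Sum>\<nu>\<in>N. shift_diff \<nu> w)" for w
  have "cmod (L2_inner (basis_state w r) (basis_state w s) - (if r = s then of_real ((ell2_norm d w)\<^sup>2 / covolume) else 0))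
      \<le> err w * (2 * (ell2_norm d w / sqrt covolume) + err w)"
    if w: "ell2 d w" and r: "r \<in> Zd d" and s: "s \<in> Zd d" for w r s
  \<comment> \<open>Both sides converge along the truncations of the envelope, so the inequality for
    finite support passes to the limit.\<close>
  proof (rule tendsto_le)
    let ?Fl = "finite_subsets_at_top (Lat d)"
    let ?u = "\<lambda>X. restrict_seq X w"
    let ?z = "\<lambda>s X. tf_sum X (?u X) (dual_comb (window_coeff s))"
    let ?f = "\<lambda>s X t. of_real (1 / covolume) * tf_sum X (?u X) (cell_fun s) t"
    have nlim: "((\<lambda>X. ell2_norm d (?u X)) \<longlongrightarrow> ell2_norm d w) ?Fl" by (rule restrict_seq_limits(1)[OF w])
    have elim: "((\<lambda>X. err (?u X)) \<longlongrightarrow> err w) ?Fl"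
      unfolding err_def using N by (intro tendsto_intros nlim restrict_seq_limits(2)[OF w]) auto
    show "((\<lambda>X. err (?u X) * (2 * (ell2_norm d (?u X) / sqrt covolume) + err (?u X)))
        \<longlongrightarrow> err w * (2 * (ell2_norm d w / sqrt covolume) + err w)) ?Fl"
      using \<kappa> by (intro tendsto_intros elim nlim) auto
    have glim: "((\<lambda>X. L2_inner (?z r X) (?z s X)) \<longlongrightarrow> L2_inner (basis_state w r) (basis_state w s)) ?Fl"
      using w by (intro L2_inner_tendsto basis_state_tendsto r s always_eventually allI tf_sum_L2 dual_comb_L2)
        (auto simp: basis_state_def Psi_L2)
    have dlim: "((\<lambda>X. if r = s then complex_of_real ((ell2_norm d (?u X))\<^sup>2 / covolume) else 0)
        \<longlongrightarrow> (if r = s then of_real ((ell2_norm d w)\<^sup>2 / covolume) else 0)) ?Fl"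
    proof (cases "r = s")
      case True
      have "((\<lambda>X. complex_of_real ((ell2_norm d (?u X))\<^sup>2 / covolume)) \<longlongrightarrow> of_real ((ell2_norm d w)\<^sup>2 / covolume)) ?Fl"
        using \<kappa> by (intro tendsto_of_real tendsto_intros nlim) auto
      with True show ?thesis by simp
    qed simp
    show "((\<lambda>X. cmod (L2_inner (?z r X) (?z s X) - (if r = s then of_real ((ell2_norm d (?u X))\<^sup>2 / covolume) else 0)))
        \<longlongrightarrow> cmod (L2_inner (basis_state w r) (basis_state w s) - (if r = s then of_real ((ell2_norm d w)\<^sup>2 / covolume) else 0))) ?Fl"
      by (intro tendsto_norm tendsto_diff glim dlim)
    show "eventually (\<lambda>X. cmod (L2_inner (?z r X) (?z s X) - (if r = s then of_real ((ell2_norm d (?u X))\<^sup>2 / covolume) else 0))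
        \<le> err (?u X) * (2 * (ell2_norm d (?u X) / sqrt covolume) + err (?u X))) ?Fl"
    proof (rule eventually_finite_subsets_at_topI[of "{}"])
      fix X assume X: "finite X" "X \<subseteq> Lat d"
      note supp = restrict_seq_support[of X w]
      let ?n = "ell2_norm d (?u X)"
      have n: "?n = L2_set (\<lambda>\<mu>. cmod (?u X \<mu>)) X"
        by (rule ell2_finite_support(2)[where w = "?u X", OF X supp])
      \<comment> \<open>The cell superposition has norm sqrt covolume times the norm of its
        coefficients, and the prefactor is 1 / covolume.\<close>
      have sizes: "L2_norm (?f s X) \<le> ?n / sqrt covolume" for s
      proof -
        have "L2_norm (?f s X) = 1 / covolume * (sqrt covolume * ?n)"
          unfolding L2_norm_cmult norm_of_real tf_sum_cell_norm[OF X] n using \<kappa> by simp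
        also have "\<dots> = ?n / sqrt covolume"
          using \<kappa> real_sqrt_mult_self[of covolume] by (simp add: field_simps)
        finally show ?thesis by simp
      qed
      have "L2_inner (?f r X) (?f s X)
          = of_real (1 / covolume) * (of_real (1 / covolume) * (if r = s then of_real (covolume * ?n\<^sup>2) else 0))"
        unfolding L2_inner_cmult_left L2_inner_cmult_right complex_cnj_complex_of_real cell_sum_inner[OF X r s] n ..
      also have "\<dots> = (if r = s then of_real (?n\<^sup>2 / covolume) else 0)"
        using \<kappa> by simp
      finally have ff: "L2_inner (?f r X) (?f s X) = (if r = s then of_real (?n\<^sup>2 / covolume) else 0)" .
      show "cmod (L2_inner (?z r X) (?z s X) - (if r = s then of_real (?n\<^sup>2 / covolume) else 0))
          \<le> err (?u X) * (2 * (?n / sqrt covolume) + err (?u X))"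
        unfolding ff[symmetric]
      proof (rule inner_perturbation)
        show "L2_norm (\<lambda>t. ?z r X t - ?f r X t) \<le> err (?u X)" "L2_norm (\<lambda>t. ?z s X t - ?f s X t) \<le> err (?u X)"
          unfolding err_def using near[rule_format, where w = "?u X", OF X] supp r s by blast+
      qed (intro sizes tf_sum_L2 L2_cmult cell_fun_L2 dual_comb_L2)+
    qed auto
  qed simp
  then show ?thesis unfolding err_def using N by blast
qed

text \<open>Being a chosen limit, \<open>Psi\<close> is linear in c only almost everywhere, by
  uniqueness of limits. After pairing with F this suffices.\<close>

lemma Psi_expansion:
  assumes w: "ell2 d w" and c: "c \<in> Hd d" and F: "F \<in> L2"
  shows "L2_inner (Psi d m g \<gamma> w c) F = (\<Sum>r\<in>Zd d. c r * L2_inner (basis_state w r) F)"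
proof -
  have Gam: "Gam d m g \<gamma> c = (\<lambda>t. \<Sum>r\<in>Zd d. c r * Gam d m g \<gamma> (basis_vec r) t)"
  proof
    fix t
    have "(\<Sum>r\<in>Zd d. c r * Gam d m g \<gamma> (basis_vec r) t)
        = (\<Sum>r\<in>Zd d. \<Sum>j\<in>{1..m}. c r * cnj (Zak_vec d (g j) 0 0 r) * \<gamma> j t)"
      by (intro sum.cong refl) (simp add: Gam_basis_vec dual_comb_def window_coeff_def sum_distrib_left mult.assoc)
    also have "\<dots> = (\<Sum>j\<in>{1..m}. \<Sum>r\<in>Zd d. c r * cnj (Zak_vec d (g j) 0 0 r) * \<gamma> j t)" by (rule sum.swap)
    also have "\<dots> = Gam d m g \<gamma> c t" by (simp add: Gam_def Hd_inner_def sum_distrib_right)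
    finally show "Gam d m g \<gamma> c t = (\<Sum>r\<in>Zd d. c r * Gam d m g \<gamma> (basis_vec r) t)" ..
  qed
  have eq: "(\<lambda>\<mu> t. w \<mu> * Srep d \<mu> (Gam d m g \<gamma> c) t)
      = (\<lambda>\<mu> t. \<Sum>r\<in>Zd d. c r * (w \<mu> * Srep d \<mu> (Gam d m g \<gamma> (basis_vec r)) t))"
    unfolding Srep_def rho_eq_tf_shift
    by (subst Gam) (simp add: tf_shift_sum tf_shift_cmult sum_distrib_left mult_ac)
  have "L2_has_sum (\<lambda>\<mu> t. w \<mu> * Srep d \<mu> (Gam d m g \<gamma> c) t) (Lat d) (\<lambda>t. \<Sum>r\<in>Zd d. c r * basis_state w r t)"
    unfolding eq basis_state_def
    by (intro L2_has_sum_sum finite_Zd Zd_nonempty L2_has_sum_cmult Psi_has_sum w)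
  from L2_has_sum_unique[OF Psi_has_sum[OF w] this]
  have ae: "AE t in lborel. Psi d m g \<gamma> w c t = (\<Sum>r\<in>Zd d. c r * basis_state w r t)" .
  have b: "basis_state w r \<in> L2" for r unfolding basis_state_def by (rule Psi_L2[OF w])
  have "L2_inner (Psi d m g \<gamma> w c) F = L2_inner (\<lambda>t. \<Sum>r\<in>Zd d. c r * basis_state w r t) F"
    by (rule L2_inner_cong_AE[OF Psi_L2[OF w] L2_finite_sum[OF L2_cmult[OF b]] F ae])
  also have "\<dots> = (\<Sum>r\<in>Zd d. c r * L2_inner (basis_state w r) F)"
    by (subst L2_inner_sum_left[OF L2_cmult[OF b] F]) (simp add: L2_inner_cmult_left)
  finally show ?thesis .
qed

definition gram :: "((real^'n) \<times> (real^'n) \<Rightarrow> complex) \<Rightarrow> int^'n \<Rightarrow> int^'n \<Rightarrow> complex" where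
  "gram w r s = L2_inner (basis_state w r) (basis_state w s)
    / of_real (sqrt (real (\<Prod>j\<in>UNIV. d j)) * (ell2_norm d w)\<^sup>2)"

text \<open>Entrywise distance of the Gram matrix from the identity. It dominates both the operator
  norm and the sesquilinear form on bounded sets, so both forms of the conclusion follow from one
  limit.\<close>

definition gram_defect :: "((real^'n) \<times> (real^'n) \<Rightarrow> complex) \<Rightarrow> real" where
  "gram_defect w = (\<Sum>r\<in>Zd d. \<Sum>s\<in>Zd d. cmod (gram w r s - (if r = s then 1 else 0)))"

lemma Psi_gram:
  assumes w: "ell2 d w" and c: "c \<in> Hd d" and c': "c' \<in> Hd d"
  shows "L2_inner (Psi d m g \<gamma> w c) (Psi d m g \<gamma> w c') / of_real (sqrt (real (\<Prod>j\<in>UNIV. d j)) * (ell2_norm d w)\<^sup>2)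
    = (\<Sum>r\<in>Zd d. \<Sum>s\<in>Zd d. c r * cnj (c' s) * gram w r s)"
proof -
  have b: "basis_state w r \<in> L2" for r unfolding basis_state_def by (rule Psi_L2[OF w])
  have "L2_inner (basis_state w r) (Psi d m g \<gamma> w c') = (\<Sum>s\<in>Zd d. cnj (c' s) * L2_inner (basis_state w r) (basis_state w s))" for r
  proof -
    have "L2_inner (basis_state w r) (Psi d m g \<gamma> w c') = cnj (\<Sum>s\<in>Zd d. c' s * L2_inner (basis_state w s) (basis_state w r))"
      by (subst L2_inner_sym) (simp only: Psi_expansion[OF w c' b])
    also have "\<dots> = (\<Sum>s\<in>Zd d. cnj (c' s) * L2_inner (basis_state w r) (basis_state w s))"
      unfolding cnj_sum complex_cnj_mult by (intro sum.cong refl arg_cong2[where f = "(*)"]) (rule L2_inner_sym[symmetric])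
    finally show ?thesis .
  qed
  then show ?thesis
    unfolding Psi_expansion[OF w c Psi_L2[OF w]] gram_def
    by (simp only: sum_distrib_left sum_divide_distrib times_divide_eq_right mult.assoc)
qed

lemma gram_sum_bound:
  assumes c: "\<And>r. r \<in> Zd d \<Longrightarrow> cmod (c r) \<le> R" and c': "\<And>r. r \<in> Zd d \<Longrightarrow> cmod (c' r) \<le> R'" and R: "R \<ge> 0"
  shows "cmod ((\<Sum>r\<in>Zd d. \<Sum>s\<in>Zd d. c r * cnj (c' s) * gram w r s) - Hd_inner d c c') \<le> R * R' * gram_defect w"
proof -
  have "Hd_inner d c c' = (\<Sum>r\<in>Zd d. \<Sum>s\<in>Zd d. c r * cnj (c' s) * (if r = s then 1 else 0))"
    unfolding Hd_inner_def
  proof (intro sum.cong refl)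
    fix r assume r: "r \<in> Zd d"
    have "(\<Sum>s\<in>Zd d. c r * cnj (c' s) * (if r = s then 1 else 0)) = (\<Sum>s\<in>Zd d. if r = s then c r * cnj (c' s) else 0)"
      by (intro sum.cong refl) simp
    then show "c r * cnj (c' r) = (\<Sum>s\<in>Zd d. c r * cnj (c' s) * (if r = s then 1 else 0))"
      using r finite_Zd by (simp add: sum.delta)
  qed
  then have "(\<Sum>r\<in>Zd d. \<Sum>s\<in>Zd d. c r * cnj (c' s) * gram w r s) - Hd_inner d c c'
      = (\<Sum>r\<in>Zd d. \<Sum>s\<in>Zd d. c r * cnj (c' s) * (gram w r s - (if r = s then 1 else 0)))"
    by (simp only: sum_subtractf[symmetric] right_diff_distrib)
  also have "cmod \<dots> \<le> (\<Sum>r\<in>Zd d. \<Sum>s\<in>Zd d. R * R' * cmod (gram w r s - (if r = s then 1 else 0)))"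
    unfolding norm_mult complex_mod_cnj
    by (intro sum_norm_le order_trans[OF norm_sum] sum_mono)
      (unfold norm_mult complex_mod_cnj, intro mult_right_mono mult_mono c c' R, auto)
  also have "\<dots> = R * R' * gram_defect w"
    by (simp only: gram_defect_def sum_distrib_left)
  finally show ?thesis .
qed

lemma gram_defect_tendsto:
  fixes w :: "real \<Rightarrow> (real^'n) \<times> (real^'n) \<Rightarrow> complex"
  assumes w: "\<And>\<epsilon>. \<epsilon> > 0 \<Longrightarrow> ell2 d (w \<epsilon>)" and pos: "\<And>\<epsilon>. \<epsilon> > 0 \<Longrightarrow> ell2_norm d (w \<epsilon>) > 0"
    and shift: "\<And>\<nu>. \<nu> \<in> Lat d \<Longrightarrow> ((\<lambda>\<epsilon>. shift_diff \<nu> (w \<epsilon>) / ell2_norm d (w \<epsilon>)) \<longlongrightarrow> 0) (at_right 0)"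
  shows "((\<lambda>\<epsilon>. gram_defect (w \<epsilon>)) \<longlongrightarrow> 0) (at_right 0)"
  unfolding gram_defect_def
proof (intro tendsto_null_sum tendsto_norm_zero tendstoI)
  note \<kappa> = covolume_pos
  fix r s and \<tau> :: real assume r: "r \<in> Zd d" and s: "s \<in> Zd d" and \<tau>: "\<tau> > 0"
  \<comment> \<open>The square of \<open>a\<close> is sqrt d, the limit of the diagonal Gram entries
    relative to the squared norm of the envelope.\<close>
  define a where "a = 1 / sqrt covolume"
  have a: "a > 0" using \<kappa> by (simp add: a_def)
  have a2: "1 / covolume = a\<^sup>2" using \<kappa> by (simp add: a_def power_divide)
  \<comment> \<open>Chosen so that a relative error x below 2 \<eta> satisfies x (2 a + x) < \<tau>
    a^2; the bound 1 enters through 2 a + x \<le> 2 a + 2.\<close>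
  define \<eta> where "\<eta> = min 1 (\<tau> * a\<^sup>2 / (8 * a + 8))"
  have \<eta>: "\<eta> > 0" "\<eta> \<le> 1" using \<tau> a by (auto simp: \<eta>_def)
  have \<eta>\<tau>: "2 * \<eta> * (2 * a + 2) < \<tau> * a\<^sup>2"
  proof -
    have "\<eta> * (8 * a + 8) \<le> \<tau> * a\<^sup>2"
      using a by (simp add: \<eta>_def min_def pos_le_divide_eq[symmetric])
    moreover have "0 < \<eta> * a" using \<eta> a by simp
    then have "2 * \<eta> * (2 * a + 2) < \<eta> * (8 * a + 8)" using \<eta> by (simp add: algebra_simps)
    ultimately show ?thesis by linarith
  qed
  obtain N C where N: "finite N" "N \<subseteq> Lat d" "C \<ge> 0" and gb: "\<forall>w r s. ell2 d w \<longrightarrow> r \<in> Zd d \<longrightarrow> s \<in> Zd d \<longrightarrow>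
    cmod (L2_inner (basis_state w r) (basis_state w s) - (if r = s then of_real ((ell2_norm d w)\<^sup>2 / covolume) else 0))
    \<le> (\<eta> * ell2_norm d w + C * (\<Sum>\<nu>\<in>N. shift_diff \<nu> w))
      * (2 * (ell2_norm d w / sqrt covolume) + (\<eta> * ell2_norm d w + C * (\<Sum>\<nu>\<in>N. shift_diff \<nu> w)))"
    using basis_state_gram[OF \<eta>(1)] by blast
  \<comment> \<open>The error divided by the norm of the envelope. Its shift part tends to 0 because
    \<open>N\<close> is finite.\<close>
  let ?x = "\<lambda>\<epsilon>. \<eta> + C * (\<Sum>\<nu>\<in>N. shift_diff \<nu> (w \<epsilon>) / ell2_norm d (w \<epsilon>))"
  have "(?x \<longlongrightarrow> \<eta> + C * (\<Sum>\<nu>\<in>N. 0)) (at_right 0)"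
    using N(2) by (intro tendsto_intros shift) auto
  then have "(?x \<longlongrightarrow> \<eta>) (at_right 0)" by simp
  then have "eventually (\<lambda>\<epsilon>. ?x \<epsilon> < 2 * \<eta>) (at_right 0)"
    using \<eta> by (intro order_tendstoD) auto
  moreover have "eventually (\<lambda>\<epsilon>::real. \<epsilon> > 0) (at_right 0)" by (rule eventually_at_right_less)
  ultimately show "eventually (\<lambda>\<epsilon>. dist (gram (w \<epsilon>) r s - (if r = s then 1 else 0)) 0 < \<tau>) (at_right 0)"
  proof eventually_elim
    case (elim \<epsilon>)
    define n where "n = ell2_norm d (w \<epsilon>)"
    have n: "n > 0" unfolding n_def by (rule pos[OF elim(2)])
    define x where "x = ?x \<epsilon>"
    have x0: "x \<ge> 0"
      unfolding x_def using \<eta> N(3) n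
      by (intro add_nonneg_nonneg mult_nonneg_nonneg sum_nonneg divide_nonneg_pos shift_diff_nonneg) (auto simp: n_def)
    have err: "\<eta> * n + C * (\<Sum>\<nu>\<in>N. shift_diff \<nu> (w \<epsilon>)) = n * x"
      using n unfolding x_def n_def[symmetric] sum_divide_distrib[symmetric] by (simp add: field_simps)
    let ?I = "L2_inner (basis_state (w \<epsilon>) r) (basis_state (w \<epsilon>) s)"
    have D: "sqrt (real (\<Prod>j\<in>UNIV. d j)) * n\<^sup>2 = a\<^sup>2 * n\<^sup>2"
      using covolume_inverse a2 by simp
    have Dpos: "a\<^sup>2 * n\<^sup>2 > 0" using a n by simp
    have "cmod (?I - (if r = s then of_real (a\<^sup>2 * n\<^sup>2) else 0)) \<le> (n * x) * (2 * (n * a) + n * x)"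
    proof -
      have "n\<^sup>2 / covolume = (1 / covolume) * n\<^sup>2" by simp
      then have n2: "n\<^sup>2 / covolume = a\<^sup>2 * n\<^sup>2" unfolding a2 .
      have na: "n / sqrt covolume = n * a" by (simp add: a_def)
      show ?thesis
        using gb[rule_format, OF w[OF elim(2)] r s] unfolding n_def[symmetric] err n2 na .
    qed
    also have "\<dots> = n\<^sup>2 * (x * (2 * a + x))" by (simp add: power2_eq_square algebra_simps)
    also have "x * (2 * a + x) < \<tau> * a\<^sup>2"
    proof -
      have "x * (2 * a + x) \<le> (2 * \<eta>) * (2 * a + 2)"
        using elim(1) x0 \<eta> a by (intro mult_mono) (auto simp: x_def[symmetric])
      then show ?thesis using \<eta>\<tau> by linarith
    qed
    finally have fin: "cmod (?I - (if r = s then of_real (a\<^sup>2 * n\<^sup>2) else 0)) < \<tau> * (a\<^sup>2 * n\<^sup>2)"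
      using n by (simp add: mult_ac)
    have "gram (w \<epsilon>) r s - (if r = s then 1 else 0) = (?I - (if r = s then of_real (a\<^sup>2 * n\<^sup>2) else 0)) / of_real (a\<^sup>2 * n\<^sup>2)"
      unfolding gram_def n_def[symmetric] D using Dpos by (auto simp: diff_divide_distrib)
    then have "cmod (gram (w \<epsilon>) r s - (if r = s then 1 else 0)) = cmod (?I - (if r = s then of_real (a\<^sup>2 * n\<^sup>2) else 0)) / (a\<^sup>2 * n\<^sup>2)"
      using Dpos by (simp only: norm_divide norm_of_real abs_of_pos)
    also have "\<dots> < \<tau>" using fin Dpos by (simp only: pos_divide_less_eq)
    finally show ?case by simp
  qed
qed

text \<open>\<open>Hd_adjoint\<close> is a choice, so an adjoint must be exhibited: its components
  are conjugated inner products with the basis states. Testing the chosen adjoint on basis vectors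
  then determines its components.\<close>

lemma Hd_adjoint_Eop:
  assumes w: "ell2 d w" and n: "ell2_norm d w > 0" and c: "c \<in> Hd d"
  shows "Hd_adjoint d (Eop d m g \<gamma> w) (Eop d m g \<gamma> w c) \<in> Hd d"
    and "r \<in> Zd d \<Longrightarrow> Hd_adjoint d (Eop d m g \<gamma> w) (Eop d m g \<gamma> w c) r = (\<Sum>s\<in>Zd d. c s * cnj (gram w r s))"
proof -
  let ?E = "Eop d m g \<gamma> w"
  define p where "p = real (\<Prod>j\<in>UNIV. d j)"
  have p: "p > 0" unfolding p_def using d_pos by (simp add: prod_pos)
  define \<alpha> where "\<alpha> = p powr (- 1 / 4) / ell2_norm d w"
  \<comment> \<open>The operator occurs twice, so the exponent -1/4 is doubled and the normalisation
    of \<open>gram\<close> results.\<close>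
  have \<alpha>2: "\<alpha> * \<alpha> = 1 / (sqrt p * (ell2_norm d w)\<^sup>2)"
  proof -
    have "p powr (- 1 / 4) * p powr (- 1 / 4) = 1 / sqrt p"
      using p by (simp add: powr_add[symmetric] powr_minus_divide powr_half_sqrt)
    then show ?thesis by (simp add: \<alpha>_def power2_eq_square)
  qed
  have E: "?E c = (\<lambda>t. of_real \<alpha> * Psi d m g \<gamma> w c t)" for c
    by (simp add: Eop_def \<alpha>_def p_def)
  have EL: "?E c \<in> L2" for c unfolding E by (intro L2_cmult Psi_L2 w)
  let ?prop = "\<lambda>T. \<forall>F\<in>L2. T F \<in> Hd d \<and> (\<forall>c\<in>Hd d. L2_inner (?E c) F = Hd_inner d c (T F))"
  have "?prop (\<lambda>F r. if r \<in> Zd d then cnj (of_real \<alpha> * L2_inner (basis_state w r) F) else 0)"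
  proof (intro ballI conjI)
    fix F :: "real^'n \<Rightarrow> complex" and c assume F: "F \<in> L2" and c: "c \<in> Hd d"
    show "L2_inner (?E c) F = Hd_inner d c (\<lambda>r. if r \<in> Zd d then cnj (of_real \<alpha> * L2_inner (basis_state w r) F) else 0)"
      unfolding E L2_inner_cmult_left Psi_expansion[OF w c F] Hd_inner_def sum_distrib_left
      by (intro sum.cong refl) simp
  qed (simp add: Hd_def)
  then have adj: "?prop (Hd_adjoint d ?E)"
    unfolding Hd_adjoint_def by (rule someI[where P = ?prop])
  show H: "Hd_adjoint d ?E (?E c) \<in> Hd d" using adj EL by blast
  assume r: "r \<in> Zd d"
  have "cnj (Hd_adjoint d ?E (?E c) r) = L2_inner (?E (basis_vec r)) (?E c)"
    using adj[rule_format, OF EL[of c]] basis_vec_Hd[OF r] by (simp add: Hd_inner_basis_vec[OF r])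
  also have "\<dots> = of_real (\<alpha> * \<alpha>) * L2_inner (Psi d m g \<gamma> w (basis_vec r)) (Psi d m g \<gamma> w c)"
    unfolding E L2_inner_cmult_left L2_inner_cmult_right by simp
  also have "\<dots> = L2_inner (Psi d m g \<gamma> w (basis_vec r)) (Psi d m g \<gamma> w c)
      / of_real (sqrt (real (\<Prod>j\<in>UNIV. d j)) * (ell2_norm d w)\<^sup>2)"
    unfolding \<alpha>2 p_def by simp
  also have "\<dots> = (\<Sum>r'\<in>Zd d. \<Sum>s\<in>Zd d. basis_vec r r' * cnj (c s) * gram w r' s)"
    by (rule Psi_gram[OF w basis_vec_Hd[OF r] c])
  also have "\<dots> = (\<Sum>r'\<in>Zd d. if r' = r then (\<Sum>s\<in>Zd d. cnj (c s) * gram w r' s) else 0)"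
    by (intro sum.cong refl) (auto simp: basis_vec_def)
  also have "\<dots> = (\<Sum>s\<in>Zd d. cnj (c s) * gram w r s)"
    using r finite_Zd by (simp add: sum.delta)
  finally have "cnj (cnj (Hd_adjoint d ?E (?E c) r)) = cnj (\<Sum>s\<in>Zd d. cnj (c s) * gram w r s)" by simp
  then show "Hd_adjoint d ?E (?E c) r = (\<Sum>s\<in>Zd d. c s * cnj (gram w r s))" by simp
qed

text \<open>Coordinates of a symbol of norm at most 1 have modulus at most 1, so the entrywise sum
  bounds the operator norm. For the lower bound the zero symbol is a witness, once the supremum is
  known to be over a bounded set.\<close>

lemma Hd_opnorm_defect:
  assumes w: "ell2 d w" and n: "ell2_norm d w > 0"
  shows "0 \<le> Hd_opnorm d (\<lambda>c r. Hd_adjoint d (Eop d m g \<gamma> w) (Eop d m g \<gamma> w c) r - c r)"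
    and "Hd_opnorm d (\<lambda>c r. Hd_adjoint d (Eop d m g \<gamma> w) (Eop d m g \<gamma> w c) r - c r) \<le> gram_defect w"
proof -
  let ?T = "\<lambda>c r. Hd_adjoint d (Eop d m g \<gamma> w) (Eop d m g \<gamma> w c) r - c r"
  let ?S = "{c \<in> Hd d. Hd_norm d c \<le> 1}"
  have le: "Hd_norm d (?T c) \<le> gram_defect w" if c: "c \<in> ?S" for c
  proof -
    have "Hd_norm d (?T c) \<le> (\<Sum>r\<in>Zd d. cmod (?T c r))" by (rule Hd_norm_le_sum)
    also have "\<dots> \<le> gram_defect w"
      unfolding gram_defect_def
    proof (rule sum_mono)
      fix r assume r: "r \<in> Zd d"
      have "(\<Sum>s\<in>Zd d. c s * cnj (if r = s then 1 else 0)) = (\<Sum>s\<in>Zd d. if r = s then c s else 0)"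
        by (intro sum.cong refl) simp
      also have "\<dots> = c r" using r finite_Zd by (simp add: sum.delta)
      finally have cr: "c r = (\<Sum>s\<in>Zd d. c s * cnj (if r = s then 1 else 0))" ..
      have "?T c r = (\<Sum>s\<in>Zd d. c s * cnj (gram w r s)) - c r"
        using Hd_adjoint_Eop(2)[OF w n _ r] c by simp
      also have "\<dots> = (\<Sum>s\<in>Zd d. c s * cnj (gram w r s - (if r = s then 1 else 0)))"
        by (subst cr) (simp only: sum_subtractf[symmetric] right_diff_distrib complex_cnj_diff)
      also have "cmod \<dots> \<le> (\<Sum>s\<in>Zd d. cmod (gram w r s - (if r = s then 1 else 0)))"
      proof (rule sum_norm_le)
        fix s assume s: "s \<in> Zd d"
        have "cmod (c s) \<le> 1" using Hd_component_le[OF s, of c] c by simp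
        then show "cmod (c s * cnj (gram w r s - (if r = s then 1 else 0))) \<le> cmod (gram w r s - (if r = s then 1 else 0))"
          unfolding norm_mult complex_mod_cnj by (rule mult_left_le_one_le[rotated 2]) auto
      qed
      finally show "cmod (?T c r) \<le> (\<Sum>s\<in>Zd d. cmod (gram w r s - (if r = s then 1 else 0)))" .
    qed
    finally show ?thesis .
  qed
  have z: "(\<lambda>r. 0) \<in> ?S" by (simp add: Hd_def Hd_norm_def)
  show "Hd_opnorm d ?T \<le> gram_defect w"
    unfolding Hd_opnorm_def using z le by (intro cSUP_least) auto
  have "0 \<le> Hd_norm d (?T (\<lambda>r. 0))" by (simp add: Hd_norm_def sum_nonneg)
  also have "\<dots> \<le> Hd_opnorm d ?T"
    unfolding Hd_opnorm_def using z le by (intro cSUP_upper bdd_aboveI2[where M = "gram_defect w"]) auto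
  finally show "0 \<le> Hd_opnorm d ?T" .
qed

end

theorem theorem6p3:
  fixes d :: "'n::{finite, linorder} \<Rightarrow> nat"
    and \<phi> :: "real^('n::{finite, linorder}) \<Rightarrow> complex"
    and m :: nat
    and g \<gamma> :: "nat \<Rightarrow> real^('n::{finite, linorder}) \<Rightarrow> complex"
    and w :: "real \<Rightarrow> (real^('n::{finite, linorder})) \<times> (real^('n::{finite, linorder})) \<Rightarrow> complex"
  assumes d_pos: "\<forall>j. d j > 0"
    and d_dvd: "\<forall>i j. i \<le> j \<longrightarrow> d i dvd d j"
    and phi: "schwartz \<phi>" "\<phi> \<noteq> (\<lambda>t. 0)"
    and g_M1: "\<forall>j\<in>{1..m}. g j \<in> M1 \<phi>"
    and frame: "gabor_frame d m g"
    and dual: "canonical_dual d m g \<gamma>"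
    and w_ell2: "\<forall>\<epsilon>>0. ell2 d (w \<epsilon>)"
    and w_nonzero: "\<forall>\<epsilon>>0. \<exists>\<mu>\<in>Lat d. w \<epsilon> \<mu> \<noteq> 0"
    and w_shift: "\<forall>\<nu>\<in>Lat d.
      ((\<lambda>\<epsilon>. ell2_norm d (\<lambda>\<mu>. w \<epsilon> (\<mu> - \<nu>) - w \<epsilon> \<mu>) / ell2_norm d (w \<epsilon>)) \<longlongrightarrow> 0) (at_right 0)"
  shows "((\<lambda>\<epsilon>. Hd_opnorm d (\<lambda>c r.
           Hd_adjoint d (Eop d m g \<gamma> (w \<epsilon>)) (Eop d m g \<gamma> (w \<epsilon>) c) r - c r)) \<longlongrightarrow> 0) (at_right 0)
    \<and> (\<forall>B. B \<subseteq> Hd d \<and> (\<exists>R. \<forall>c\<in>B. Hd_norm d c \<le> R) \<longrightarrow>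
        uniform_limit (B \<times> B)
          (\<lambda>\<epsilon> (c, c'). L2_inner (Psi d m g \<gamma> (w \<epsilon>) c) (Psi d m g \<gamma> (w \<epsilon>) c')
             / of_real (sqrt (real (\<Prod>j\<in>UNIV. d j)) * (ell2_norm d (w \<epsilon>))\<^sup>2))
          (\<lambda>(c, c'). Hd_inner d c c')
          (at_right 0))"
proof -
  obtain A B where AB: "0 < A" "0 < B" and fr: "\<forall>f\<in>L2.
       (\<lambda>(\<mu>, j). (cmod (L2_inner f (rho \<mu> (g j))))\<^sup>2) summable_on (Lat d \<times> {1..m}) \<and>
       A * (L2_norm f)\<^sup>2
         \<le> (\<Sum>\<^sub>\<infinity>(\<mu>, j)\<in>Lat d \<times> {1..m}. (cmod (L2_inner f (rho \<mu> (g j))))\<^sup>2) \<and>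
       (\<Sum>\<^sub>\<infinity>(\<mu>, j)\<in>Lat d \<times> {1..m}. (cmod (L2_inner f (rho \<mu> (g j))))\<^sup>2)
         \<le> B * (L2_norm f)\<^sup>2"
    using frame unfolding gabor_frame_def by blast
  have conv: "(\<lambda>(\<mu>, j). (cmod (L2_inner f (rho \<mu> (g j))))\<^sup>2)
      = (\<lambda>i. (cmod (L2_inner f (tf_shift (fst i) (g (snd i)))))\<^sup>2)" for f
    by (simp add: fun_eq_iff rho_coefficient(2))
  interpret gabor_frame_dual d m g \<gamma> A B
  proof
    show "0 < d j" for j using d_pos by blast
    show "g j \<in> L2" "continuous_on UNIV (g j)" if "j \<in> {1..m}" for j
      using g_M1 that by (auto simp: M1_def)
    show "\<exists>M. M summable_on UNIV \<and> (\<forall>t. cmod (g j t) \<le> M (cell_index d t))" if "j \<in> {1..m}" for j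
      by (rule M1_majorant[OF d_pos phi g_M1[rule_format, OF that]]) blast
    show "\<gamma> j \<in> L2" "AE t in lborel. frame_op d m g (\<gamma> j) t = g j t" if "j \<in> {1..m}" for j
      using dual that by (auto simp: canonical_dual_def)
  qed (use AB fr[unfolded conv] in auto)
  have w: "ell2 d (w \<epsilon>)" if "\<epsilon> > 0" for \<epsilon> using w_ell2 that by blast
  \<comment> \<open>A single nonzero entry bounds the norm from below, which makes the normalisation
    meaningful.\<close>
  have pos: "ell2_norm d (w \<epsilon>) > 0" if \<epsilon>: "\<epsilon> > 0" for \<epsilon>
  proof -
    obtain \<mu> where \<mu>: "\<mu> \<in> Lat d" "w \<epsilon> \<mu> \<noteq> 0" using w_nonzero \<epsilon> by blast
    have "cmod (w \<epsilon> \<mu>) \<le> ell2_norm d (w \<epsilon>)"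
      using L2_set_le_ell2_norm[OF w[OF \<epsilon>], of "{\<mu>}"] \<mu> by simp
    moreover have "0 < cmod (w \<epsilon> \<mu>)" using \<mu> by simp
    ultimately show ?thesis by linarith
  qed
  have defect: "((\<lambda>\<epsilon>. gram_defect (w \<epsilon>)) \<longlongrightarrow> 0) (at_right 0)"
    by (rule gram_defect_tendsto) (use w pos w_shift in \<open>auto simp: shift_diff_def\<close>)
  have ev: "eventually (\<lambda>\<epsilon>::real. \<epsilon> > 0) (at_right 0)" by (rule eventually_at_right_less)
  show ?thesis
  proof (intro conjI allI impI)
    show "((\<lambda>\<epsilon>. Hd_opnorm d (\<lambda>c r.
           Hd_adjoint d (Eop d m g \<gamma> (w \<epsilon>)) (Eop d m g \<gamma> (w \<epsilon>) c) r - c r)) \<longlongrightarrow> 0) (at_right 0)"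
      by (rule tendsto_sandwich[OF _ _ tendsto_const defect];
          use ev in eventually_elim; intro Hd_opnorm_defect w pos)
  next
    fix Bs assume Bs: "Bs \<subseteq> Hd d \<and> (\<exists>R. \<forall>c\<in>Bs. Hd_norm d c \<le> R)"
    then obtain R where R: "\<And>c. c \<in> Bs \<Longrightarrow> Hd_norm d c \<le> R" by blast
    show "uniform_limit (Bs \<times> Bs)
          (\<lambda>\<epsilon> (c, c'). L2_inner (Psi d m g \<gamma> (w \<epsilon>) c) (Psi d m g \<gamma> (w \<epsilon>) c')
             / of_real (sqrt (real (\<Prod>j\<in>UNIV. d j)) * (ell2_norm d (w \<epsilon>))\<^sup>2))
          (\<lambda>(c, c'). Hd_inner d c c')
          (at_right 0)"
      unfolding uniform_limit_iff
    proof (intro allI impI)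
      fix e :: real assume e: "e > 0"
      \<comment> \<open>The absolute value takes care of an empty \<open>Bs\<close>, for which
        \<open>R\<close> may be negative.\<close>
      have "((\<lambda>\<epsilon>. \<bar>R\<bar> * \<bar>R\<bar> * gram_defect (w \<epsilon>)) \<longlongrightarrow> 0) (at_right 0)"
        by (rule tendsto_mult_right_zero[OF defect])
      then have "eventually (\<lambda>\<epsilon>. \<bar>R\<bar> * \<bar>R\<bar> * gram_defect (w \<epsilon>) < e) (at_right 0)"
        using e by (rule order_tendstoD)
      then show "eventually (\<lambda>\<epsilon>. \<forall>p\<in>Bs \<times> Bs. dist
          (case p of (c, c') \<Rightarrow> L2_inner (Psi d m g \<gamma> (w \<epsilon>) c) (Psi d m g \<gamma> (w \<epsilon>) c')
             / of_real (sqrt (real (\<Prod>j\<in>UNIV. d j)) * (ell2_norm d (w \<epsilon>))\<^sup>2))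
          (case p of (c, c') \<Rightarrow> Hd_inner d c c') < e) (at_right 0)"
        using ev
      proof eventually_elim
        case (elim \<epsilon>)
        show ?case
        proof
          fix p assume "p \<in> Bs \<times> Bs"
          then obtain c c' where p: "p = (c, c')" and c: "c \<in> Bs" "c' \<in> Bs" by blast
          have H: "c \<in> Hd d" "c' \<in> Hd d" using c Bs by blast+
          have bd: "cmod (b r) \<le> \<bar>R\<bar>" if "b \<in> Bs" "r \<in> Zd d" for b r
            using Hd_component_le[OF that(2), of b] R[OF that(1)] by linarith
          have "cmod ((\<Sum>r\<in>Zd d. \<Sum>s\<in>Zd d. c r * cnj (c' s) * gram (w \<epsilon>) r s) - Hd_inner d c c')
              \<le> \<bar>R\<bar> * \<bar>R\<bar> * gram_defect (w \<epsilon>)"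
            by (intro gram_sum_bound bd c abs_ge_zero)
          then show "dist (case p of (c, c') \<Rightarrow> L2_inner (Psi d m g \<gamma> (w \<epsilon>) c) (Psi d m g \<gamma> (w \<epsilon>) c')
             / of_real (sqrt (real (\<Prod>j\<in>UNIV. d j)) * (ell2_norm d (w \<epsilon>))\<^sup>2))
             (case p of (c, c') \<Rightarrow> Hd_inner d c c') < e"
            unfolding p prod.case dist_norm Psi_gram[OF w[OF elim(2)] H] using elim(1) by linarith
        qed
      qed
    qed
  qed
qed

end
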